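(* Let $\underline{N}=(N_1,\dots,N_m)$ be a stationary multivariate Hawkes process with mean intensity vector $\Lambda$, covariance density $\Omega$, and excitation matrix $\Gamma(t)=\sum_{d=1}^{D}A_d e^{-\beta_d t}u(t)\in\mathcal{E}\textit{xp}(m)$ with exciting modes $\{\beta_1,\dots,\beta_D\}$. Then the coefficient matrices $A_1,\dots,A_D\in\mathbb{R}^{m\times m}$ are a solution of the linear system of equations $$\mathbf{S}=\mathbf{A}\mathbf{H},$$ where $\mathbf{A}=[A_1,\dots,A_D]$ and $\mathbf{S}=\left[\mathcal{L}[\Omega](\beta_1),\dots,\mathcal{L}[\Omega](\beta_D)\right]$ are $m\times Dm$ block matrices, and $\mathbf{H}$ is the $Dm\times Dm$ block matrix whose $(i,j)$th $m\times m$ block ($1\le i,j\le D$) is $$\mathbf{H}_{i,j}=\frac{\mathrm{diag}(\Lambda)+\mathcal{L}[\Omega](\beta_j)+\mathcal{L}[\Omega]^{T}(\beta_i)}{\beta_j+\beta_i}.$$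
   Context: **Multivariate Hawkes process.** An $m$-dimensional counting process $\underline N=(N_1,\dots,N_m)$ such that, with $\underline{\mathcal F}^t$ the $\sigma$-algebra generated by $\underline N$ up to time $t$, $P(dN_i(t)=1\mid\underline{\mathcal F}^t)=\lambda_i(t)dt+o(dt)$ and $P(dN_i(t)>1\mid\underline{\mathcal F}^t)=o(dt)$ for each $i$, where the intensity vector $\Lambda(t)=(\lambda_1(t),\dots,\lambda_m(t))^T$ has positive entries and is given (in the stationary regime) by $$\Lambda(t)=\mathbf v+\int_{-\infty}^{t}\Gamma(t-t')\,d\underline N(t').$$ Here $\mathbf v$ is a constant vector, and $\Gamma=[\gamma_{i,j}]$ is the excitation matrix, with integrable entries. The process is stationary if it has stationary increments (equivalently, the intensity process is stationary); this holds iff the matrix $\overline\Gamma=[\|\gamma_{i,j}\|_1]$ has spectral radius $\rho(\overline\Gamma)<1$. In that case $\Lambda:=\mathbb E[\Lambda(t)]=(I-\overline\Gamma)^{-1}\mathbf v$. $\mathrm{diag}(\Lambda)$ is the diagonal matrix with diagonal $\Lambda$. **The class $\mathcal{E}\textit{xp}(m)$.** The set of matrix functions $\sum_{d=1}^D A_d e^{-\beta_d t}u(t)$ with $D\in\mathbb N$, $A_d\in\mathbb R^{m\times m}$, $\beta_d>0$, $u$ the unit step function, all entries of $\sum_d A_d e^{-\beta_d t}$ nonnegative, and $\rho\left(\sum_{d=1}^D A_d/\beta_d\right)<1$. The set $\{\beta_d\}$ is called the set of exciting modes. **Covariance density.** For $\tau>0$, $$\Omega(\tau):=\mathbb E\left[\left(d\underline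 N(t+\tau)/dt-\Lambda\right)\left(d\underline N(t)/dt-\Lambda\right)^T\right],$$ and $\Omega(-\tau)=\Omega^T(\tau)$. **Known fact (Hawkes) about $\Omega$:** $\Omega(\tau)=\Gamma(\tau)\,\mathrm{diag}(\Lambda)+(\Gamma*\Omega)(\tau)$ for $\tau>0$, where $(f*g)(t)=\int_{\mathbb R}f(x)g(t-x)dx$. **Laplace transform.** $\mathcal L[X](s)=\int_0^\infty X(t)e^{-st}dt$, applied entrywise to matrices; $\mathcal L[\Omega]^T(s)$ is the transpose of $\mathcal L[\Omega](s)$. *)

theory Defs
  imports "HOL-Probability.Probability"
begin

section \<open>Counting processes on the real line\<close>

text \<open>
  \<open>N i t \<omega>\<close> is the value at time \<open>t\<close> of a counting path of component \<open>i\<close>, normalised arbitrarily: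
  time runs over the whole line, only the increments \<open>N i b - N i a\<close> (the number of events in
  \<open>(a, b]\<close>) carry meaning, and values may be negative.
  As is usual for multivariate counting processes, distinct components have almost surely no common
  event. This cannot be dropped: if two components coincide, the measure
  \<open>E (dN\<^sub>i(t) dN\<^sub>j(t))\<close> is not \<open>diag \<Lambda> dt\<close>.
\<close>

definition counting_process :: "'a measure \<Rightarrow> ('m::finite \<Rightarrow> real \<Rightarrow> 'a \<Rightarrow> int) \<Rightarrow> bool" where
  "counting_process M N \<longleftrightarrow>
     (\<forall>i t. N i t \<in> measurable M (count_space UNIV)) \<and>
     (\<forall>i. \<forall>\<omega>\<in>space M. mono (\<lambda>t. N i t \<omega>) \<and>
        (\<forall>t. continuous (at_right t) (\<lambda>s. real_of_int (N i s \<omega>)))) \<and>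
     (\<forall>i j. i \<noteq> j \<longrightarrow> (AE \<omega> in M. \<forall>t.
        isCont (\<lambda>s. real_of_int (N i s \<omega>)) t \<or> isCont (\<lambda>s. real_of_int (N j s \<omega>)) t))"

text \<open>
  The history is generated by increments, not by the values \<open>N i s\<close>, because a normalisation such as
  \<open>N i 0 = 0\<close> would let \<open>N i s\<close> with \<open>s < 0\<close> reveal the events in \<open>(s, 0]\<close>.
\<close>

definition history :: "'a measure \<Rightarrow> ('m::finite \<Rightarrow> real \<Rightarrow> 'a \<Rightarrow> int) \<Rightarrow> real \<Rightarrow> 'a measure" where
  "history M N t = sigma (space M)
     {(\<lambda>\<omega>. N i b \<omega> - N i a \<omega>) -` A \<inter> space M | i a b A. a \<le> b \<and> b \<le> t}"

lemma subalgebra_history: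
  assumes "counting_process M N"
  shows "subalgebra M (history M N t)"
proof -
  have m: "N i s \<in> measurable M (count_space UNIV)" for i s
    using assms by (simp add: counting_process_def)
  have "(\<lambda>\<omega>. N i b \<omega> - N i a \<omega>) \<in> measurable M (count_space UNIV)" for i a b
    using m[of i b] m[of i a] by measurable
  then have *: "{(\<lambda>\<omega>. N i b \<omega> - N i a \<omega>) -` A \<inter> space M | i a b A. a \<le> b \<and> b \<le> t} \<subseteq> sets M"
    by (auto intro: measurable_sets)
  with sets.space_closed have "sets (history M N t) = sigma_sets (space M)
      {(\<lambda>\<omega>. N i b \<omega> - N i a \<omega>) -` A \<inter> space M | i a b A. a \<le> b \<and> b \<le> t}"
    unfolding history_def by (intro sets_measure_of) blast
  with sets.sigma_sets_subset[OF *] show ?thesis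
    unfolding subalgebra_def by (simp add: history_def space_measure_of_conv)
qed

definition cond_prob :: "'a measure \<Rightarrow> 'a measure \<Rightarrow> ('a \<Rightarrow> bool) \<Rightarrow> 'a \<Rightarrow> real" where
  "cond_prob M F P = real_cond_exp M F (indicat_real {\<omega>\<in>space M. P \<omega>})"

text \<open>
  A random remainder is \<open>o(h)\<close>, as \<open>h\<close> decreases to \<open>0\<close>, in the sense of the norm of \<open>L\<^sup>1(M)\<close>.
  Integrability is required because the Bochner integral of a non-integrable function is \<open>0\<close>.
\<close>

definition small_o_L1 :: "'a measure \<Rightarrow> (real \<Rightarrow> 'a \<Rightarrow> real) \<Rightarrow> bool" where
  "small_o_L1 M R \<longleftrightarrow>
     (\<forall>\<^sub>F h in at_right 0. integrable M (R h)) \<and>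
     ((\<lambda>h. (\<integral>\<omega>. \<bar>R h \<omega>\<bar> \<partial>M) / h) \<longlongrightarrow> 0) (at_right 0)"

definition has_intensity ::
  "'a measure \<Rightarrow> ('m::finite \<Rightarrow> real \<Rightarrow> 'a \<Rightarrow> int) \<Rightarrow> ('m \<Rightarrow> real \<Rightarrow> 'a \<Rightarrow> real) \<Rightarrow> bool" where
  "has_intensity M N lam \<longleftrightarrow> (\<forall>i t.
     small_o_L1 M (\<lambda>h \<omega>.
       cond_prob M (history M N t) (\<lambda>\<omega>. N i (t + h) \<omega> - N i t \<omega> = 1) \<omega> - lam i t \<omega> * h) \<and>
     small_o_L1 M (\<lambda>h. cond_prob M (history M N t) (\<lambda>\<omega>. N i (t + h) \<omega> - N i t \<omega> > 1)))"

definition stationary_increments :: "'a measure \<Rightarrow> ('m::finite \<Rightarrow> real \<Rightarrow> 'a \<Rightarrow> int) \<Rightarrow> bool" where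
  "stationary_increments M N \<longleftrightarrow> (\<forall>h.
     distr M (Pi\<^sub>M UNIV (\<lambda>_. count_space UNIV)) (\<lambda>\<omega> (i, a, b). N i (b + h) \<omega> - N i (a + h) \<omega>) =
     distr M (Pi\<^sub>M UNIV (\<lambda>_. count_space UNIV)) (\<lambda>\<omega> (i, a, b). N i b \<omega> - N i a \<omega>))"


section \<open>Hawkes processes\<close>

text \<open>
  The integral over the past of \<open>t\<close> is a pathwise Stieltjes integral. It excludes \<open>t\<close> itself, which
  makes the intensity predictable; at a fixed time this changes it on a null set only.
\<close>

definition hawkes_intensity ::
  "real^'m \<Rightarrow> (real \<Rightarrow> real^'m^'m) \<Rightarrow> ('m::finite \<Rightarrow> real \<Rightarrow> 'a \<Rightarrow> int) \<Rightarrow> 'm \<Rightarrow> real \<Rightarrow> 'a \<Rightarrow> real" where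
  "hawkes_intensity v \<Gamma> N i t \<omega> = v $ i +
     (\<Sum>j\<in>UNIV. LINT t':{..<t}|interval_measure (\<lambda>s. real_of_int (N j s \<omega>)). \<Gamma> (t - t') $ i $ j)"

definition hawkes_process ::
  "'a measure \<Rightarrow> ('m::finite \<Rightarrow> real \<Rightarrow> 'a \<Rightarrow> int) \<Rightarrow> real^'m \<Rightarrow> (real \<Rightarrow> real^'m^'m) \<Rightarrow> bool" where
  "hawkes_process M N v \<Gamma> \<longleftrightarrow>
     prob_space M \<and> counting_process M N \<and>
     (\<forall>i j. integrable lborel (\<lambda>t. \<Gamma> t $ i $ j)) \<and>
     (\<forall>i t. AE \<omega> in M. hawkes_intensity v \<Gamma> N i t \<omega> > 0) \<and>
     has_intensity M N (hawkes_intensity v \<Gamma> N)"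

definition mean_intensity ::
  "'a measure \<Rightarrow> ('m::finite \<Rightarrow> real \<Rightarrow> 'a \<Rightarrow> int) \<Rightarrow> real^'m \<Rightarrow> (real \<Rightarrow> real^'m^'m) \<Rightarrow> real \<Rightarrow> real^'m"
  where
  "mean_intensity M N v \<Gamma> t = (\<chi> i. \<integral>\<omega>. hawkes_intensity v \<Gamma> N i t \<omega> \<partial>M)"

text \<open>
  The formal derivatives \<open>dN(t)/dt\<close> are read as difference quotients whose step tends to \<open>0\<close> after
  the expectation has been taken. Square-integrability of the increments says that the expectations
  exist.
\<close>

definition diff_quot :: "('m::finite \<Rightarrow> real \<Rightarrow> 'a \<Rightarrow> int) \<Rightarrow> real \<Rightarrow> real \<Rightarrow> 'a \<Rightarrow> real^'m" where
  "diff_quot N h t \<omega> = (\<chi> i. real_of_int (N i (t + h) \<omega> - N i t \<omega>) / h)"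

definition is_covariance_density ::
  "'a measure \<Rightarrow> ('m::finite \<Rightarrow> real \<Rightarrow> 'a \<Rightarrow> int) \<Rightarrow> real^'m \<Rightarrow> (real \<Rightarrow> real^'m^'m) \<Rightarrow> bool" where
  "is_covariance_density M N \<Lambda> \<Omega> \<longleftrightarrow>
     (\<forall>i a b. integrable M (\<lambda>\<omega>. (real_of_int (N i b \<omega> - N i a \<omega>))\<^sup>2)) \<and>
     (\<forall>\<tau>>0. \<forall>t i j.
        ((\<lambda>h. \<integral>\<omega>. (diff_quot N h (t + \<tau>) \<omega> - \<Lambda>) $ i * (diff_quot N h t \<omega> - \<Lambda>) $ j \<partial>M)
          \<longlongrightarrow> \<Omega> \<tau> $ i $ j) (at_right 0)) \<and>
     (\<forall>\<tau>>0. \<Omega> (- \<tau>) = transpose (\<Omega> \<tau>))"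


section \<open>Exponential excitation matrices\<close>

definition spectral_radius :: "real^'m^'m \<Rightarrow> real" where
  "spectral_radius B =
     Max (cmod ` {z. \<exists>x::complex^'m. x \<noteq> 0 \<and> (\<chi> i j. complex_of_real (B $ i $ j)) *v x = z *s x})"

definition exp_kernel :: "'d set \<Rightarrow> ('d \<Rightarrow> real^'m^'m) \<Rightarrow> ('d \<Rightarrow> real) \<Rightarrow> real \<Rightarrow> real^'m^'m" where
  "exp_kernel I A \<beta> t = (\<Sum>d\<in>I. (exp (- \<beta> d * t) * indicat_real {0..} t) *\<^sub>R A d)"

definition Exp_class :: "(real \<Rightarrow> real^'m^'m) set" where
  "Exp_class = {exp_kernel {1..D} A \<beta> | (D::nat) A \<beta>.
     (\<forall>d\<in>{1..D}. \<beta> d > 0) \<and>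
     (\<forall>t\<ge>0. \<forall>i j. (\<Sum>d\<in>{1..D}. exp (- \<beta> d * t) *\<^sub>R A d) $ i $ j \<ge> 0) \<and>
     spectral_radius (\<Sum>d\<in>{1..D}. (1 / \<beta> d) *\<^sub>R A d) < 1}"


section \<open>Laplace transform and block matrices\<close>

definition laplace :: "(real \<Rightarrow> real^'m^'m) \<Rightarrow> real \<Rightarrow> real^'m^'m" where
  "laplace X s = (\<chi> i j. LINT t:{0..}|lborel. X t $ i $ j * exp (- s * t))"

definition diag :: "real^'m \<Rightarrow> real^'m^'m" where
  "diag x = (\<chi> i j. if i = j then x $ i else 0)"

text \<open>
  With \<open>D = CARD('d)\<close> and \<open>m = CARD('m)\<close>, the index type \<open>'d \<times> 'm\<close> has \<open>D m\<close> elements; its first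
  component numbers the block and its second component the position inside the block.
\<close>

definition block_row :: "('d::finite \<Rightarrow> real^'m^'m) \<Rightarrow> real^('d \<times> 'm)^'m" where
  "block_row B = (\<chi> k q. B (fst q) $ k $ snd q)"

definition block_matrix :: "('d::finite \<Rightarrow> 'd \<Rightarrow> real^'m^'m) \<Rightarrow> real^('d \<times> 'm)^('d \<times> 'm)" where
  "block_matrix B = (\<chi> p q. B (fst p) (fst q) $ snd p $ snd q)"

end

theory Submission
  imports Defs
begin

text \<open>
  The exponential kernel makes the intensity a linear function of the discounted pasts
  \<open>Z\<^sub>d\<^sub>k(t) = \<integral>\<^sub>s\<^sub><\<^sub>t exp (- \<beta>\<^sub>d (t - s)) dN\<^sub>k(s) = \<beta>\<^sub>d \<integral>\<^sub>0\<^sup>\<infinity> exp (- \<beta>\<^sub>d y) N\<^sub>k(t - y, t] dy\<close>, so that every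
  mixed moment is a Laplace transform of second moments of increments. Put
  \<open>F\<^sub>i\<^sub>j(x) = E (\<lambda>\<^sub>i(0) N\<^sub>j(-x, 0])\<close>. The compensator identity
  \<open>E (N\<^sub>i(a, b] X) = \<integral>\<^sub>a\<^sup>b E (\<lambda>\<^sub>i(s) X) ds\<close>, for \<open>X\<close> in the past of \<open>a\<close>, expresses the second moments
  over disjoint intervals by the primitive of \<open>F\<close>; the atom \<open>diag \<Lambda>\<close> on the diagonal comes from
  simplicity and the absence of common events, along dyadic partitions. Substituting back gives a
  renewal equation for \<open>F\<close>, which shows that \<open>F\<close> is continuously differentiable; its derivative is
  \<open>\<Omega> + \<Lambda> \<Lambda>\<^sup>T\<close>, and the Laplace transform of the equation at the exciting modes is the linear system.
\<close>

section \<open>One-sided derivatives and difference quotients\<close>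

text \<open>No density of the second moments and no regularity of \<open>F\<close> is given at the
  outset: \<open>\<Omega>\<close> is a pointwise limit of expectations, and the intensity is
  described by remainders that are small in the mean as \<open>h\<close> decreases to 0. Two
  constraints follow. Only right derivatives in time are accessible, so integration needs a
  fundamental theorem for right derivatives, with the continuity of the derivative supplied
  separately. A remainder small in L1 may be multiplied only by bounded variables, whereas the
  moments wanted involve unbounded increments; truncation and a uniform Cauchy-Schwarz bound close
  this gap. Working with \<open>F\<close> and its primitive \<open>\<Phi>\<close> postpones
  differentiation until the renewal equation, whose right side contains \<open>F\<close> only under
  integrals, provides it. The denominators \<open>\<beta> j + \<beta> i\<close> arise by
  transforming, at one mode, an exponential of another mode or a convolution with it. The baseline
  \<open>v\<close> leaves the final system because the mean equation for \<open>\<Lambda>\<close>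
  cancels the products of mean intensities.\<close>

lemma right_derivative_zero_imp_constant:
  fixes f :: "real \<Rightarrow> real"
  assumes "a \<le> b" and cont: "continuous_on {a..b} f"
    and deriv: "\<And>x. a \<le> x \<Longrightarrow> x < b \<Longrightarrow> ((\<lambda>h. (f (x + h) - f x) / h) \<longlongrightarrow> 0) (at_right 0)"
  shows "f b = f a"
proof -
  have "\<bar>f b - f a\<bar> \<le> e * (b - a)" if "e > 0" for e
  proof -
    \<comment> \<open>By continuity this set is closed, so it has a largest element. A right
      derivative equal to 0 at a point of it below \<open>b\<close> would produce larger elements,
      so the largest one is \<open>b\<close>.\<close>
    define S where "S = {a..b} \<inter> (\<lambda>x. \<bar>f x - f a\<bar> - e * (x - a)) -` {..0}"
    have "closed S"
      unfolding S_def using cont by (intro continuous_closed_preimage continuous_intros) auto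
    moreover have "S \<subseteq> {a..b}" by (auto simp: S_def)
    ultimately have "compact S" by (meson bounded_closed_interval bounded_subset compact_eq_bounded_closed)
    moreover have "a \<in> S" using \<open>a \<le> b\<close> by (auto simp: S_def)
    ultimately obtain x where x: "x \<in> S" "\<And>y. y \<in> S \<Longrightarrow> y \<le> x"
      using compact_attains_sup[of S] by blast
    have "x = b"
    proof (rule ccontr)
      assume "x \<noteq> b"
      with x(1) have xb: "a \<le> x" "x < b" by (auto simp: S_def)
      have "\<forall>\<^sub>F h in at_right 0. dist ((f (x + h) - f x) / h) 0 < e"
        using tendstoD[OF deriv[OF xb] \<open>e > 0\<close>] .
      moreover have "\<forall>\<^sub>F h in at_right 0. h \<in> {0<..<b - x}"
        using xb by (intro eventually_at_right_real) auto
      ultimately have "\<forall>\<^sub>F h in at_right (0::real). x + h \<in> S"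
      proof eventually_elim
        case (elim h)
        then have "\<bar>f (x + h) - f x\<bar> \<le> e * h"
          by (simp add: dist_real_def field_simps)
        with x(1) elim xb show ?case by (auto simp: S_def algebra_simps)
      qed
      then have "\<exists>h. x + h \<in> S \<and> h \<in> {0<..<b - x}"
        using \<open>\<forall>\<^sub>F h in at_right 0. h \<in> {0<..<b - x}\<close>
        by (intro eventually_happens'[of "at_right (0::real)"]) (auto intro: eventually_conj)
      then show False using x(2) by fastforce
    qed
    with x(1) show ?thesis by (auto simp: S_def)
  qed
  note bound = this
  have "\<bar>f b - f a\<bar> \<le> 0 + e" if "e > 0" for e
  proof -
    have "\<bar>f b - f a\<bar> \<le> e / (b - a + 1) * (b - a)" using that \<open>a \<le> b\<close> by (intro bound) simp
    also have "\<dots> \<le> e" using that \<open>a \<le> b\<close> by (simp add: field_simps)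
    finally show ?thesis by simp
  qed
  then have "\<bar>f b - f a\<bar> \<le> 0" by (rule field_le_epsilon)
  then show ?thesis by simp
qed

text \<open>The difference of \<open>f\<close> and a primitive of \<open>g\<close> has right
  derivative 0 and is therefore constant. In the application \<open>f\<close> is the mean of an
  increment weighted by a past variable, of which only the forward difference quotient is
  known.\<close>

lemma has_integral_right_derivative:
  fixes f g :: "real \<Rightarrow> real"
  assumes "a \<le> b" and f: "continuous_on {a..b} f" and g: "continuous_on {a..b} g"
    and deriv: "\<And>x. a \<le> x \<Longrightarrow> x < b \<Longrightarrow> ((\<lambda>h. (f (x + h) - f x) / h) \<longlongrightarrow> g x) (at_right 0)"
  shows "(g has_integral f b - f a) {a..b}"
proof -
  define G where "G x = integral {a..x} g" for x
  have G: "(G has_real_derivative g x) (at x within {a..b})" if "x \<in> {a..b}" for x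
    unfolding G_def by (rule integral_has_real_derivative[OF g that])
  have "(\<lambda>x. f x - G x) b = (\<lambda>x. f x - G x) a"
  proof (rule right_derivative_zero_imp_constant[OF \<open>a \<le> b\<close>])
    show "continuous_on {a..b} (\<lambda>x. f x - G x)"
      using DERIV_continuous_on[OF G] by (intro continuous_intros f) auto
    fix x assume x: "a \<le> x" "x < b"
    have "(G has_real_derivative g x) (at x within {x..b})"
      using x by (intro DERIV_subset[OF G]) auto
    then have "(G has_real_derivative g x) (at_right x)"
      using x by (simp add: at_within_Icc_at_right)
    then have "((\<lambda>h. (G (x + h) - G x) / h) \<longlongrightarrow> g x) (at_right 0)"
      unfolding has_field_derivative_iff
      by (subst (asm) at_right_to_0) (simp add: filterlim_filtermap add.commute)
    from tendsto_diff[OF deriv[OF x] this]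
    show "((\<lambda>h. (f (x + h) - G (x + h) - (f x - G x)) / h) \<longlongrightarrow> 0) (at_right 0)"
      by (simp add: diff_divide_distrib add_divide_distrib algebra_simps)
  qed
  then have "integral {a..b} g = f b - f a" by (simp add: G_def)
  with integrable_continuous_real[OF g] show ?thesis by (simp add: has_integral_integrable_integral)
qed

text \<open>Nonnegativity makes an additive function monotone, so \<open>f (n x)\<close> lies
  between its values at the two integers next to \<open>n x\<close>. The resulting error in
  \<open>f x\<close>, multiplied by any \<open>n\<close>, stays below \<open>f 1\<close>.\<close>

lemma nonneg_additive_imp_linear:
  fixes f :: "real \<Rightarrow> real"
  assumes add: "\<And>x y. 0 \<le> x \<Longrightarrow> 0 \<le> y \<Longrightarrow> f (x + y) = f x + f y"
    and nonneg: "\<And>x. 0 \<le> x \<Longrightarrow> 0 \<le> f x" and "0 \<le> x"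
  shows "f x = x * f 1"
proof -
  have "f 0 = 0" using add[of 0 0] by simp
  have nat: "f (real n * x) = real n * f x" if "0 \<le> x" for n x
    using that by (induction n) (simp_all add: \<open>f 0 = 0\<close> add distrib_right)
  have mono: "f x \<le> f y" if "0 \<le> x" "x \<le> y" for x y
    using add[of x "y - x"] nonneg[of "y - x"] that by simp
  have "real n * \<bar>f x - x * f 1\<bar> \<le> f 1" for n
  proof -
    define k where "k = nat \<lfloor>real n * x\<rfloor>"
    have "0 \<le> real n * x" using \<open>0 \<le> x\<close> by simp
    then have k: "real k \<le> real n * x" "real n * x \<le> real (k + 1)"
      unfolding k_def by linarith+
    have fk: "f (real m) = real m * f 1" for m using nat[of 1 m] by simp
    have "real k * f 1 \<le> real n * f x" "real n * f x \<le> real (k + 1) * f 1"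
      using mono[OF _ k(1)] mono[OF _ k(2)] \<open>0 \<le> real n * x\<close> fk[of k] fk[of "k + 1"] nat[OF \<open>0 \<le> x\<close>]
      by auto
    moreover have "real k * f 1 \<le> real n * x * f 1" "real n * x * f 1 \<le> real (k + 1) * f 1"
      using k nonneg[of 1] by (auto intro: mult_right_mono)
    ultimately have "\<bar>real n * f x - real n * x * f 1\<bar> \<le> f 1"
      by (simp add: algebra_simps abs_le_iff)
    also have "real n * f x - real n * x * f 1 = real n * (f x - x * f 1)"
      by (simp add: algebra_simps)
    finally show ?thesis by (simp add: abs_mult)
  qed
  then have "\<bar>f x - x * f 1\<bar> \<le> 0"
    by (metis ex_less_of_nat_mult linorder_not_le)
  then show ?thesis by simp
qed

text \<open>Cauchy's mean value theorem against \<open>h\<^sup>2\<close>, followed by the ordinary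
  one for \<open>F (x + w) - F (x - w)\<close>, writes the quotient as the mean of two values of
  \<open>g\<close> near \<open>x\<close>. Covariances over two windows of length \<open>h\<close> at
  lag \<open>x\<close> lead to such a second difference.\<close>

lemma second_difference_tendsto:
  fixes F G g :: "real \<Rightarrow> real"
  assumes G: "\<And>x. 0 < x \<Longrightarrow> (G has_real_derivative F x) (at x)"
    and F: "\<And>x. 0 < x \<Longrightarrow> (F has_real_derivative g x) (at x)"
    and g: "continuous_on {0<..} g" and "0 < x"
  shows "((\<lambda>h. (G (x + h) - 2 * G x + G (x - h)) / h\<^sup>2) \<longlongrightarrow> g x) (at_right 0)"
proof (rule tendstoI)
  fix e :: real assume "e > 0"
  have "isCont g x" using g \<open>0 < x\<close> by (simp add: continuous_on_eq_continuous_at)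
  then obtain d where d: "d > 0" "\<And>y. \<bar>y - x\<bar> < d \<Longrightarrow> \<bar>g y - g x\<bar> < e"
    using \<open>e > 0\<close> by (auto simp: continuous_at dist_real_def LIM_def) (metis abs_zero diff_self)
  have "\<forall>\<^sub>F h in at_right 0. h \<in> {0<..<min d x}"
    using d \<open>0 < x\<close> by (intro eventually_at_right_real) auto
  then show "\<forall>\<^sub>F h in at_right 0. dist ((G (x + h) - 2 * G x + G (x - h)) / h\<^sup>2) (g x) < e"
  proof eventually_elim
    case (elim h)
    define U where "U y = G (x + y) - 2 * G x + G (x - y)" for y
    have dU: "(U has_real_derivative F (x + y) - F (x - y)) (at y)" if "0 \<le> y" "y \<le> h" for y
      unfolding U_def using that elim
      by (auto intro!: derivative_eq_intros DERIV_chain2[OF G])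
    have dF: "((\<lambda>y. F (x + y) - F (x - y)) has_real_derivative g (x + y) + g (x - y)) (at y)"
      if "0 \<le> y" "y \<le> h" for y
      using that elim by (auto intro!: derivative_eq_intros DERIV_chain2[OF F])
    have "\<exists>w>0. w < h \<and> (U h - U 0) * (2 * w) = (h\<^sup>2 - 0\<^sup>2) * (F (x + w) - F (x - w))"
      using elim by (intro GMVT' DERIV_isCont[OF dU] dU) (auto intro!: derivative_eq_intros)
    then obtain w where w: "0 < w" "w < h" "U h * (2 * w) = h\<^sup>2 * (F (x + w) - F (x - w))"
      by (auto simp: U_def)
    obtain z where z: "0 < z" "z < w" "F (x + w) - F (x - w) = w * (g (x + z) + g (x - z))"
      using MVT2[OF w(1), of "\<lambda>y. F (x + y) - F (x - y)" "\<lambda>y. g (x + y) + g (x - y)"] dF w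
      by fastforce
    have "U h / h\<^sup>2 = (g (x + z) + g (x - z)) / 2"
    proof -
      have "2 * w * U h = 2 * w * (h\<^sup>2 * ((g (x + z) + g (x - z)) / 2))"
        using w(3) z(3) by (simp add: algebra_simps)
      then have "U h = h\<^sup>2 * ((g (x + z) + g (x - z)) / 2)"
        using w(1) by (metis mult_cancel_left mult_eq_0_iff order_less_irrefl zero_neq_numeral)
      then show ?thesis using elim by simp
    qed
    moreover have "\<bar>g (x + z) - g x\<bar> < e" "\<bar>g (x - z) - g x\<bar> < e"
      using z w elim by (intro d; simp)+
    moreover from this have "\<bar>(g (x + z) + g (x - z)) / 2 - g x\<bar> < e" by (simp add: abs_less_iff field_simps)
    ultimately have "\<bar>U h / h\<^sup>2 - g x\<bar> < e" by (simp only:)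
    then show ?case by (simp add: U_def dist_real_def)
  qed
qed

section \<open>Laplace transforms of subexponential functions\<close>

text \<open>Every function that is transformed below is continuous on the half line and grows more
  slowly than every exponential, so that its transform exists on all of \<open>s > 0\<close>.\<close>

definition subexponential :: "(real \<Rightarrow> real) \<Rightarrow> bool" where
  "subexponential f \<longleftrightarrow> continuous_on {0..} f \<and>
     (\<forall>\<epsilon>>0. \<exists>C. \<forall>x\<ge>0. \<bar>f x\<bar> \<le> C * exp (\<epsilon> * x))"

definition laplace_real :: "(real \<Rightarrow> real) \<Rightarrow> real \<Rightarrow> real" where
  "laplace_real f s = (LINT x:{0..}|lborel. f x * exp (- s * x))"

lemma subexponentialD:
  assumes "subexponential f" "\<epsilon> > 0"
  obtains C where "C \<ge> 0" "\<And>x. x \<ge> 0 \<Longrightarrow> \<bar>f x\<bar> \<le> C * exp (\<epsilon> * x)"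
proof -
  obtain C where C: "\<And>x. x \<ge> 0 \<Longrightarrow> \<bar>f x\<bar> \<le> C * exp (\<epsilon> * x)"
    using assms unfolding subexponential_def by blast
  from C[of 0] have "C \<ge> 0" by simp
  with C show ?thesis using that by blast
qed

lemma subexponential_cont: "subexponential f \<Longrightarrow> continuous_on {0..} f"
  by (simp add: subexponential_def)

lemma subexponential_add:
  assumes "subexponential f" "subexponential g"
  shows "subexponential (\<lambda>x. f x + g x)"
  unfolding subexponential_def
proof (intro conjI allI impI)
  show "continuous_on {0..} (\<lambda>x. f x + g x)"
    using assms by (intro continuous_intros subexponential_cont)
  fix \<epsilon> :: real assume \<epsilon>: "\<epsilon> > 0"
  obtain C where C: "\<And>x. x \<ge> 0 \<Longrightarrow> \<bar>f x\<bar> \<le> C * exp (\<epsilon> * x)"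
    using subexponentialD[OF assms(1) \<epsilon>] by blast
  obtain D where D: "\<And>x. x \<ge> 0 \<Longrightarrow> \<bar>g x\<bar> \<le> D * exp (\<epsilon> * x)"
    using subexponentialD[OF assms(2) \<epsilon>] by blast
  have "\<bar>f x + g x\<bar> \<le> (C + D) * exp (\<epsilon> * x)" if "x \<ge> 0" for x
    using C[OF that] D[OF that] by (simp add: distrib_right)
  then show "\<exists>C. \<forall>x\<ge>0. \<bar>f x + g x\<bar> \<le> C * exp (\<epsilon> * x)" by blast
qed

lemma subexponential_cmult:
  assumes "subexponential f"
  shows "subexponential (\<lambda>x. c * f x)"
  unfolding subexponential_def
proof (intro conjI allI impI)
  show "continuous_on {0..} (\<lambda>x. c * f x)"
    using assms by (intro continuous_intros subexponential_cont)
  fix \<epsilon> :: real assume \<epsilon>: "\<epsilon> > 0"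
  obtain C where C: "\<And>x. x \<ge> 0 \<Longrightarrow> \<bar>f x\<bar> \<le> C * exp (\<epsilon> * x)"
    using subexponentialD[OF assms(1) \<epsilon>] by blast
  have "\<bar>c * f x\<bar> \<le> (\<bar>c\<bar> * C) * exp (\<epsilon> * x)" if "x \<ge> 0" for x
    using mult_left_mono[OF C[OF that], of "\<bar>c\<bar>"] by (simp add: abs_mult mult.assoc)
  then show "\<exists>C. \<forall>x\<ge>0. \<bar>c * f x\<bar> \<le> C * exp (\<epsilon> * x)" by blast
qed

lemma subexponential_diff:
  assumes "subexponential f" "subexponential g"
  shows "subexponential (\<lambda>x. f x - g x)"
  using subexponential_add[OF assms(1) subexponential_cmult[OF assms(2), of "-1"]] by simp

lemma subexponential_sum:
  assumes "\<And>i. i \<in> I \<Longrightarrow> subexponential (f i)"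
  shows "subexponential (\<lambda>x. \<Sum>i\<in>I. f i x)"
  using assms
proof (induction I rule: infinite_finite_induct)
  case (insert i I) then show ?case by (simp add: subexponential_add)
qed (auto simp: subexponential_def intro!: exI[of _ 0])

lemma subexponential_const: "subexponential (\<lambda>x. c)"
  unfolding subexponential_def
proof (intro conjI allI impI)
  fix \<epsilon> :: real assume "\<epsilon> > 0"
  then have "\<bar>c\<bar> \<le> \<bar>c\<bar> * exp (\<epsilon> * x)" if "x \<ge> 0" for x
    using that by (simp add: mult_le_cancel_left1)
  then show "\<exists>C. \<forall>x\<ge>0. \<bar>c\<bar> \<le> C * exp (\<epsilon> * x)" by blast
qed simp

lemma subexponential_bounded_by:
  assumes "continuous_on {0..} f" "\<And>x. x \<ge> 0 \<Longrightarrow> \<bar>f x\<bar> \<le> g x" "subexponential g"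
  shows "subexponential f"
  unfolding subexponential_def
proof (intro conjI allI impI assms(1))
  fix \<epsilon> :: real assume \<epsilon>: "\<epsilon> > 0"
  obtain C where C: "\<And>x. x \<ge> 0 \<Longrightarrow> \<bar>g x\<bar> \<le> C * exp (\<epsilon> * x)"
    using subexponentialD[OF assms(3) \<epsilon>] by blast
  have "\<bar>f x\<bar> \<le> C * exp (\<epsilon> * x)" if "x \<ge> 0" for x
    using C[OF that] assms(2)[OF that] by linarith
  then show "\<exists>C. \<forall>x\<ge>0. \<bar>f x\<bar> \<le> C * exp (\<epsilon> * x)" by blast
qed

lemma subexponential_ident: "subexponential (\<lambda>x. x)"
  unfolding subexponential_def
proof (intro conjI allI impI)
  fix \<epsilon> :: real assume \<epsilon>: "\<epsilon> > 0"
  have "\<bar>x\<bar> \<le> 1 / \<epsilon> * exp (\<epsilon> * x)" if "x \<ge> 0" for x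
    using exp_ge_add_one_self[of "\<epsilon> * x"] \<epsilon> that by (simp add: field_simps del: exp_ge_add_one_self)
  then show "\<exists>C. \<forall>x\<ge>0. \<bar>x\<bar> \<le> C * exp (\<epsilon> * x)" by blast
qed simp

lemma subexponential_affine: "subexponential (\<lambda>y. C * (1 + y))"
  by (intro subexponential_cmult subexponential_add subexponential_const subexponential_ident)

lemma subexponential_shift:
  assumes "subexponential f" "a \<ge> 0"
  shows "subexponential (\<lambda>x. f (a + x))"
  unfolding subexponential_def
proof (intro conjI allI impI)
  show "continuous_on {0..} (\<lambda>x. f (a + x))"
    using assms
    by (intro continuous_on_compose2[OF subexponential_cont[OF assms(1)]] continuous_intros) auto
  fix \<epsilon> :: real assume \<epsilon>: "\<epsilon> > 0"
  obtain C where C: "\<And>x. x \<ge> 0 \<Longrightarrow> \<bar>f x\<bar> \<le> C * exp (\<epsilon> * x)"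
    using subexponentialD[OF assms(1) \<epsilon>] by blast
  have "\<bar>f (a + x)\<bar> \<le> (C * exp (\<epsilon> * a)) * exp (\<epsilon> * x)" if "x \<ge> 0" for x
    using C[of "a + x"] that assms(2) by (simp add: distrib_left exp_add mult.assoc)
  then show "\<exists>C. \<forall>x\<ge>0. \<bar>f (a + x)\<bar> \<le> C * exp (\<epsilon> * x)" by blast
qed

lemma integrable_exp_atLeast:
  assumes "c > 0"
  shows "set_integrable lborel {0..} (\<lambda>x::real. exp (- c * x))"
proof -
  have "(\<lambda>x. exp (- c * x)) absolutely_integrable_on {0..}"
    using assms integrable_on_exp_minus_to_infinity[OF assms, of 0]
    by (intro nonnegative_absolutely_integrable_1) auto
  moreover have "set_borel_measurable lborel {0..} (\<lambda>x::real. exp (- c * x))"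
    by (simp add: set_borel_measurable_def)
  ultimately show ?thesis
    unfolding set_integrable_def set_borel_measurable_def using integrable_completion by blast
qed

lemma laplace_integrable:
  assumes "subexponential f" "s > 0"
  shows "set_integrable lborel {0..} (\<lambda>x. f x * exp (- s * x))"
proof -
  \<comment> \<open>Half of the rate \<open>s\<close> is spent on the growth of \<open>f\<close>;
    the other half keeps the dominating exponential integrable.\<close>
  obtain C where C: "\<And>x. x \<ge> 0 \<Longrightarrow> \<bar>f x\<bar> \<le> C * exp (s / 2 * x)"
    using subexponentialD[OF assms(1), of "s / 2"] assms(2) by auto
  show ?thesis
  proof (rule set_integrable_bound)
    show "set_integrable lborel {0..} (\<lambda>x. C * exp (- (s / 2) * x))"
      using assms(2) by (intro set_integrable_mult_right integrable_exp_atLeast) auto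
    show "set_borel_measurable lborel {0..} (\<lambda>x. f x * exp (- s * x))"
      using borel_measurable_continuous_on_indicator[of "{0..}" "\<lambda>x. f x * exp (- s * x)"]
        subexponential_cont[OF assms(1)]
      by (simp add: set_borel_measurable_def continuous_intros)
    have "\<bar>f x\<bar> * exp (- s * x) \<le> C * exp (- (s / 2) * x)" if "x \<ge> 0" for x
    proof -
      have "\<bar>f x\<bar> * exp (- s * x) \<le> C * exp (s / 2 * x) * exp (- s * x)"
        by (intro mult_right_mono C that) auto
      also have "\<dots> = C * exp (s / 2 * x + - s * x)" by (simp only: exp_add mult.assoc)
      also have "s / 2 * x + - s * x = - (s / 2) * x" by (simp add: field_simps)
      finally show ?thesis .
    qed
    then have "\<bar>f x * exp (- s * x)\<bar> \<le> \<bar>C * exp (- (s / 2) * x)\<bar>" if "x \<ge> 0" for x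
      using that by (intro order_trans[OF _ abs_ge_self]) (simp add: abs_mult)
    then show "AE x in lborel. x \<in> {0..} \<longrightarrow>
        norm (f x * exp (- s * x)) \<le> norm (C * exp (- (s / 2) * x))"
      by simp
  qed
qed

text \<open>Links the Lebesgue transform to Henstock-Kurzweil integrals over bounded intervals,
  where the fundamental theorem is available.\<close>

lemma laplace_real_tendsto:
  assumes "subexponential f" "s > 0"
  shows "((\<lambda>y. integral {0..y} (\<lambda>x. f x * exp (- s * x))) \<longlongrightarrow> laplace_real f s) at_top"
proof -
  have "((\<lambda>y. LINT x:{0..y}|lborel. f x * exp (- s * x)) \<longlongrightarrow> laplace_real f s) at_top"
    unfolding laplace_real_def
    by (intro tendsto_set_lebesgue_integral_at_top laplace_integrable assms) auto
  moreover have "(LINT x:{0..y}|lborel. f x * exp (- s * x)) = integral {0..y} (\<lambda>x. f x * exp (- s * x))" for y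
    by (intro set_borel_integral_eq_integral(2) set_integrable_subset[OF laplace_integrable[OF assms]]) auto
  ultimately show ?thesis by simp
qed

lemma subexponential_exp_tendsto:
  assumes "subexponential f" "s > 0"
  shows "((\<lambda>x. f x * exp (- s * x)) \<longlongrightarrow> 0) at_top"
proof -
  obtain C where C: "\<And>x. x \<ge> 0 \<Longrightarrow> \<bar>f x\<bar> \<le> C * exp (s / 2 * x)"
    using subexponentialD[OF assms(1), of "s / 2"] assms(2) by auto
  show ?thesis
  proof (rule Lim_null_comparison)
    have "\<bar>f x\<bar> * exp (- s * x) \<le> C * exp (- (s / 2) * x)" if "x \<ge> 0" for x
    proof -
      have "\<bar>f x\<bar> * exp (- s * x) \<le> C * exp (s / 2 * x) * exp (- s * x)"
        by (intro mult_right_mono C that) auto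
      also have "\<dots> = C * exp (s / 2 * x + - s * x)" by (simp only: exp_add mult.assoc)
      also have "s / 2 * x + - s * x = - (s / 2) * x" by (simp add: field_simps)
      finally show ?thesis .
    qed
    then show "\<forall>\<^sub>F x in at_top. norm (f x * exp (- s * x)) \<le> C * exp (- (s / 2) * x)"
      by (intro eventually_mono[OF eventually_ge_at_top[of 0]]) (simp add: abs_mult)
    have "filterlim (\<lambda>x. - (s / 2) * x) at_bot at_top"
      using assms(2) by (intro filterlim_tendsto_neg_mult_at_bot[OF tendsto_const] filterlim_ident) auto
    then have "((\<lambda>x. exp (- (s / 2) * x)) \<longlongrightarrow> 0) at_top"
      by (rule filterlim_compose[OF exp_at_bot])
    from tendsto_mult[OF tendsto_const this, of C]
    show "((\<lambda>x. C * exp (- (s / 2) * x)) \<longlongrightarrow> 0) at_top" by simp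
  qed
qed

text \<open>Integration by parts on a bounded interval. The derivative rule for the transform is its
  limit, but the bounded form is needed too, for a function given by different formulas on either
  side of a point.\<close>

lemma integral_deriv_exp:
  fixes f f' :: "real \<Rightarrow> real"
  assumes "\<And>x. 0 \<le> x \<Longrightarrow> x \<le> y \<Longrightarrow> (f has_real_derivative f' x) (at x within {0..y})"
    and f': "continuous_on {0..y} f'" and "0 \<le> y"
  shows "integral {0..y} (\<lambda>x. f' x * exp (- s * x)) =
    f y * exp (- s * y) - f 0 + s * integral {0..y} (\<lambda>x. f x * exp (- s * x))"
proof -
  have f: "continuous_on {0..y} f" by (rule DERIV_continuous_on) (use assms in auto)
  have "((\<lambda>x. f' x * exp (- s * x) - s * (f x * exp (- s * x))) has_integral
      f y * exp (- s * y) - f 0 * exp (- s * 0)) {0..y}"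
    using assms(3)
    by (intro fundamental_theorem_of_calculus)
      (auto intro!: derivative_eq_intros assms(1) simp flip: has_real_derivative_iff_has_vector_derivative
        simp: algebra_simps)
  then have "integral {0..y} (\<lambda>x. f' x * exp (- s * x) - s * (f x * exp (- s * x))) =
      f y * exp (- s * y) - f 0" by (simp add: integral_unique)
  moreover have "integral {0..y} (\<lambda>x. f' x * exp (- s * x) - s * (f x * exp (- s * x))) =
    integral {0..y} (\<lambda>x. f' x * exp (- s * x)) - s * integral {0..y} (\<lambda>x. f x * exp (- s * x))"
    using f f' by (subst integral_diff) (auto intro!: integrable_continuous_real continuous_intros)
  ultimately show ?thesis by simp
qed

lemma laplace_real_deriv:
  assumes "\<And>x. 0 \<le> x \<Longrightarrow> (f has_real_derivative f' x) (at x within {0..})"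
    and f: "subexponential f" and f': "subexponential f'" and s: "s > 0"
  shows "laplace_real f' s = s * laplace_real f s - f 0"
proof (rule tendsto_unique[OF _ laplace_real_tendsto[OF f' s]])
  have "((\<lambda>y. f y * exp (- s * y) - f 0 + s * integral {0..y} (\<lambda>x. f x * exp (- s * x)))
      \<longlongrightarrow> 0 - f 0 + s * laplace_real f s) at_top"
    by (intro tendsto_intros subexponential_exp_tendsto laplace_real_tendsto f s)
  moreover have "\<forall>\<^sub>F y in at_top. f y * exp (- s * y) - f 0 + s * integral {0..y} (\<lambda>x. f x * exp (- s * x))
      = integral {0..y} (\<lambda>x. f' x * exp (- s * x))"
    using eventually_ge_at_top[of 0]
  proof eventually_elim
    case (elim y)
    then show ?case
      by (intro integral_deriv_exp[symmetric] continuous_on_subset[OF subexponential_cont[OF f']]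
          DERIV_subset[OF assms(1)]) auto
  qed
  ultimately show "((\<lambda>y. integral {0..y} (\<lambda>x. f' x * exp (- s * x)))
      \<longlongrightarrow> s * laplace_real f s - f 0) at_top"
    by (simp add: tendsto_cong)
qed simp

text \<open>Serves to transform moments whose formula changes at \<open>a\<close>: the piece up to
  \<open>a\<close> and the shifted tail are treated separately.\<close>

lemma laplace_real_split:
  assumes f: "subexponential f" and s: "s > 0" and a: "a \<ge> 0"
  shows "laplace_real f s = integral {0..a} (\<lambda>x. f x * exp (- s * x)) +
    exp (- s * a) * laplace_real (\<lambda>x. f (a + x)) s"
proof (rule tendsto_unique)
  let ?g = "\<lambda>x. f x * exp (- s * x)"
  have "filterlim (\<lambda>y::real. a + y) at_top at_top" by (intro filterlim_tendsto_add_at_top[OF tendsto_const] filterlim_ident)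
  from filterlim_compose[OF laplace_real_tendsto[OF f s] this]
  show "((\<lambda>y. integral {0..a + y} ?g) \<longlongrightarrow> laplace_real f s) at_top" .
  have "((\<lambda>y. integral {0..a} ?g + exp (- s * a) * integral {0..y} (\<lambda>x. f (a + x) * exp (- s * x)))
      \<longlongrightarrow> integral {0..a} ?g + exp (- s * a) * laplace_real (\<lambda>x. f (a + x)) s) at_top"
    by (intro tendsto_intros laplace_real_tendsto subexponential_shift assms)
  moreover have "\<forall>\<^sub>F y in at_top. integral {0..a} ?g +
      exp (- s * a) * integral {0..y} (\<lambda>x. f (a + x) * exp (- s * x)) = integral {0..a + y} ?g"
    using eventually_ge_at_top[of 0]
  proof eventually_elim
    case (elim y)
    have c: "continuous_on {0..} ?g" using subexponential_cont[OF f] by (intro continuous_intros)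
    have "integral {0..a + y} ?g = integral {0..a} ?g + integral {a..a + y} ?g"
      using a elim by (intro Henstock_Kurzweil_Integration.integral_combine[symmetric]
          integrable_continuous_real continuous_on_subset[OF c]) auto
    also have "integral {a..a + y} ?g = integral {0..y} (?g \<circ> (+) a)"
      using integral_shift_Icc_real[of 0 y ?g a] by (simp add: add.commute)
    also have "?g \<circ> (+) a = (\<lambda>x. exp (- s * a) * (f (a + x) * exp (- s * x)))"
      by (simp add: fun_eq_iff algebra_simps flip: exp_add)
    also have "integral {0..y} \<dots> = exp (- s * a) * integral {0..y} (\<lambda>x. f (a + x) * exp (- s * x))"
      by simp
    finally show ?case by simp
  qed
  ultimately show "((\<lambda>y. integral {0..a + y} ?g) \<longlongrightarrow>
      integral {0..a} ?g + exp (- s * a) * laplace_real (\<lambda>x. f (a + x)) s) at_top"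
    by (simp add: tendsto_cong)
qed simp

lemma laplace_real_add:
  assumes "subexponential f" "subexponential g" "s > 0"
  shows "laplace_real (\<lambda>x. f x + g x) s = laplace_real f s + laplace_real g s"
  unfolding laplace_real_def distrib_right
  by (intro set_integral_add laplace_integrable assms)

lemma laplace_real_cmult: "laplace_real (\<lambda>x. c * f x) s = c * laplace_real f s"
  unfolding laplace_real_def mult.assoc by simp

lemma laplace_real_diff:
  assumes "subexponential f" "subexponential g" "s > 0"
  shows "laplace_real (\<lambda>x. f x - g x) s = laplace_real f s - laplace_real g s"
  unfolding laplace_real_def left_diff_distrib
  by (intro set_integral_diff laplace_integrable assms)

lemma laplace_real_sum:
  assumes "finite I" "\<And>i. i \<in> I \<Longrightarrow> subexponential (f i)" "s > 0"
  shows "laplace_real (\<lambda>x. \<Sum>i\<in>I. f i x) s = (\<Sum>i\<in>I. laplace_real (f i) s)"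
  using assms
proof (induction I rule: finite_induct)
  case empty then show ?case by (simp add: laplace_real_def set_lebesgue_integral_def)
next
  case (insert i I) then show ?case by (simp add: laplace_real_add subexponential_sum)
qed

lemma laplace_real_const:
  assumes "s > 0"
  shows "laplace_real (\<lambda>_. c) s = c / s"
  using laplace_real_deriv[of "\<lambda>_. c" "\<lambda>_. 0" s] assms subexponential_const
  by (simp add: laplace_real_def field_simps)

lemma laplace_real_cong:
  assumes "\<And>x. x \<ge> 0 \<Longrightarrow> f x = g x"
  shows "laplace_real f s = laplace_real g s"
  unfolding laplace_real_def using assms by (intro set_lebesgue_integral_cong) auto

lemma subexponential_exp_neg:
  assumes "b \<ge> 0" shows "subexponential (\<lambda>x. exp (- b * x))"
  by (rule subexponential_bounded_by[where g = "\<lambda>_. 1"])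
    (use assms in \<open>auto intro!: continuous_intros subexponential_const\<close>)

text \<open>The solution of \<open>y' = f - b y\<close>, \<open>y 0 = 0\<close>.\<close>
definition exp_conv :: "real \<Rightarrow> (real \<Rightarrow> real) \<Rightarrow> real \<Rightarrow> real" where
  "exp_conv b f x = exp (- b * x) * integral {0..x} (\<lambda>u. exp (b * u) * f u)"

lemma has_real_derivative_integral_atLeast:
  assumes f: "continuous_on {0..} f" and "0 \<le> x"
  shows "((\<lambda>x. integral {0..x} f) has_real_derivative f x) (at x within {0..})"
proof -
  have "((\<lambda>x. integral {0..x} f) has_real_derivative f x) (at x within {0..x + 1})"
    using assms by (intro integral_has_real_derivative continuous_on_subset[OF f]) auto
  moreover have "at x within {0..x + 1} = at x within {0..}"
    by (rule at_within_nhd[of _ "{x - 1<..<x + 1}"]) auto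
  ultimately show ?thesis by simp
qed

lemma exp_conv_deriv:
  assumes f: "continuous_on {0..} f" and "0 \<le> x"
  shows "(exp_conv b f has_real_derivative f x - b * exp_conv b f x) (at x within {0..})"
proof -
  have "continuous_on {0..} (\<lambda>u. exp (b * u) * f u)" by (intro continuous_intros f)
  note has_real_derivative_integral_atLeast[OF this \<open>0 \<le> x\<close>, derivative_intros]
  have "(exp_conv b f has_real_derivative
      exp (- b * x) * (- b) * integral {0..x} (\<lambda>u. exp (b * u) * f u) + exp (b * x) * f x * exp (- b * x))
      (at x within {0..})"
    unfolding exp_conv_def by (auto intro!: derivative_eq_intros)
  also have "exp (b * x) * f x * exp (- b * x) = f x"
    by (simp add: exp_minus)
  also have "exp (- b * x) * - b * integral {0..x} (\<lambda>u. exp (b * u) * f u) + f x = f x - b * exp_conv b f x"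
    by (simp add: exp_conv_def)
  finally show ?thesis .
qed

text \<open>Inside the integral \<open>exp (b * u)\<close> is at most \<open>exp (b * x)\<close>,
  which the outer factor cancels exactly; only the length of the interval remains.\<close>

lemma exp_conv_bound:
  assumes f: "continuous_on {0..} f" and "0 \<le> x" "0 \<le> b"
    and le: "\<And>u. 0 \<le> u \<Longrightarrow> u \<le> x \<Longrightarrow> \<bar>f u\<bar> \<le> K"
  shows "\<bar>exp_conv b f x\<bar> \<le> K * x"
proof -
  have "norm (integral {0..x} (\<lambda>u. exp (b * u) * f u)) \<le> (exp (b * x) * K) * (x - 0)"
  proof (rule integral_bound)
    show "continuous_on {0..x} (\<lambda>u. exp (b * u) * f u)"
      by (intro continuous_intros continuous_on_subset[OF f]) auto
    fix u assume "u \<in> {0..x}"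
    then show "norm (exp (b * u) * f u) \<le> exp (b * x) * K"
      using le \<open>0 \<le> b\<close> by (auto simp: abs_mult intro!: mult_mono mult_left_mono)
  qed (use assms in auto)
  then have "exp (- b * x) * \<bar>integral {0..x} (\<lambda>u. exp (b * u) * f u)\<bar> \<le> exp (- b * x) * ((exp (b * x) * K) * x)"
    by (intro mult_left_mono) auto
  also have "\<dots> = K * x" by (simp add: exp_minus)
  finally show ?thesis by (simp add: exp_conv_def abs_mult)
qed

lemma subexponential_exp_conv:
  assumes f: "subexponential f" and "0 \<le> b"
  shows "subexponential (exp_conv b f)"
  unfolding subexponential_def
proof (intro conjI allI impI)
  show "continuous_on {0..} (exp_conv b f)"
    by (rule DERIV_continuous_on[OF exp_conv_deriv]) (use subexponential_cont[OF f] in auto)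
  fix \<epsilon> :: real assume "\<epsilon> > 0"
  \<comment> \<open>One half of the rate absorbs the growth of \<open>f\<close>, the other the
    linear factor \<open>x\<close> from \<open>exp_conv_bound\<close>.\<close>
  then have \<epsilon>: "\<epsilon> / 2 > 0" by simp
  obtain C where C: "C \<ge> 0" "\<And>x. x \<ge> 0 \<Longrightarrow> \<bar>f x\<bar> \<le> C * exp (\<epsilon> / 2 * x)"
    using subexponentialD[OF f \<epsilon>] by blast
  obtain D where D: "\<And>x. x \<ge> 0 \<Longrightarrow> \<bar>x\<bar> \<le> D * exp (\<epsilon> / 2 * x)"
    using subexponentialD[OF subexponential_ident \<epsilon>] by blast
  have "\<bar>exp_conv b f x\<bar> \<le> (C * D) * exp (\<epsilon> * x)" if "x \<ge> 0" for x
  proof -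
    have "\<bar>f u\<bar> \<le> C * exp (\<epsilon> / 2 * x)" if "0 \<le> u" "u \<le> x" for u
      using C(2)[OF \<open>0 \<le> u\<close>] mult_left_mono[of "exp (\<epsilon> / 2 * u)" "exp (\<epsilon> / 2 * x)" C] that C(1) \<open>\<epsilon> > 0\<close>
      by simp
    then have "\<bar>exp_conv b f x\<bar> \<le> C * exp (\<epsilon> / 2 * x) * x"
      using that assms(2) by (intro exp_conv_bound subexponential_cont[OF f])
    also have "\<dots> \<le> C * exp (\<epsilon> / 2 * x) * (D * exp (\<epsilon> / 2 * x))"
      using D[OF that] C(1) by (intro mult_left_mono) auto
    also have "\<dots> = (C * D) * (exp (\<epsilon> / 2 * x) * exp (\<epsilon> / 2 * x))" by simp
    also have "exp (\<epsilon> / 2 * x) * exp (\<epsilon> / 2 * x) = exp (\<epsilon> * x)" by (simp flip: exp_add)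
    finally show ?thesis .
  qed
  then show "\<exists>C. \<forall>x\<ge>0. \<bar>exp_conv b f x\<bar> \<le> C * exp (\<epsilon> * x)" by blast
qed

text \<open>Transforming the differential equation \<open>y' = f - b y\<close> with zero initial
  value gives \<open>L f - b L y = s L y\<close>.\<close>

lemma laplace_real_exp_conv:
  assumes f: "subexponential f" and b: "0 \<le> b" and s: "0 < s"
  shows "laplace_real (exp_conv b f) s = laplace_real f s / (s + b)"
proof -
  note e = subexponential_exp_conv[OF f b]
  have "laplace_real (\<lambda>x. f x - b * exp_conv b f x) s = s * laplace_real (exp_conv b f) s - exp_conv b f 0"
    by (intro laplace_real_deriv exp_conv_deriv subexponential_cont[OF f] e s
        subexponential_diff subexponential_cmult f)
  moreover have "exp_conv b f 0 = 0" by (simp add: exp_conv_def)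
  ultimately have "laplace_real f s - b * laplace_real (exp_conv b f) s = s * laplace_real (exp_conv b f) s"
    by (simp add: laplace_real_diff laplace_real_cmult subexponential_cmult f e s)
  with b s show ?thesis by (simp add: field_simps)
qed

text \<open>The substitution \<open>u = x - y\<close>. Second moments produce the reversed argument,
  while the differential equation is attached to the other form.\<close>

lemma exp_conv_reflect:
  assumes "0 \<le> x" and "continuous_on {0..} f"
  shows "integral {0..x} (\<lambda>y. f (x - y) * exp (- b * y)) = exp_conv b f x"
proof -
  let ?g = "\<lambda>u. f u * exp (- b * (x - u))"
  have "continuous_on {0..x} ?g"
    using assms(2) by (auto intro!: continuous_intros intro: continuous_on_subset)
  then have "(?g has_integral integral {0..x} ?g) (cbox 0 x)"
    by (simp add: integrable_integral integrable_continuous_real)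
  from has_integral_affinity[OF this, of "-1" x]
  have "((\<lambda>y. f (x - y) * exp (- b * y)) has_integral integral {0..x} ?g) {0..x}"
    using assms(1) by (simp add: image_affinity_atLeastAtMost)
  then have "integral {0..x} (\<lambda>y. f (x - y) * exp (- b * y)) = integral {0..x} ?g"
    by (rule integral_unique)
  also have "\<dots> = exp_conv b f x"
    unfolding exp_conv_def
    by (subst integral_mult_right[symmetric]) (simp add: right_diff_distrib exp_diff exp_minus field_simps)
  finally show ?thesis .
qed

lemma laplace_real_abs_le:
  assumes g: "subexponential g" and s: "0 < s" and le: "\<And>x. 0 \<le> x \<Longrightarrow> \<bar>f x\<bar> \<le> g x"
  shows "\<bar>laplace_real f s\<bar> \<le> laplace_real g s"
proof -
  have "norm (LINT x:{0..}|lborel. f x * exp (- s * x)) \<le> (LINT x:{0..}|lborel. g x * exp (- s * x))"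
    unfolding set_lebesgue_integral_def
  proof (rule order_trans[OF integral_norm_bound], cases "integrable lborel (\<lambda>x. norm (indicat_real {0..} x *\<^sub>R (f x * exp (- s * x))))")
    case True
    then show "(\<integral>x. norm (indicat_real {0..} x *\<^sub>R (f x * exp (- s * x))) \<partial>lborel) \<le>
        (\<integral>x. indicat_real {0..} x *\<^sub>R (g x * exp (- s * x)) \<partial>lborel)"
      using laplace_integrable[OF g s] le
      by (intro integral_mono) (auto simp: set_integrable_def indicator_def abs_mult intro!: mult_right_mono)
  next
    case False
    \<comment> \<open>If the integrand is not integrable, the Bochner integral of its norm is 0 by
      convention, so the bound reduces to nonnegativity of the right side. This lets the lemma be
      applied without any regularity of \<open>f\<close>.\<close>
    have "0 \<le> g x" if "0 \<le> x" for x using le[OF that] by linarith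
    then have "0 \<le> (\<integral>x. indicat_real {0..} x *\<^sub>R (g x * exp (- s * x)) \<partial>lborel)"
      by (intro Bochner_Integration.integral_nonneg_AE AE_I2) (auto simp: indicator_def)
    then show "(\<integral>x. norm (indicat_real {0..} x *\<^sub>R (f x * exp (- s * x))) \<partial>lborel) \<le>
        (\<integral>x. indicat_real {0..} x *\<^sub>R (g x * exp (- s * x)) \<partial>lborel)"
      using not_integrable_integral_eq[OF False] by simp
  qed
  then show ?thesis by (simp add: laplace_real_def)
qed

lemma laplace_real_ident:
  assumes "0 < s"
  shows "laplace_real (\<lambda>x. x) s = 1 / s\<^sup>2"
proof -
  have "laplace_real (\<lambda>_. 1) s = s * laplace_real (\<lambda>x. x) s - 0"
    by (intro laplace_real_deriv subexponential_ident subexponential_const assms) (auto intro!: derivative_eq_intros)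
  with assms show ?thesis by (simp add: laplace_real_const field_simps power2_eq_square)
qed

lemma laplace_real_exp:
  assumes "0 < s" "0 \<le> b"
  shows "laplace_real (\<lambda>x. exp (- b * x)) s = 1 / (s + b)"
proof -
  note e = subexponential_exp_neg[OF assms(2)]
  have "laplace_real (\<lambda>x. - b * exp (- b * x)) s = s * laplace_real (\<lambda>x. exp (- b * x)) s - exp (- b * 0)"
    by (intro laplace_real_deriv subexponential_cmult e assms) (auto intro!: derivative_eq_intros)
  then have "- b * laplace_real (\<lambda>x. exp (- b * x)) s = s * laplace_real (\<lambda>x. exp (- b * x)) s - 1"
    by (simp only: laplace_real_cmult) simp
  then have "(s + b) * laplace_real (\<lambda>x. exp (- b * x)) s = 1" by (simp add: algebra_simps)
  then show ?thesis using assms by (simp add: field_simps)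
qed

lemma integral_exp_neg:
  fixes s :: real
  assumes "0 < s" "0 \<le> x"
  shows "integral {0..x} (\<lambda>y. exp (- s * y)) = (1 - exp (- s * x)) / s"
proof -
  have "integral {0..x} (\<lambda>y. 0 * exp (- s * y)) = 1 * exp (- s * x) - 1 + s * integral {0..x} (\<lambda>y. 1 * exp (- s * y))"
    by (rule integral_deriv_exp) (use assms in auto)
  with assms show ?thesis by (simp add: field_simps)
qed

section \<open>Stationary increments\<close>

lemma integral_Cauchy_Schwarz_nonneg:
  fixes f g :: "'a \<Rightarrow> real"
  assumes [measurable]: "f \<in> borel_measurable M" "g \<in> borel_measurable M"
    and f2: "integrable M (\<lambda>x. (f x)\<^sup>2)" and g2: "integrable M (\<lambda>x. (g x)\<^sup>2)"
    and fg: "integrable M (\<lambda>x. f x * g x)"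
    and nonneg: "\<And>x. x \<in> space M \<Longrightarrow> 0 \<le> f x" "\<And>x. x \<in> space M \<Longrightarrow> 0 \<le> g x"
  shows "(\<integral>x. f x * g x \<partial>M) \<le> sqrt (\<integral>x. (f x)\<^sup>2 \<partial>M) * sqrt (\<integral>x. (g x)\<^sup>2 \<partial>M)"
proof -
  have "(\<integral>\<^sup>+x. ennreal (f x) * ennreal (g x) \<partial>M)\<^sup>2 \<le>
      (\<integral>\<^sup>+x. (ennreal (f x))\<^sup>2 \<partial>M) * (\<integral>\<^sup>+x. (ennreal (g x))\<^sup>2 \<partial>M)"
    by (rule Cauchy_Schwarz_nn_integral) measurable
  also have "(\<integral>\<^sup>+x. (ennreal (f x))\<^sup>2 \<partial>M) = (\<integral>\<^sup>+x. ennreal ((f x)\<^sup>2) \<partial>M)"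
    by (intro nn_integral_cong) (simp add: ennreal_power nonneg)
  also have "\<dots> = ennreal (\<integral>x. (f x)\<^sup>2 \<partial>M)" by (intro nn_integral_eq_integral f2) simp
  also have "(\<integral>\<^sup>+x. (ennreal (g x))\<^sup>2 \<partial>M) = (\<integral>\<^sup>+x. ennreal ((g x)\<^sup>2) \<partial>M)"
    by (intro nn_integral_cong) (simp add: ennreal_power nonneg)
  also have "\<dots> = ennreal (\<integral>x. (g x)\<^sup>2 \<partial>M)" by (intro nn_integral_eq_integral g2) simp
  also have "(\<integral>\<^sup>+x. ennreal (f x) * ennreal (g x) \<partial>M) = (\<integral>\<^sup>+x. ennreal (f x * g x) \<partial>M)"
    by (intro nn_integral_cong) (simp add: ennreal_mult' nonneg)
  also have "\<dots> = ennreal (\<integral>x. f x * g x \<partial>M)"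
    by (intro nn_integral_eq_integral fg) (simp add: nonneg AE_I2)
  finally have "ennreal ((\<integral>x. f x * g x \<partial>M)\<^sup>2) \<le> ennreal ((\<integral>x. (f x)\<^sup>2 \<partial>M) * (\<integral>x. (g x)\<^sup>2 \<partial>M))"
    by (simp add: ennreal_power ennreal_mult nonneg)
  then have "(\<integral>x. f x * g x \<partial>M)\<^sup>2 \<le> (\<integral>x. (f x)\<^sup>2 \<partial>M) * (\<integral>x. (g x)\<^sup>2 \<partial>M)"
    by (subst (asm) ennreal_le_iff) auto
  then show ?thesis by (metis real_le_rsqrt real_sqrt_mult)
qed

text \<open>The points of the dyadic grid of mesh \<open>y / 2 ^ n\<close> on \<open>[0, y]\<close>.
  Point \<open>p\<close> of level \<open>n\<close> is point \<open>2 * p\<close> of level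
  \<open>n + 1\<close>, so the partitions are nested.\<close>

definition cell :: "real \<Rightarrow> nat \<Rightarrow> nat \<Rightarrow> real" where
  "cell y n p = y * real p / 2 ^ n"

lemma cell_Suc: "cell y n (Suc p) = y / 2 ^ n + cell y n p"
  by (simp add: cell_def field_simps)

lemma cell_mono: "0 \<le> y \<Longrightarrow> p \<le> q \<Longrightarrow> cell y n p \<le> cell y n q"
  by (simp add: cell_def divide_right_mono mult_left_mono)

lemma cell_0 [simp]: "cell y n 0 = 0" and cell_last [simp]: "cell y n (2 ^ n) = y"
  by (simp_all add: cell_def)

lemma mesh_filterlim: "0 < y \<Longrightarrow> filterlim (\<lambda>n. y / 2 ^ n :: real) (at_right 0) sequentially"
  unfolding filterlim_at
  by (auto intro!: eventually_sequentiallyI LIMSEQ_divide_realpow_zero)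

definition increment :: "('m \<Rightarrow> real \<Rightarrow> 'a \<Rightarrow> int) \<Rightarrow> 'm \<Rightarrow> real \<Rightarrow> real \<Rightarrow> 'a \<Rightarrow> real" where
  "increment N i a b \<omega> = real_of_int (N i b \<omega> - N i a \<omega>)"

text \<open>Square integrability is taken over from the hypothesis on the covariance density. The
  density itself stays outside, because its value is identified only after the second moments have
  been computed.\<close>

locale stationary_hawkes = prob_space M
  for M :: "'a measure"
    and N :: "'m::finite \<Rightarrow> real \<Rightarrow> 'a \<Rightarrow> int"
    and v \<Lambda> :: "real^'m"
    and \<Gamma> :: "real \<Rightarrow> real^'m^'m"
    and A :: "'d::finite \<Rightarrow> real^'m^'m"
    and \<beta> :: "'d \<Rightarrow> real" +
  assumes hawkes: "hawkes_process M N v \<Gamma>"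
    and stationary: "stationary_increments M N"
    and mean: "mean_intensity M N v \<Gamma> t = \<Lambda>"
    and inc_sq_integrable: "integrable M (\<lambda>\<omega>. (increment N i a b \<omega>)\<^sup>2)"
    and kernel: "\<Gamma> = exp_kernel UNIV A \<beta>"
    and modes: "\<beta> d > 0"
begin

abbreviation "inc \<equiv> increment N"

lemma counting: "counting_process M N"
  using hawkes by (simp add: hawkes_process_def)

lemma N_measurable [measurable]: "N i t \<in> measurable M (count_space UNIV)"
  using counting by (simp add: counting_process_def)

lemma N_mono: "\<omega> \<in> space M \<Longrightarrow> a \<le> b \<Longrightarrow> N i a \<omega> \<le> N i b \<omega>"
  using counting by (auto simp: counting_process_def mono_def)

lemma N_right_continuous: "\<omega> \<in> space M \<Longrightarrow> continuous (at_right t) (\<lambda>s. real_of_int (N i s \<omega>))"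
  using counting by (auto simp: counting_process_def)

lemma inc_measurable [measurable]: "inc i a b \<in> borel_measurable M"
  unfolding increment_def by measurable

lemma inc_event [measurable]: "{\<omega>\<in>space M. P (N i b \<omega> - N i a \<omega>)} \<in> sets M"
proof -
  have "(\<lambda>\<omega>. N i b \<omega> - N i a \<omega>) \<in> measurable M (count_space UNIV)" by measurable
  from measurable_sets[OF this, of "Collect P"] show ?thesis
    by (simp add: vimage_def Int_def conj_commute)
qed

lemma inc_nonneg: "\<omega> \<in> space M \<Longrightarrow> a \<le> b \<Longrightarrow> 0 \<le> inc i a b \<omega>"
  using N_mono[of \<omega> a b i] by (simp add: increment_def)

lemma inc_combine: "inc i a b \<omega> + inc i b c \<omega> = inc i a c \<omega>"
  by (simp add: increment_def)

lemma inc_mono: "\<omega> \<in> space M \<Longrightarrow> a' \<le> a \<Longrightarrow> b \<le> b' \<Longrightarrow> inc i a b \<omega> \<le> inc i a' b' \<omega>"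
  using N_mono[of \<omega> a' a i] N_mono[of \<omega> b b' i] by (simp add: increment_def)

lemma inc_prod_integrable: "integrable M (\<lambda>\<omega>. inc i a b \<omega> * inc j c d \<omega>)"
proof (rule Bochner_Integration.integrable_bound)
  show "integrable M (\<lambda>\<omega>. (inc i a b \<omega>)\<^sup>2 + (inc j c d \<omega>)\<^sup>2)"
    by (intro Bochner_Integration.integrable_add inc_sq_integrable)
  have "norm (x * y) \<le> norm (x\<^sup>2 + y\<^sup>2)" for x y :: real
  proof -
    have "2 * (\<bar>x\<bar> * \<bar>y\<bar>) \<le> x\<^sup>2 + y\<^sup>2"
      using sum_squares_bound[of "\<bar>x\<bar>" "\<bar>y\<bar>"] by simp
    moreover have "0 \<le> \<bar>x\<bar> * \<bar>y\<bar>" by simp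
    ultimately have "\<bar>x\<bar> * \<bar>y\<bar> \<le> x\<^sup>2 + y\<^sup>2" by linarith
    then show ?thesis by (simp add: abs_mult)
  qed
  then show "AE \<omega> in M. norm (inc i a b \<omega> * inc j c d \<omega>) \<le> norm ((inc i a b \<omega>)\<^sup>2 + (inc j c d \<omega>)\<^sup>2)"
    by simp
qed measurable

lemma inc_integrable: "integrable M (inc i a b)"
  by (rule square_integrable_imp_integrable) (use inc_sq_integrable in auto)

text \<open>Stationarity is an equality of laws on a product space indexed by component and end
  points. A function of two increments depends on two coordinates of that space, so its expectation
  is determined by the law.\<close>

lemma expectation_shift:
  fixes f :: "int \<Rightarrow> int \<Rightarrow> real"
  shows "(\<integral>\<omega>. f (N i (b + h) \<omega> - N i (a + h) \<omega>) (N j (d + h) \<omega> - N j (c + h) \<omega>) \<partial>M) =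
    (\<integral>\<omega>. f (N i b \<omega> - N i a \<omega>) (N j d \<omega> - N j c \<omega>) \<partial>M)"
proof -
  let ?P = "Pi\<^sub>M UNIV (\<lambda>_::'m \<times> real \<times> real. count_space (UNIV :: int set))"
  define X where "X h \<omega> = (\<lambda>(i, a, b). N i (b + h) \<omega> - N i (a + h) \<omega>)" for h \<omega>
  define g where "g y = f (y (i, a, b)) (y (j, c, d))" for y
  have X [measurable]: "X h \<in> measurable M ?P" for h
    unfolding X_def by (rule measurable_PiM_single') (auto split: prod.splits)
  have comp [measurable]: "(\<lambda>y. y p) \<in> measurable ?P (count_space UNIV)" for p
    by (rule measurable_component_singleton) simp
  \<comment> \<open>The coordinates are integers, so fixing one of them at each of countably many
    values gives measurability of \<open>g\<close> for arbitrary \<open>f\<close>.\<close>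
  have "(\<lambda>y. f m (y (j, c, d))) \<in> borel_measurable ?P" for m
    by (rule measurable_compose[OF comp]) simp
  then have g: "g \<in> borel_measurable ?P"
    unfolding g_def by (rule measurable_compose_countable[OF _ comp])
  have eq: "distr M ?P (X h) = distr M ?P (X 0)"
    using stationary unfolding stationary_increments_def X_def by (simp add: case_prod_unfold)
  have "(\<integral>\<omega>. g (X h \<omega>) \<partial>M) = (\<integral>\<omega>. g (X 0 \<omega>) \<partial>M)"
    using integral_distr[OF X g, of h] integral_distr[OF X g, of 0] eq by simp
  then show ?thesis by (simp add: g_def X_def)
qed

lemma inc_second_moment_shift:
  "(\<integral>\<omega>. inc i (a + h) (b + h) \<omega> * inc j (c + h) (d + h) \<omega> \<partial>M) = (\<integral>\<omega>. inc i a b \<omega> * inc j c d \<omega> \<partial>M)"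
  unfolding increment_def by (rule expectation_shift[of "\<lambda>x y. real_of_int x * real_of_int y"])

lemma inc_mean_shift: "(\<integral>\<omega>. inc i (a + h) (b + h) \<omega> \<partial>M) = (\<integral>\<omega>. inc i a b \<omega> \<partial>M)"
  unfolding increment_def by (rule expectation_shift[of "\<lambda>x y. real_of_int x" i b h a i b a])

lemma inc_prob_shift:
  "prob {\<omega>\<in>space M. P (N i (b + h) \<omega> - N i (a + h) \<omega>)} = prob {\<omega>\<in>space M. P (N i b \<omega> - N i a \<omega>)}"
proof -
  have eq: "prob {\<omega>\<in>space M. P (N i b \<omega> - N i a \<omega>)} = (\<integral>\<omega>. of_bool (P (N i b \<omega> - N i a \<omega>)) \<partial>M)" for a b
  proof -
    have "(\<integral>\<omega>. of_bool (P (N i b \<omega> - N i a \<omega>)) \<partial>M) = (\<integral>\<omega>. indicat_real {\<omega>\<in>space M. P (N i b \<omega> - N i a \<omega>)} \<omega> \<partial>M)"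
      by (intro Bochner_Integration.integral_cong) (auto simp: indicator_def)
    also have "\<dots> = prob {\<omega>\<in>space M. P (N i b \<omega> - N i a \<omega>)}"
      by (simp add: Int_absorb1 subset_iff)
    finally show ?thesis by simp
  qed
  show ?thesis unfolding eq by (rule expectation_shift[of "\<lambda>x y. of_bool (P x)" i b h a i b a])
qed

lemma inc_mean_linear:
  assumes "a \<le> b"
  shows "(\<integral>\<omega>. inc i a b \<omega> \<partial>M) = (b - a) * (\<integral>\<omega>. inc i 0 1 \<omega> \<partial>M)"
proof -
  let ?f = "\<lambda>x. \<integral>\<omega>. inc i 0 x \<omega> \<partial>M"
  have "?f (b - a) = (b - a) * ?f 1"
  proof (rule nonneg_additive_imp_linear)
    fix x y :: real assume "0 \<le> x" "0 \<le> y"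
    have "?f (x + y) = (\<integral>\<omega>. inc i 0 x \<omega> + inc i x (y + x) \<omega> \<partial>M)"
      by (simp add: inc_combine add.commute)
    also have "\<dots> = ?f x + (\<integral>\<omega>. inc i x (y + x) \<omega> \<partial>M)"
      by (intro Bochner_Integration.integral_add inc_integrable)
    also have "(\<integral>\<omega>. inc i x (y + x) \<omega> \<partial>M) = ?f y" using inc_mean_shift[of i 0 x y] by simp
    finally show "?f (x + y) = ?f x + ?f y" .
  next
    fix x :: real assume "0 \<le> x"
    then show "0 \<le> ?f x" by (intro Bochner_Integration.integral_nonneg_AE AE_I2 inc_nonneg)
  qed (use assms in auto)
  moreover have "(\<integral>\<omega>. inc i a b \<omega> \<partial>M) = ?f (b - a)" using inc_mean_shift[of i 0 a "b - a"] by simp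
  ultimately show ?thesis by simp
qed

section \<open>Second moment of a window of given length\<close>

definition sq where "sq i h = (\<integral>\<omega>. (inc i 0 h \<omega>)\<^sup>2 \<partial>M)"

lemma sq_shift: "(\<integral>\<omega>. (inc i a b \<omega>)\<^sup>2 \<partial>M) = sq i (b - a)"
  using inc_second_moment_shift[of i 0 a "b - a" i 0 "b - a"] by (simp add: sq_def power2_eq_square)

lemma sq_nonneg: "0 \<le> sq i h"
  by (simp add: sq_def)

lemma sq_mono: "0 \<le> h \<Longrightarrow> h \<le> h' \<Longrightarrow> sq i h \<le> sq i h'"
  unfolding sq_def
  by (intro integral_mono_AE inc_sq_integrable AE_I2 power_mono inc_mono inc_nonneg) auto

text \<open>Unit windows cover the interval, and the square of a sum of \<open>n\<close> terms is at
  most \<open>n\<close> times the sum of their squares. With \<open>n\<close> rounded up from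
  \<open>y\<close> this gives quadratic growth, so that by Cauchy-Schwarz moments against a fixed
  window grow at most linearly and their Laplace transforms converge.\<close>

lemma sq_le:
  assumes "0 \<le> y"
  shows "sq i y \<le> sq i 1 * (1 + y)\<^sup>2"
proof -
  define n where "n = nat \<lceil>y\<rceil>"
  have n: "y \<le> real n" "real n \<le> 1 + y" unfolding n_def using assms by linarith+
  have "sq i y \<le> sq i (real n)" using assms n by (intro sq_mono)
  also have "\<dots> \<le> (\<integral>\<omega>. real n * (\<Sum>p<n. (inc i (real p) (real p + 1) \<omega>)\<^sup>2) \<partial>M)"
    unfolding sq_def
  proof (intro integral_mono inc_sq_integrable)
    show "integrable M (\<lambda>\<omega>. real n * (\<Sum>p<n. (inc i (real p) (real p + 1) \<omega>)\<^sup>2))"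
      by (intro integrable_mult_right Bochner_Integration.integrable_sum inc_sq_integrable)
    fix \<omega> assume "\<omega> \<in> space M"
    have "inc i 0 (real n) \<omega> = (\<Sum>p<n. inc i (real p) (real p + 1) \<omega>)"
      using sum_lessThan_telescope[of "\<lambda>p. real_of_int (N i (real p) \<omega>)" n]
      by (simp add: increment_def add.commute)
    then show "(inc i 0 (real n) \<omega>)\<^sup>2 \<le> real n * (\<Sum>p<n. (inc i (real p) (real p + 1) \<omega>)\<^sup>2)"
      using sum_squared_le_sum_of_squares[of "\<lambda>p. inc i (real p) (real p + 1) \<omega>" "{..<n}"]
      by (simp add: mult.commute)
  qed
  also have "\<dots> = real n * (\<Sum>p<n. sq i 1)"
    by (simp add: Bochner_Integration.integral_sum inc_sq_integrable sq_shift)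
  also have "\<dots> = sq i 1 * (real n)\<^sup>2" by (simp add: power2_eq_square)
  also have "\<dots> \<le> sq i 1 * (1 + y)\<^sup>2"
    using n sq_nonneg by (intro mult_left_mono power_mono) auto
  finally show ?thesis .
qed

lemma inc_right_tendsto:
  assumes "\<omega> \<in> space M"
  shows "((\<lambda>h. inc i t (t + h) \<omega>) \<longlongrightarrow> 0) (at_right 0)"
proof -
  have "((\<lambda>s. real_of_int (N i s \<omega>)) \<longlongrightarrow> real_of_int (N i t \<omega>)) (at_right t)"
    using N_right_continuous[OF assms] by (simp add: continuous_within)
  then have "((\<lambda>h. real_of_int (N i (h + t) \<omega>)) \<longlongrightarrow> real_of_int (N i t \<omega>)) (at_right 0)"
    by (subst (asm) at_right_to_0) (simp add: filterlim_filtermap)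
  from tendsto_diff[OF this tendsto_const, of "real_of_int (N i t \<omega>)"]
  show ?thesis by (simp add: increment_def add.commute)
qed

text \<open>Right continuity of the paths and dominated convergence give the limit along
  \<open>1 / (n + 1)\<close>; monotonicity extends it to all small windows. The continuity of
  \<open>F\<close> rests on it.\<close>

lemma sq_tendsto_0: "(sq i \<longlongrightarrow> 0) (at_right 0)"
proof (rule tendstoI)
  fix e :: real assume "e > 0"
  define h where "h n = 1 / real (Suc n)" for n
  have h: "h \<longlonglongrightarrow> 0" "\<And>n. 0 < h n" "\<And>n. h n \<le> 1"
    unfolding h_def using LIMSEQ_inverse_real_of_nat by (auto simp: inverse_eq_divide)
  have "(\<lambda>n. sq i (h n)) \<longlonglongrightarrow> (\<integral>\<omega>. 0 \<partial>M)"
    unfolding sq_def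
  proof (rule integral_dominated_convergence)
    show "integrable M (\<lambda>\<omega>. (inc i 0 1 \<omega>)\<^sup>2)" by (rule inc_sq_integrable)
    have "(\<lambda>n. inc i 0 (h n) \<omega>) \<longlonglongrightarrow> 0" if "\<omega> \<in> space M" for \<omega>
      using filterlim_compose[OF inc_right_tendsto[OF that, of i 0], of h sequentially] h
      by (simp add: filterlim_at less_imp_neq[symmetric] eventually_sequentiallyI)
    from tendsto_power[OF this, of _ 2]
    show "AE \<omega> in M. (\<lambda>n. (inc i 0 (h n) \<omega>)\<^sup>2) \<longlonglongrightarrow> 0"
      by (intro AE_I2) simp
    show "AE \<omega> in M. norm ((inc i 0 (h n) \<omega>)\<^sup>2) \<le> (inc i 0 1 \<omega>)\<^sup>2" for n
      using h(2)[of n] h(3)[of n] by (auto intro!: AE_I2 power_mono inc_mono inc_nonneg)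
  qed auto
  then have "\<forall>\<^sub>F n in sequentially. sq i (h n) < e"
    using order_tendstoD(2)[of _ 0 sequentially e] \<open>e > 0\<close> by simp
  then obtain n where n: "sq i (h n) < e" by (auto simp: eventually_sequentially)
  have "\<forall>\<^sub>F x in at_right 0. x \<in> {0<..<h n}" by (intro eventually_at_right_real h)
  then show "\<forall>\<^sub>F x in at_right 0. dist (sq i x) 0 < e"
  proof eventually_elim
    case (elim x)
    then have "sq i x \<le> sq i (h n)" by (intro sq_mono) auto
    with n show ?case by (simp add: dist_real_def sq_nonneg)
  qed
qed

lemma inc_second_moment_le:
  assumes "a \<le> b" "c \<le> d"
  shows "(\<integral>\<omega>. inc i a b \<omega> * inc j c d \<omega> \<partial>M) \<le> sqrt (sq i (b - a)) * sqrt (sq j (d - c))"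
  unfolding sq_shift[symmetric]
  by (intro integral_Cauchy_Schwarz_nonneg inc_sq_integrable inc_prod_integrable inc_nonneg assms) measurable

lemma inc_second_moment_nonneg:
  assumes "a \<le> b" "c \<le> d"
  shows "0 \<le> (\<integral>\<omega>. inc i a b \<omega> * inc j c d \<omega> \<partial>M)"
  by (intro Bochner_Integration.integral_nonneg_AE AE_I2 mult_nonneg_nonneg inc_nonneg assms)

lemma sqrt_sq_le: "0 \<le> y \<Longrightarrow> sqrt (sq i y) \<le> sqrt (sq i 1) * (1 + y)"
  using real_sqrt_le_mono[OF sq_le[of y i]] by (simp add: real_sqrt_mult)

section \<open>Testing the intensity against the past\<close>

definition intens where "intens = hawkes_intensity v \<Gamma> N"

lemma intensity:
  "small_o_L1 M (\<lambda>h \<omega>.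
     cond_prob M (history M N t) (\<lambda>\<omega>. N i (t + h) \<omega> - N i t \<omega> = 1) \<omega> - intens i t \<omega> * h)"
  "small_o_L1 M (\<lambda>h. cond_prob M (history M N t) (\<lambda>\<omega>. N i (t + h) \<omega> - N i t \<omega> > 1))"
  using hawkes by (auto simp: hawkes_process_def has_intensity_def intens_def)

lemma intens_pos: "AE \<omega> in M. intens i t \<omega> > 0"
  using hawkes by (auto simp: hawkes_process_def intens_def)

lemma history_subalgebra: "finite_measure_subalgebra M (history M N t)"
  using subalgebra_history[OF counting] by unfold_locales

lemma expectation_cond_prob:
  assumes X: "X \<in> borel_measurable (history M N t)" and bd: "\<And>\<omega>. \<bar>X \<omega>\<bar> \<le> K"
    and [measurable]: "{\<omega>\<in>space M. P \<omega>} \<in> sets M"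
  shows "integrable M (\<lambda>\<omega>. X \<omega> * cond_prob M (history M N t) P \<omega>)"
    and "(\<integral>\<omega>. X \<omega> * cond_prob M (history M N t) P \<omega> \<partial>M) = (\<integral>\<omega>. X \<omega> * indicat_real {\<omega>\<in>space M. P \<omega>} \<omega> \<partial>M)"
proof -
  interpret H: finite_measure_subalgebra M "history M N t" by (rule history_subalgebra)
  have X' [measurable]: "X \<in> borel_measurable M"
    using measurable_from_subalg[OF H.subalg X] .
  have "integrable M (\<lambda>\<omega>. X \<omega> * indicat_real {\<omega>\<in>space M. P \<omega>} \<omega>)"
    by (rule integrable_const_bound[of _ K])
      (use bd order_trans[OF abs_ge_zero bd] in \<open>auto simp: indicator_def\<close>)
  then show "integrable M (\<lambda>\<omega>. X \<omega> * cond_prob M (history M N t) P \<omega>)"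
    "(\<integral>\<omega>. X \<omega> * cond_prob M (history M N t) P \<omega> \<partial>M) = (\<integral>\<omega>. X \<omega> * indicat_real {\<omega>\<in>space M. P \<omega>} \<omega> \<partial>M)"
    unfolding cond_prob_def using H.real_cond_exp_intg[of X "indicat_real {\<omega>\<in>space M. P \<omega>}"] X by auto
qed

text \<open>For one small \<open>h\<close> the remainder is integrable by the definition of
  \<open>small_o_L1\<close>, and so is the conditional probability; their difference is
  \<open>intens i t\<close> times the nonzero number \<open>h\<close>.\<close>

lemma intens_integrable: "integrable M (intens i t)"
proof -
  have "\<forall>\<^sub>F h in at_right 0. integrable M (\<lambda>\<omega>.
     cond_prob M (history M N t) (\<lambda>\<omega>. N i (t + h) \<omega> - N i t \<omega> = 1) \<omega> - intens i t \<omega> * h)"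
    using intensity(1) by (simp add: small_o_L1_def)
  then have "\<exists>h. h \<in> {0<..<1} \<and> integrable M (\<lambda>\<omega>.
     cond_prob M (history M N t) (\<lambda>\<omega>. N i (t + h) \<omega> - N i t \<omega> = 1) \<omega> - intens i t \<omega> * h)"
    by (intro eventually_happens'[of "at_right (0::real)"] eventually_conj eventually_at_right_real) auto
  then obtain h where h: "h > 0" "integrable M (\<lambda>\<omega>.
     cond_prob M (history M N t) (\<lambda>\<omega>. N i (t + h) \<omega> - N i t \<omega> = 1) \<omega> - intens i t \<omega> * h)" by auto
  have "integrable M (\<lambda>\<omega>. 1 * cond_prob M (history M N t) (\<lambda>\<omega>. N i (t + h) \<omega> - N i t \<omega> = 1) \<omega>)"
    by (rule expectation_cond_prob[of _ _ 1]) auto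
  from Bochner_Integration.integrable_diff[OF this h(2)]
  have "integrable M (\<lambda>\<omega>. intens i t \<omega> * h)" by simp
  then show ?thesis using h(1) by simp
qed

lemma intens_mean: "(\<integral>\<omega>. intens i t \<omega> \<partial>M) = \<Lambda> $ i"
  using mean[of t] by (simp add: mean_intensity_def vec_eq_iff intens_def)

text \<open>The remainders in the definition of the intensity are small in \<open>L\<^sup>1\<close>, hence may be tested
  against bounded functions of the past only.\<close>

lemma single_event_tendsto:
  assumes X: "X \<in> borel_measurable (history M N t)" and bd: "\<And>\<omega>. \<bar>X \<omega>\<bar> \<le> K"
  shows "((\<lambda>h. (\<integral>\<omega>. X \<omega> * indicat_real {\<omega>\<in>space M. N i (t + h) \<omega> - N i t \<omega> = 1} \<omega> \<partial>M) / h)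
    \<longlongrightarrow> (\<integral>\<omega>. X \<omega> * intens i t \<omega> \<partial>M)) (at_right 0)"
proof -
  define R where "R h \<omega> = cond_prob M (history M N t) (\<lambda>\<omega>. N i (t + h) \<omega> - N i t \<omega> = 1) \<omega> - intens i t \<omega> * h"
    for h \<omega>
  have X' [measurable]: "X \<in> borel_measurable M"
    using measurable_from_subalg[OF subalgebra_history[OF counting] X] .
  have K: "0 \<le> K" using order_trans[OF abs_ge_zero bd] by blast
  have Xi: "integrable M (\<lambda>\<omega>. X \<omega> * intens i t \<omega>)"
    by (rule Bochner_Integration.integrable_bound[of _ "\<lambda>\<omega>. K * intens i t \<omega>"])
      (use intens_integrable[of i t] K bd in \<open>auto simp: abs_mult intro!: mult_right_mono\<close>)
  have R: "\<forall>\<^sub>F h in at_right 0. integrable M (R h)" "((\<lambda>h. (\<integral>\<omega>. \<bar>R h \<omega>\<bar> \<partial>M) / h) \<longlongrightarrow> 0) (at_right 0)"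
    using intensity(1)[of t i] by (auto simp: small_o_L1_def R_def[abs_def])
  have "((\<lambda>h. (\<integral>\<omega>. X \<omega> * indicat_real {\<omega>\<in>space M. N i (t + h) \<omega> - N i t \<omega> = 1} \<omega> \<partial>M) / h
      - (\<integral>\<omega>. X \<omega> * intens i t \<omega> \<partial>M)) \<longlongrightarrow> 0) (at_right 0)"
  proof (rule Lim_null_comparison)
    show "((\<lambda>h. K * ((\<integral>\<omega>. \<bar>R h \<omega>\<bar> \<partial>M) / h)) \<longlongrightarrow> 0) (at_right 0)"
      using tendsto_mult_right_zero[OF R(2)] .
    show "\<forall>\<^sub>F h in at_right 0. norm ((\<integral>\<omega>. X \<omega> * indicat_real {\<omega>\<in>space M. N i (t + h) \<omega> - N i t \<omega> = 1} \<omega> \<partial>M) / h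
      - (\<integral>\<omega>. X \<omega> * intens i t \<omega> \<partial>M)) \<le> K * ((\<integral>\<omega>. \<bar>R h \<omega>\<bar> \<partial>M) / h)"
      using R(1) eventually_at_right_less[of 0]
    proof eventually_elim
      case (elim h)
      let ?c = "cond_prob M (history M N t) (\<lambda>\<omega>. N i (t + h) \<omega> - N i t \<omega> = 1)"
      have c: "integrable M (\<lambda>\<omega>. X \<omega> * ?c \<omega>)"
        "(\<integral>\<omega>. X \<omega> * ?c \<omega> \<partial>M) = (\<integral>\<omega>. X \<omega> * indicat_real {\<omega>\<in>space M. N i (t + h) \<omega> - N i t \<omega> = 1} \<omega> \<partial>M)"
        by (rule expectation_cond_prob[OF X bd]; measurable)+
      have "(\<integral>\<omega>. X \<omega> * ?c \<omega> \<partial>M) - h * (\<integral>\<omega>. X \<omega> * intens i t \<omega> \<partial>M) = (\<integral>\<omega>. X \<omega> * R h \<omega> \<partial>M)"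
        unfolding R_def using c(1) Xi
        by (simp add: right_diff_distrib mult.assoc[symmetric])
      moreover have "norm (\<integral>\<omega>. X \<omega> * R h \<omega> \<partial>M) \<le> (\<integral>\<omega>. K * \<bar>R h \<omega>\<bar> \<partial>M)"
      proof (rule order_trans[OF integral_norm_bound integral_mono])
        show K_R: "integrable M (\<lambda>\<omega>. K * \<bar>R h \<omega>\<bar>)"
          using elim(1) by auto
        show le: "norm (X \<omega> * R h \<omega>) \<le> K * \<bar>R h \<omega>\<bar>" for \<omega>
          using bd by (auto simp: abs_mult intro!: mult_right_mono)
        show "integrable M (\<lambda>\<omega>. norm (X \<omega> * R h \<omega>))"
          using le elim(1) K by (intro Bochner_Integration.integrable_bound[OF K_R]) (auto simp: abs_mult)
      qed
      ultimately have "\<bar>(\<integral>\<omega>. X \<omega> * ?c \<omega> \<partial>M) - h * (\<integral>\<omega>. X \<omega> * intens i t \<omega> \<partial>M)\<bar> \<le> K * (\<integral>\<omega>. \<bar>R h \<omega>\<bar> \<partial>M)"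
        by simp
      then have "\<bar>(\<integral>\<omega>. X \<omega> * ?c \<omega> \<partial>M) - h * (\<integral>\<omega>. X \<omega> * intens i t \<omega> \<partial>M)\<bar> / h \<le> K * (\<integral>\<omega>. \<bar>R h \<omega>\<bar> \<partial>M) / h"
        using elim by (intro divide_right_mono) auto
      also have "\<bar>(\<integral>\<omega>. X \<omega> * ?c \<omega> \<partial>M) - h * (\<integral>\<omega>. X \<omega> * intens i t \<omega> \<partial>M)\<bar> / h =
          \<bar>((\<integral>\<omega>. X \<omega> * ?c \<omega> \<partial>M) - h * (\<integral>\<omega>. X \<omega> * intens i t \<omega> \<partial>M)) / h\<bar>"
        using elim by (simp add: abs_divide)
      also have "((\<integral>\<omega>. X \<omega> * ?c \<omega> \<partial>M) - h * (\<integral>\<omega>. X \<omega> * intens i t \<omega> \<partial>M)) / h =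
          (\<integral>\<omega>. X \<omega> * ?c \<omega> \<partial>M) / h - (\<integral>\<omega>. X \<omega> * intens i t \<omega> \<partial>M)"
        using elim by (simp add: diff_divide_distrib)
      finally show ?case unfolding c(2) by simp
    qed
  qed
  from tendsto_add[OF this tendsto_const, of "\<integral>\<omega>. X \<omega> * intens i t \<omega> \<partial>M"] show ?thesis by simp
qed

lemma single_event_prob_tendsto:
  "((\<lambda>h. prob {\<omega>\<in>space M. N i h \<omega> - N i 0 \<omega> = 1} / h) \<longlongrightarrow> \<Lambda> $ i) (at_right 0)"
  using single_event_tendsto[of "\<lambda>_. 1" 0 1 i] by (simp add: intens_mean Int_absorb1 subset_iff)

lemma multiple_event_prob_tendsto:
  "((\<lambda>h. prob {\<omega>\<in>space M. N i h \<omega> - N i 0 \<omega> > 1} / h) \<longlongrightarrow> 0) (at_right 0)"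
proof (rule Lim_null_comparison)
  let ?c = "\<lambda>h. cond_prob M (history M N 0) (\<lambda>\<omega>. N i (0 + h) \<omega> - N i 0 \<omega> > 1)"
  show "((\<lambda>h. (\<integral>\<omega>. \<bar>?c h \<omega>\<bar> \<partial>M) / h) \<longlongrightarrow> 0) (at_right 0)"
    using intensity(2)[of 0 i] by (simp add: small_o_L1_def)
  show "\<forall>\<^sub>F h in at_right 0. norm (prob {\<omega>\<in>space M. N i h \<omega> - N i 0 \<omega> > 1} / h) \<le> (\<integral>\<omega>. \<bar>?c h \<omega>\<bar> \<partial>M) / h"
    using eventually_at_right_less[of 0]
  proof eventually_elim
    case (elim h)
    have "prob {\<omega>\<in>space M. N i h \<omega> - N i 0 \<omega> > 1} = (\<integral>\<omega>. ?c h \<omega> \<partial>M)"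
      using expectation_cond_prob(2)[of "\<lambda>_. 1" 0 1 "\<lambda>\<omega>. N i (0 + h) \<omega> - N i 0 \<omega> > 1"]
        inc_event[of "\<lambda>m. m > 1" i h 0]
      by (simp add: Int_absorb1 subset_iff)
    also have "\<dots> \<le> (\<integral>\<omega>. \<bar>?c h \<omega>\<bar> \<partial>M)"
      using integral_abs_bound[of M "?c h"] by linarith
    finally show ?case using elim by (simp add: divide_right_mono)
  qed
qed

section \<open>Multiple and common events along dyadic partitions\<close>

lemma sum_inc_cell: "(\<Sum>p<q. inc i (cell y n p) (cell y n (Suc p)) \<omega>) = inc i 0 (cell y n q) \<omega>"
  using sum_lessThan_telescope[of "\<lambda>p. real_of_int (N i (cell y n p) \<omega>)" q]
  by (simp add: increment_def)

lemma sum_inc_cell_last: "(\<Sum>p<(2::nat) ^ n. inc i (cell y n p) (cell y n (Suc p)) \<omega>) = inc i 0 y \<omega>"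
  by (simp add: sum_inc_cell)

text \<open>The event that some cell of level \<open>n\<close> carries two or more events shrinks
  with \<open>n\<close>, since a finer cell lies inside a coarser one. Its probability is at most
  \<open>2 ^ n\<close> times an \<open>o(y / 2 ^ n)\<close>, so the intersection is a null
  set.\<close>

lemma eventually_no_multiple_events:
  assumes "0 < y"
  shows "AE \<omega> in M. \<forall>\<^sub>F n in sequentially. \<forall>p<(2::nat) ^ n. N i (cell y n (Suc p)) \<omega> - N i (cell y n p) \<omega> \<le> 1"
proof -
  define B where "B n = (\<Union>p\<in>{..<2 ^ n}. {\<omega>\<in>space M. N i (cell y n (Suc p)) \<omega> - N i (cell y n p) \<omega> > 1})" for n :: nat
  have B [measurable]: "B n \<in> sets M" for n
    unfolding B_def by (intro sets.finite_UN inc_event) auto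
  have sub: "B (Suc n) \<subseteq> B n" for n
  proof
    fix \<omega> assume "\<omega> \<in> B (Suc n)"
    then obtain p where p: "p < 2 ^ Suc n" "\<omega> \<in> space M"
      "N i (cell y (Suc n) (Suc p)) \<omega> - N i (cell y (Suc n) p) \<omega> > 1" by (auto simp: B_def)
    \<comment> \<open>The cell of level \<open>n\<close> that contains cell \<open>p\<close> of
      level \<open>n + 1\<close>.\<close>
    define q where "q = p div 2"
    have q: "q < 2 ^ n" "2 * q \<le> p" "Suc p \<le> 2 * Suc q" using p(1) by (auto simp: q_def)
    have c: "cell y n r = cell y (Suc n) (2 * r)" for r by (simp add: cell_def)
    have "N i (cell y n q) \<omega> \<le> N i (cell y (Suc n) p) \<omega>"
      unfolding c using q assms by (intro N_mono p cell_mono) auto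
    moreover have "N i (cell y (Suc n) (Suc p)) \<omega> \<le> N i (cell y n (Suc q)) \<omega>"
      unfolding c using q assms by (intro N_mono p cell_mono) auto
    ultimately show "\<omega> \<in> B n" using p q by (auto simp: B_def intro!: bexI[of _ q])
  qed
  then have dec: "decseq B" by (rule decseq_SucI)
  have small: "prob (B n) \<le> y * (prob {\<omega>\<in>space M. N i (y / 2 ^ n) \<omega> - N i 0 \<omega> > 1} / (y / 2 ^ n))" for n
  proof -
    have "prob (B n) \<le> (\<Sum>p<(2::nat) ^ n. prob {\<omega>\<in>space M. N i (cell y n (Suc p)) \<omega> - N i (cell y n p) \<omega> > 1})"
      unfolding B_def by (intro finite_measure_subadditive_finite) auto
    also have "\<dots> = (\<Sum>p<(2::nat) ^ n. prob {\<omega>\<in>space M. N i (y / 2 ^ n) \<omega> - N i 0 \<omega> > 1})" 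
      unfolding cell_Suc using inc_prob_shift[of "\<lambda>m. m > 1" i "y / 2 ^ n" _ 0] by simp
    finally show ?thesis using assms by (simp add: mult.commute)
  qed
  have "(\<lambda>n. prob (B n)) \<longlonglongrightarrow> 0"
  proof (rule tendsto_sandwich[OF _ _ tendsto_const])
    show "(\<lambda>n. y * (prob {\<omega>\<in>space M. N i (y / 2 ^ n) \<omega> - N i 0 \<omega> > 1} / (y / 2 ^ n))) \<longlonglongrightarrow> 0"
      by (intro tendsto_mult_right_zero filterlim_compose[OF multiple_event_prob_tendsto mesh_filterlim] assms)
  qed (use small in \<open>simp_all only: measure_nonneg eventually_True\<close>)
  moreover have "(\<lambda>n. prob (B n)) \<longlonglongrightarrow> prob (\<Inter>n. B n)"
    using dec by (intro finite_Lim_measure_decseq) auto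
  ultimately have "prob (\<Inter>n. B n) = 0" using LIMSEQ_unique by blast
  then have "AE \<omega> in M. \<omega> \<notin> (\<Inter>n. B n)"
    by (intro AE_not_in) (auto simp: null_sets_def emeasure_eq_measure)
  with AE_space show ?thesis
  proof eventually_elim
    case (elim \<omega>)
    then obtain n where n: "\<omega> \<notin> B n" by blast
    then have nB: "\<omega> \<notin> B m" if "n \<le> m" for m using decseqD[OF dec that] by blast
    then have "\<forall>p<(2::nat) ^ m. N i (cell y m (Suc p)) \<omega> - N i (cell y m p) \<omega> \<le> 1" if "n \<le> m" for m
    proof -
      from nB[OF that] \<open>\<omega> \<in> space M\<close> show ?thesis by (auto simp: B_def not_less)
    qed
    then show ?case unfolding eventually_sequentially by blast
  qed
qed

text \<open>Korolyuk's theorem: along dyadic partitions of \<open>(0, 1]\<close> the number of cells with exactly one event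
  is eventually the number of events.\<close>

lemma inc_rate: "(\<integral>\<omega>. inc i 0 1 \<omega> \<partial>M) = \<Lambda> $ i"
proof -
  define S where "S n \<omega> = (\<Sum>p<(2::nat) ^ n. indicat_real
    {\<omega>\<in>space M. N i (cell 1 n (Suc p)) \<omega> - N i (cell 1 n p) \<omega> = 1} \<omega>)" for n :: nat and \<omega>
  have le: "indicat_real {\<omega>\<in>space M. N i (cell 1 n (Suc p)) \<omega> - N i (cell 1 n p) \<omega> = 1} \<omega>
      \<le> inc i (cell 1 n p) (cell 1 n (Suc p)) \<omega>" if "\<omega> \<in> space M" for n p \<omega>
    using inc_nonneg[OF that, of "cell 1 n p" "cell 1 n (Suc p)" i] cell_mono[of 1 p "Suc p" n]
    by (auto simp: indicator_def increment_def)
  have "(\<lambda>n. \<integral>\<omega>. S n \<omega> \<partial>M) \<longlonglongrightarrow> (\<integral>\<omega>. inc i 0 1 \<omega> \<partial>M)"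
  proof (rule integral_dominated_convergence)
    show "S n \<in> borel_measurable M" for n unfolding S_def by measurable
    show "AE \<omega> in M. norm (S n \<omega>) \<le> inc i 0 1 \<omega>" for n
    proof (rule AE_I2)
      fix \<omega> assume "\<omega> \<in> space M"
      then have "S n \<omega> \<le> inc i 0 1 \<omega>"
        unfolding S_def sum_inc_cell_last[of i 1 n \<omega>, symmetric] by (intro sum_mono le)
      moreover have "0 \<le> S n \<omega>" unfolding S_def by (intro sum_nonneg) auto
      ultimately show "norm (S n \<omega>) \<le> inc i 0 1 \<omega>" by simp
    qed
    have "AE \<omega> in M. \<forall>\<^sub>F n in sequentially. \<forall>p<(2::nat) ^ n. N i (cell 1 n (Suc p)) \<omega> - N i (cell 1 n p) \<omega> \<le> 1"
      by (rule eventually_no_multiple_events) simp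
    with AE_space show "AE \<omega> in M. (\<lambda>n. S n \<omega>) \<longlonglongrightarrow> inc i 0 1 \<omega>"
    proof eventually_elim
      case (elim \<omega>)
      have "\<forall>\<^sub>F n in sequentially. S n \<omega> = inc i 0 1 \<omega>"
        using elim(2)
      proof eventually_elim
        case (elim n)
        show ?case unfolding S_def sum_inc_cell_last[of i 1 n \<omega>, symmetric]
        proof (intro sum.cong refl)
          fix p :: nat assume "p \<in> {..<2 ^ n}"
          with elim have "N i (cell 1 n (Suc p)) \<omega> - N i (cell 1 n p) \<omega> \<le> 1" by simp
          moreover have "0 \<le> N i (cell 1 n (Suc p)) \<omega> - N i (cell 1 n p) \<omega>"
            using N_mono[OF \<open>\<omega> \<in> space M\<close> cell_mono[of 1 p "Suc p" n]] by simp
          ultimately have "N i (cell 1 n (Suc p)) \<omega> - N i (cell 1 n p) \<omega> \<in> {0, 1}" by auto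
          then show "indicat_real {\<omega>\<in>space M. N i (cell 1 n (Suc p)) \<omega> - N i (cell 1 n p) \<omega> = 1} \<omega> =
              inc i (cell 1 n p) (cell 1 n (Suc p)) \<omega>"
            using \<open>\<omega> \<in> space M\<close> by (auto simp: indicator_def increment_def)
        qed
      qed
      then show ?case by (rule tendsto_eventually)
    qed
  qed (auto intro: inc_integrable)
  \<comment> \<open>By stationarity all \<open>2 ^ n\<close> cells contribute the same probability,
    so the expected count is the difference quotient whose limit is the mean intensity.\<close>
  moreover have "(\<integral>\<omega>. S n \<omega> \<partial>M) = prob {\<omega>\<in>space M. N i (1 / 2 ^ n) \<omega> - N i 0 \<omega> = 1} / (1 / 2 ^ n)" for n
  proof -
    have "(\<integral>\<omega>. S n \<omega> \<partial>M) = (\<Sum>p<(2::nat) ^ n. prob {\<omega>\<in>space M. N i (cell 1 n (Suc p)) \<omega> - N i (cell 1 n p) \<omega> = 1})"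
      unfolding S_def
      by (subst Bochner_Integration.integral_sum) (auto simp: Int_absorb1 subset_iff emeasure_eq_measure)
    also have "\<dots> = (\<Sum>p<(2::nat) ^ n. prob {\<omega>\<in>space M. N i (1 / 2 ^ n) \<omega> - N i 0 \<omega> = 1})"
      unfolding cell_Suc using inc_prob_shift[of "\<lambda>m. m = 1" i "1 / 2 ^ n" _ 0] by simp
    finally show ?thesis by simp
  qed
  ultimately have "(\<lambda>n. prob {\<omega>\<in>space M. N i (1 / 2 ^ n) \<omega> - N i 0 \<omega> = 1} / (1 / 2 ^ n))
      \<longlonglongrightarrow> (\<integral>\<omega>. inc i 0 1 \<omega> \<partial>M)" by simp
  moreover have "(\<lambda>n. prob {\<omega>\<in>space M. N i (1 / 2 ^ n) \<omega> - N i 0 \<omega> = 1} / (1 / 2 ^ n)) \<longlonglongrightarrow> \<Lambda> $ i"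
    by (intro filterlim_compose[OF single_event_prob_tendsto mesh_filterlim]) simp
  ultimately show ?thesis using LIMSEQ_unique by blast
qed

lemma inc_mean: "a \<le> b \<Longrightarrow> (\<integral>\<omega>. inc i a b \<omega> \<partial>M) = \<Lambda> $ i * (b - a)"
  by (simp add: inc_mean_linear inc_rate)

lemma intensity_vector_nonneg: "0 \<le> \<Lambda> $ i"
  using inc_rate[of i] Bochner_Integration.integral_nonneg_AE[of "inc i 0 1" M]
  by (simp add: AE_I2 inc_nonneg)

text \<open>The mean number of events is exactly \<open>\<Lambda> $ i * h\<close>, and the
  probability of exactly one event agrees with it up to \<open>o(h)\<close>. Hence the excess is
  \<open>o(h)\<close> in mean, which controls the number of events and not only the probability of
  several.\<close>

lemma multiple_event_mean_tendsto:
  "((\<lambda>h. (\<integral>\<omega>. inc i t (t + h) \<omega> - indicat_real {\<omega>\<in>space M. N i (t + h) \<omega> - N i t \<omega> = 1} \<omega> \<partial>M) / h)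
    \<longlongrightarrow> 0) (at_right 0)"
proof -
  have "((\<lambda>h. \<Lambda> $ i - prob {\<omega>\<in>space M. N i h \<omega> - N i 0 \<omega> = 1} / h) \<longlongrightarrow> \<Lambda> $ i - \<Lambda> $ i) (at_right 0)"
    by (intro tendsto_intros single_event_prob_tendsto)
  moreover have "\<forall>\<^sub>F h in at_right 0. \<Lambda> $ i - prob {\<omega>\<in>space M. N i h \<omega> - N i 0 \<omega> = 1} / h =
    (\<integral>\<omega>. inc i t (t + h) \<omega> - indicat_real {\<omega>\<in>space M. N i (t + h) \<omega> - N i t \<omega> = 1} \<omega> \<partial>M) / h"
    using eventually_at_right_less[of 0]
  proof eventually_elim
    case (elim h)
    have "(\<integral>\<omega>. inc i t (t + h) \<omega> - indicat_real {\<omega>\<in>space M. N i (t + h) \<omega> - N i t \<omega> = 1} \<omega> \<partial>M) =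
      \<Lambda> $ i * h - prob {\<omega>\<in>space M. N i (t + h) \<omega> - N i t \<omega> = 1}"
      using elim by (subst Bochner_Integration.integral_diff) (auto simp: inc_mean Int_absorb1 subset_iff inc_integrable emeasure_eq_measure)
    also have "prob {\<omega>\<in>space M. N i (t + h) \<omega> - N i t \<omega> = 1} = prob {\<omega>\<in>space M. N i h \<omega> - N i 0 \<omega> = 1}"
      using inc_prob_shift[of "\<lambda>m. m = 1" i h t 0] by (simp add: add.commute)
    finally show ?case using elim by (simp add: field_simps)
  qed
  ultimately show ?thesis by (simp add: tendsto_cong)
qed

text \<open>Almost surely at least one of the two paths is continuous, hence locally constant, at
  each time. Compactness of \<open>[0, y]\<close> makes the size of these neighbourhoods uniform,
  and every cell shorter than that size lies in one of them.\<close>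

lemma eventually_no_common_events:
  assumes "i \<noteq> j" "0 < y"
  shows "AE \<omega> in M. \<forall>\<^sub>F n in sequentially. \<forall>p<(2::nat) ^ n.
    inc i (cell y n p) (cell y n (Suc p)) \<omega> * inc j (cell y n p) (cell y n (Suc p)) \<omega> = 0"
proof -
  have "AE \<omega> in M. \<forall>t. isCont (\<lambda>s. real_of_int (N i s \<omega>)) t \<or> isCont (\<lambda>s. real_of_int (N j s \<omega>)) t"
    using counting assms(1) by (auto simp: counting_process_def)
  then show ?thesis
  proof eventually_elim
    case (elim \<omega>)
    define const where "const k B \<longleftrightarrow> (\<forall>s\<in>B. \<forall>s'\<in>B. N k s \<omega> = N k s' \<omega>)" for k :: 'm and B :: "real set"
    have loc: "\<exists>d>0. const k (ball t d)" if "isCont (\<lambda>s. real_of_int (N k s \<omega>)) t" for k t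
    proof -
      \<comment> \<open>For integer values, distance below 1 means equality, so tolerance 1 turns
        continuity into local constancy.\<close>
      have "\<exists>d>0. \<forall>s. dist s t < d \<longrightarrow> dist (real_of_int (N k s \<omega>)) (real_of_int (N k t \<omega>)) < 1"
        using that unfolding continuous_at_eps_delta by (metis zero_less_one dist_commute)
      then obtain d where d: "d > 0" "\<And>s. dist s t < d \<Longrightarrow> dist (real_of_int (N k s \<omega>)) (real_of_int (N k t \<omega>)) < 1"
        by blast
      have "N k s \<omega> = N k t \<omega>" if "s \<in> ball t d" for s
        using d(2)[of s] that by (simp add: dist_commute dist_real_def)
      with d(1) show ?thesis unfolding const_def by metis
    qed
    obtain e where e: "0 < e" "\<And>x. x \<in> {0..y} \<Longrightarrow> \<exists>G\<in>{B. open B \<and> (const i B \<or> const j B)}. ball x e \<subseteq> G"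
    proof (rule Heine_Borel_lemma[of "{0..y}" "{B. open B \<and> (const i B \<or> const j B)}"])
      have "\<exists>B. t \<in> B \<and> open B \<and> (const i B \<or> const j B)" for t
        using elim loc by (metis centre_in_ball open_ball)
      then show "{0..y} \<subseteq> \<Union> {B. open B \<and> (const i B \<or> const j B)}" by blast
    qed auto
    have "\<forall>\<^sub>F n in sequentially. y / 2 ^ n < e"
      using order_tendstoD(2)[OF LIMSEQ_divide_realpow_zero[of 2 y] e(1)] by simp
    then show ?case
    proof eventually_elim
      case (elim n)
      show ?case
      proof (intro allI impI)
        fix p :: nat assume "p < 2 ^ n"
        then have "cell y n p \<in> {0..y}"
          using cell_mono[of y 0 p n] cell_mono[of y p "2 ^ n" n] assms by simp
        from e(2)[OF this] obtain G where G: "const i G \<or> const j G" "ball (cell y n p) e \<subseteq> G" by blast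
        \<comment> \<open>The ball around the left end point contains the right end point as well,
          because the mesh is below \<open>e\<close>.\<close>
        have "cell y n p \<in> G" "cell y n (Suc p) \<in> G"
          using G(2) elim e(1) assms by (auto intro!: subsetD[OF G(2)] simp: cell_Suc dist_real_def)
        with G(1) have "N i (cell y n p) \<omega> = N i (cell y n (Suc p)) \<omega> \<or> N j (cell y n p) \<omega> = N j (cell y n (Suc p)) \<omega>"
          unfolding const_def by blast
        then show "inc i (cell y n p) (cell y n (Suc p)) \<omega> * inc j (cell y n p) (cell y n (Suc p)) \<omega> = 0"
          by (auto simp: increment_def)
      qed
    qed
  qed
qed

text \<open>For \<open>i = j\<close> the cell counts are eventually 0 or 1, so each equals its
  square and the sum is the total count; for \<open>i \<noteq> j\<close> every product is eventually
  0. The product of the total counts dominates all the sums.\<close>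

lemma diagonal_sum_tendsto:
  assumes "0 < y"
  shows "(\<lambda>n. \<Sum>p<(2::nat) ^ n. \<integral>\<omega>. inc i (cell y n p) (cell y n (Suc p)) \<omega> * inc j (cell y n p) (cell y n (Suc p)) \<omega> \<partial>M)
    \<longlonglongrightarrow> (if i = j then \<Lambda> $ i * y else 0)"
proof -
  define I where "I k n p = inc k (cell y n p) (cell y n (Suc p))" for k and n p :: nat
  define L where "L \<omega> = (if i = j then inc i 0 y \<omega> else 0)" for \<omega>
  have I_nonneg: "0 \<le> I k n p \<omega>" if "\<omega> \<in> space M" for k n p \<omega>
    unfolding I_def using assms that by (intro inc_nonneg cell_mono) auto
  have I_sum: "(\<Sum>p<(2::nat) ^ n. I k n p \<omega>) = inc k 0 y \<omega>" for k n \<omega>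
    unfolding I_def by (rule sum_inc_cell_last)
  have "(\<lambda>n. \<integral>\<omega>. (\<Sum>p<(2::nat) ^ n. I i n p \<omega> * I j n p \<omega>) \<partial>M) \<longlonglongrightarrow> (\<integral>\<omega>. L \<omega> \<partial>M)"
  proof (rule integral_dominated_convergence)
    show "integrable M (\<lambda>\<omega>. inc i 0 y \<omega> * inc j 0 y \<omega>)" by (rule inc_prod_integrable)
    show "L \<in> borel_measurable M" unfolding L_def by (cases "i = j") auto
    show "(\<lambda>\<omega>. \<Sum>p<(2::nat) ^ n. I i n p \<omega> * I j n p \<omega>) \<in> borel_measurable M" for n :: nat
      unfolding I_def by measurable
    show "AE \<omega> in M. norm (\<Sum>p<(2::nat) ^ n. I i n p \<omega> * I j n p \<omega>) \<le> inc i 0 y \<omega> * inc j 0 y \<omega>" for n :: nat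
    proof (rule AE_I2)
      fix \<omega> assume \<omega>: "\<omega> \<in> space M"
      have "(\<Sum>p<(2::nat) ^ n. I i n p \<omega> * I j n p \<omega>) \<le> (\<Sum>p<(2::nat) ^ n. I i n p \<omega> * inc j 0 y \<omega>)"
      proof (intro sum_mono mult_left_mono I_nonneg \<omega>)
        fix p :: nat assume "p \<in> {..<2 ^ n}"
        then have "I j n p \<omega> \<le> (\<Sum>p<(2::nat) ^ n. I j n p \<omega>)"
          using I_nonneg[OF \<omega>] by (intro member_le_sum) auto
        then show "I j n p \<omega> \<le> inc j 0 y \<omega>" by (simp only: I_sum)
      qed
      also have "\<dots> = inc i 0 y \<omega> * inc j 0 y \<omega>" by (simp add: I_sum flip: sum_distrib_right)
      finally have "(\<Sum>p<(2::nat) ^ n. I i n p \<omega> * I j n p \<omega>) \<le> inc i 0 y \<omega> * inc j 0 y \<omega>" .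
      moreover have "0 \<le> (\<Sum>p<(2::nat) ^ n. I i n p \<omega> * I j n p \<omega>)"
        by (intro sum_nonneg mult_nonneg_nonneg I_nonneg \<omega>)
      ultimately show "norm (\<Sum>p<(2::nat) ^ n. I i n p \<omega> * I j n p \<omega>) \<le> inc i 0 y \<omega> * inc j 0 y \<omega>" by simp
    qed
    show "AE \<omega> in M. (\<lambda>n. \<Sum>p<(2::nat) ^ n. I i n p \<omega> * I j n p \<omega>) \<longlonglongrightarrow> L \<omega>"
    proof (cases "i = j")
      case True
      from AE_space eventually_no_multiple_events[OF assms, of j] show ?thesis
      proof eventually_elim
        case (elim \<omega>)
        have "\<forall>\<^sub>F n in sequentially. (\<Sum>p<(2::nat) ^ n. I i n p \<omega> * I j n p \<omega>) = L \<omega>"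
          using elim(2)
        proof eventually_elim
          case (elim n)
          have "I j n p \<omega> * I j n p \<omega> = I j n p \<omega>" if "p < 2 ^ n" for p
          proof -
            have "0 \<le> N j (cell y n (Suc p)) \<omega> - N j (cell y n p) \<omega>"
              using I_nonneg[OF \<open>\<omega> \<in> space M\<close>, of j n p] by (simp add: I_def increment_def)
            with elim that have "N j (cell y n (Suc p)) \<omega> - N j (cell y n p) \<omega> \<in> {0, 1}" by fastforce
            then show ?thesis by (auto simp: I_def increment_def)
          qed
          then have "(\<Sum>p<(2::nat) ^ n. I i n p \<omega> * I j n p \<omega>) = (\<Sum>p<(2::nat) ^ n. I j n p \<omega>)"
            unfolding True by (intro sum.cong) auto
          then show ?case by (simp add: True L_def I_sum)
        qed
        then show ?case by (rule tendsto_eventually)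
      qed
    next
      case False
      from eventually_no_common_events[OF False assms] show ?thesis
      proof eventually_elim
        case (elim \<omega>)
        then have "\<forall>\<^sub>F n in sequentially. (\<Sum>p<(2::nat) ^ n. I i n p \<omega> * I j n p \<omega>) = L \<omega>"
          by eventually_elim (auto simp: I_def L_def False intro!: sum.neutral)
        then show ?case by (rule tendsto_eventually)
      qed
    qed
  qed
  moreover have "(\<integral>\<omega>. L \<omega> \<partial>M) = (if i = j then \<Lambda> $ i * y else 0)"
    using assms by (auto simp: L_def inc_mean)
  moreover have "(\<integral>\<omega>. (\<Sum>p<(2::nat) ^ n. I i n p \<omega> * I j n p \<omega>) \<partial>M) = (\<Sum>p<(2::nat) ^ n. \<integral>\<omega>. I i n p \<omega> * I j n p \<omega> \<partial>M)" for n
    unfolding I_def by (intro Bochner_Integration.integral_sum inc_prod_integrable)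
  ultimately show ?thesis by (simp add: I_def)
qed

end

section \<open>The intensity as a function of the past increments\<close>

text \<open>For a nonnegative integrand an integrable bound on its expectations already gives joint
  integrability.\<close>

lemma Fubini_nonneg_dominated:
  fixes f :: "'b \<Rightarrow> 'a \<Rightarrow> real"
  assumes "sigma_finite_measure M" "sigma_finite_measure L"
    and f [measurable]: "case_prod f \<in> borel_measurable (L \<Otimes>\<^sub>M M)"
    and nonneg: "\<And>y \<omega>. \<omega> \<in> space M \<Longrightarrow> 0 \<le> f y \<omega>"
    and int: "\<And>y. y \<in> space L \<Longrightarrow> integrable M (f y)"
    and le: "\<And>y. y \<in> space L \<Longrightarrow> (\<integral>\<omega>. f y \<omega> \<partial>M) \<le> h y" and h: "integrable L h"
  shows "AE \<omega> in M. integrable L (\<lambda>y. f y \<omega>)"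
    and "integrable M (\<lambda>\<omega>. \<integral>y. f y \<omega> \<partial>L)"
    and "(\<integral>\<omega>. (\<integral>y. f y \<omega> \<partial>L) \<partial>M) = (\<integral>y. (\<integral>\<omega>. f y \<omega> \<partial>M) \<partial>L)"
proof -
  interpret M: sigma_finite_measure M by fact
  interpret L: sigma_finite_measure L by fact
  interpret pair_sigma_finite L M ..
  have eq: "(\<integral>\<omega>. norm (f y \<omega>) \<partial>M) = (\<integral>\<omega>. f y \<omega> \<partial>M)" for y
    by (intro Bochner_Integration.integral_cong) (auto simp: nonneg)
  have "integrable L (\<lambda>y. \<integral>\<omega>. f y \<omega> \<partial>M)"
  proof (rule Bochner_Integration.integrable_bound[OF h])
    have "0 \<le> (\<integral>\<omega>. f y \<omega> \<partial>M)" for y by (simp add: nonneg AE_I2 Bochner_Integration.integral_nonneg_AE)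
    then show "AE y in L. norm (\<integral>\<omega>. f y \<omega> \<partial>M) \<le> norm (h y)"
      using le by (intro AE_I2) (simp add: order_trans[OF _ abs_ge_self])
  qed measurable
  then have "integrable (L \<Otimes>\<^sub>M M) (case_prod f)"
    using int by (intro Fubini_integrable) (auto simp: eq[simplified])
  then show "AE \<omega> in M. integrable L (\<lambda>y. f y \<omega>)" "integrable M (\<lambda>\<omega>. \<integral>y. f y \<omega> \<partial>L)"
    "(\<integral>\<omega>. (\<integral>y. f y \<omega> \<partial>L) \<partial>M) = (\<integral>y. (\<integral>\<omega>. f y \<omega> \<partial>M) \<partial>L)"
    by (rule AE_integrable_snd, rule integrable_snd, rule Fubini_integral)
qed

text \<open>Integration by parts, written as Tonelli's theorem for
  \<open>exp (- b (t - s)) = \<integral>\<^sub>y\<^sub>>\<^sub>t\<^sub>-\<^sub>s b exp (- b y) dy\<close>.\<close>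

lemma nn_integral_interval_measure_exp:
  fixes F :: "real \<Rightarrow> real"
  assumes mono: "\<And>x y. x \<le> y \<Longrightarrow> F x \<le> F y" and cont: "\<And>a. continuous (at_right a) F" and b: "0 < b"
  shows "(\<integral>\<^sup>+s. ennreal (exp (- b * (t - s))) * indicator {..t} s \<partial>interval_measure F) =
    (\<integral>\<^sup>+y. ennreal (b * ((F t - F (t - y)) * exp (- b * y))) * indicator {0..} y \<partial>lborel)"
proof -
  let ?F = "interval_measure F"
  interpret F: sigma_finite_measure ?F by (rule sigma_finite_interval_measure[OF mono cont])
  interpret pair_sigma_finite ?F lborel ..
  let ?e = "\<lambda>y. ennreal (b * exp (- b * y))"
  have tail: "(\<integral>\<^sup>+y. ?e y * indicator {a<..} y \<partial>lborel) = ennreal (exp (- b * a))" for a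
  proof -
    have "filterlim (\<lambda>y. - b * y) at_bot at_top"
      using b by (intro filterlim_tendsto_neg_mult_at_bot[OF tendsto_const] filterlim_ident) auto
    then have lim: "((\<lambda>y. - exp (- b * y)) \<longlongrightarrow> - 0) at_top"
      by (intro tendsto_minus filterlim_compose[OF exp_at_bot])
    have "(\<integral>\<^sup>+y. ?e y * indicator {a<..} y \<partial>lborel) = (\<integral>\<^sup>+y. ?e y * indicator {a..} y \<partial>lborel)"
      by (rule nn_integral_cong_AE)
        (use AE_lborel_singleton[of a] in \<open>auto elim!: eventually_mono split: split_indicator\<close>)
    also have "\<dots> = ennreal (- 0 - (- exp (- b * a)))"
      using b by (intro nn_integral_FTC_atLeast lim) (auto intro!: derivative_eq_intros)
    finally show ?thesis by simp
  qed
  have "(\<integral>\<^sup>+s. ennreal (exp (- b * (t - s))) * indicator {..t} s \<partial>?F) =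
    (\<integral>\<^sup>+s. (\<integral>\<^sup>+y. ?e y * indicator {t - s<..} y * indicator {..t} s \<partial>lborel) \<partial>?F)"
    by (intro nn_integral_cong, subst nn_integral_multc) (simp_all only: tail, measurable)
  also have "\<dots> = (\<integral>\<^sup>+y. (\<integral>\<^sup>+s. ?e y * indicator {t - s<..} y * indicator {..t} s \<partial>?F) \<partial>lborel)"
  proof (rule Fubini'[symmetric])
    have eq: "(\<lambda>(s, y). ?e y * indicator {t - s<..} y * indicator {..t} s) =
        (\<lambda>p. ?e (snd p) * (if t - fst p < snd p then 1 else 0) * (if fst p \<le> t then 1 else 0))"
      by (auto simp: fun_eq_iff split: split_indicator)
    show "(\<lambda>(s, y). ?e y * indicator {t - s<..} y * indicator {..t} s) \<in> borel_measurable (?F \<Otimes>\<^sub>M lborel)"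
      unfolding eq by measurable
  qed
  also have "\<dots> = (\<integral>\<^sup>+y. ennreal (b * ((F t - F (t - y)) * exp (- b * y))) * indicator {0..} y \<partial>lborel)"
  proof (rule nn_integral_cong)
    \<comment> \<open>For fixed \<open>y\<close> the two indicators select the times
      \<open>s\<close> in \<open>(t - y, t]\<close>, whose mass is the increment of
      \<open>F\<close>.\<close>
    fix y :: real
    have "(\<integral>\<^sup>+s. ?e y * indicator {t - s<..} y * indicator {..t} s \<partial>?F) = (\<integral>\<^sup>+s. ?e y * indicator {t - y<..t} s \<partial>?F)"
      by (intro nn_integral_cong) (auto split: split_indicator)
    also have "\<dots> = ?e y * emeasure ?F {t - y<..t}" by (simp add: nn_integral_cmult_indicator)
    also have "emeasure ?F {t - y<..t} = (if 0 \<le> y then ennreal (F t - F (t - y)) else 0)"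
      by (subst emeasure_interval_measure_Ioc_eq[OF mono cont]) auto
    also have "?e y * (if 0 \<le> y then ennreal (F t - F (t - y)) else 0) =
        ennreal (b * ((F t - F (t - y)) * exp (- b * y))) * indicator {0..} y"
      using b mono[of "t - y" t] by (auto simp: ennreal_mult'[symmetric] mult_ac split: split_indicator)
    finally show "(\<integral>\<^sup>+s. ?e y * indicator {t - s<..} y * indicator {..t} s \<partial>?F) =
        ennreal (b * ((F t - F (t - y)) * exp (- b * y))) * indicator {0..} y" .
  qed
  finally show ?thesis .
qed

text \<open>The point \<open>s0\<close> shows that \<open>F\<close> is constant just before
  \<open>t\<close>, so \<open>t\<close> carries no atom and the integral over \<open>s < t\<close>
  agrees with the one over \<open>s \<le> t\<close> computed by Tonelli.\<close>

lemma interval_measure_exp: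
  fixes F :: "real \<Rightarrow> real"
  assumes mono: "\<And>x y. x \<le> y \<Longrightarrow> F x \<le> F y" and cont: "\<And>a. continuous (at_right a) F" and b: "0 < b"
    and int: "set_integrable lborel {0..} (\<lambda>y. (F t - F (t - y)) * exp (- b * y))"
    and const: "F s0 = F t" "s0 < t"
  shows "set_integrable (interval_measure F) {..<t} (\<lambda>s. exp (- b * (t - s)))"
    and "(LINT s:{..<t}|interval_measure F. exp (- b * (t - s))) = b * laplace_real (\<lambda>y. F t - F (t - y)) b"
proof -
  let ?F = "interval_measure F"
  let ?g = "\<lambda>y. b * ((F t - F (t - y)) * exp (- b * y)) * indicator {0..} y"
  have "emeasure ?F {t} \<le> emeasure ?F {s0<..t}"
    using const by (intro emeasure_mono) auto
  also have "\<dots> = 0" using const by (subst emeasure_interval_measure_Ioc_eq[OF mono cont]) auto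
  finally have null: "{t} \<in> null_sets ?F" by (simp add: null_sets_def)
  have g: "integrable lborel ?g"
    using set_integrable_mult_right[OF int, of b]
    by (simp add: set_integrable_def mult_ac)
  have "(\<integral>\<^sup>+s. ennreal (indicator {..<t} s *\<^sub>R exp (- b * (t - s))) \<partial>?F) =
      (\<integral>\<^sup>+s. ennreal (exp (- b * (t - s))) * indicator {..t} s \<partial>?F)"
    by (rule nn_integral_cong_AE)
      (use AE_not_in[OF null] in \<open>auto elim!: eventually_mono split: split_indicator\<close>)
  also have "\<dots> = (\<integral>\<^sup>+y. ennreal (b * ((F t - F (t - y)) * exp (- b * y))) * indicator {0..} y \<partial>lborel)"
    by (intro nn_integral_interval_measure_exp mono cont b)
  also have "\<dots> = (\<integral>\<^sup>+y. ennreal (?g y) \<partial>lborel)"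
    by (intro nn_integral_cong) (auto split: split_indicator)
  also have "\<dots> = ennreal (\<integral>y. ?g y \<partial>lborel)"
    using b mono by (intro nn_integral_eq_integral[OF g] AE_I2) (auto split: split_indicator)
  finally have eq: "(\<integral>\<^sup>+s. ennreal (indicator {..<t} s *\<^sub>R exp (- b * (t - s))) \<partial>?F) = ennreal (\<integral>y. ?g y \<partial>lborel)" .
  have m: "(\<lambda>s. indicator {..<t} s *\<^sub>R exp (- b * (t - s))) \<in> borel_measurable ?F" by measurable
  show "set_integrable ?F {..<t} (\<lambda>s. exp (- b * (t - s)))"
    unfolding set_integrable_def
    by (rule integrableI_nonneg[OF m]) (use eq in auto)
  have "(LINT s:{..<t}|?F. exp (- b * (t - s))) = enn2real (ennreal (\<integral>y. ?g y \<partial>lborel))"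
    unfolding set_lebesgue_integral_def eq[symmetric] by (rule integral_eq_nn_integral[OF m]) auto
  also have "\<dots> = (\<integral>y. ?g y \<partial>lborel)"
    using b mono by (intro enn2real_ennreal Bochner_Integration.integral_nonneg_AE AE_I2) (auto split: split_indicator)
  also have "\<dots> = b * laplace_real (\<lambda>y. F t - F (t - y)) b"
    unfolding laplace_real_def set_lebesgue_integral_def
    by (subst integral_mult_right_zero[symmetric]) (intro Bochner_Integration.integral_cong, auto simp: mult_ac)
  finally show "(LINT s:{..<t}|?F. exp (- b * (t - s))) = b * laplace_real (\<lambda>y. F t - F (t - y)) b" .
qed

context stationary_hawkes
begin

text \<open>A right-continuous path is the limit of its values at grid points approaching from the
  right. Each approximation uses countably many times, hence is jointly measurable.\<close>

lemma N_joint_measurable [measurable]: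
  "(\<lambda>p. real_of_int (N k (t - fst p) (snd p))) \<in> borel_measurable (lborel \<Otimes>\<^sub>M M)"
proof (rule borel_measurable_LIMSEQ_real)
  \<comment> \<open>Adding 1 to the floor puts the grid point strictly to the right of
    \<open>t - y\<close>, also when \<open>t - y\<close> is itself a grid point, as the limit from
    the right demands.\<close>
  define s where "s n y = (real_of_int \<lfloor>(t - y) * real (Suc n)\<rfloor> + 1) / real (Suc n)" for n and y :: real
  have s: "t - y < s n y" "s n y \<le> (t - y) + 1 / real (Suc n)" for n y
  proof -
    have "(t - y) * real (Suc n) < real_of_int \<lfloor>(t - y) * real (Suc n)\<rfloor> + 1" by linarith
    then show "t - y < s n y" by (simp add: s_def field_simps)
    have "s n y \<le> ((t - y) * real (Suc n) + 1) / real (Suc n)"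
      unfolding s_def by (intro divide_right_mono) auto
    then show "s n y \<le> (t - y) + 1 / real (Suc n)" by (simp add: add_divide_distrib)
  qed
  fix p :: "real \<times> 'a" assume p: "p \<in> space (lborel \<Otimes>\<^sub>M M)"
  then have \<omega>: "snd p \<in> space M" by (auto simp: space_pair_measure)
  have "(\<lambda>n. s n (fst p)) \<longlonglongrightarrow> t - fst p"
  proof (rule tendsto_sandwich[of "\<lambda>_. t - fst p" _ _ "\<lambda>n. (t - fst p) + 1 / real (Suc n)"])
    show "(\<lambda>n. (t - fst p) + 1 / real (Suc n)) \<longlonglongrightarrow> t - fst p"
      using tendsto_add[OF tendsto_const LIMSEQ_inverse_real_of_nat] by (simp add: inverse_eq_divide)
  qed (auto intro!: always_eventually s(2) less_imp_le[OF s(1)] simp del: of_nat_Suc)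
  then have "filterlim (\<lambda>n. s n (fst p)) (at_right (t - fst p)) sequentially"
    unfolding filterlim_at using s(1) by (auto intro!: always_eventually simp: less_imp_neq[symmetric])
  moreover have "((\<lambda>u. real_of_int (N k u (snd p))) \<longlongrightarrow> real_of_int (N k (t - fst p) (snd p))) (at_right (t - fst p))"
    using N_right_continuous[OF \<omega>] by (simp add: continuous_within)
  ultimately show "(\<lambda>n. real_of_int (N k (s n (fst p)) (snd p))) \<longlonglongrightarrow> real_of_int (N k (t - fst p) (snd p))"
    by (rule filterlim_compose[rotated])
next
  fix n :: nat
  have "(\<lambda>p. real_of_int (N k ((real_of_int m + 1) / real (Suc n)) (snd p))) \<in> borel_measurable (lborel \<Otimes>\<^sub>M M)" for m :: int
    by measurable
  moreover have "(\<lambda>p. \<lfloor>(t - fst p) * real (Suc n)\<rfloor>) \<in> measurable (lborel \<Otimes>\<^sub>M M) (count_space UNIV)"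
    by measurable
  ultimately show "(\<lambda>p. real_of_int (N k ((real_of_int \<lfloor>(t - fst p) * real (Suc n)\<rfloor> + 1) / real (Suc n)) (snd p)))
      \<in> borel_measurable (lborel \<Otimes>\<^sub>M M)"
    by (rule measurable_compose_countable)
qed

text \<open>The integrated form is taken as definition: it makes sense for every path, is ready for
  Fubini, and agrees with the Stieltjes integral only almost surely.\<close>

definition Z :: "'d \<Rightarrow> 'm \<Rightarrow> real \<Rightarrow> 'a \<Rightarrow> real" where
  "Z d k t \<omega> = \<beta> d * laplace_real (\<lambda>y. inc k (t - y) t \<omega>) (\<beta> d)"

text \<open>Random variables against which the intensity may be integrated term by term.\<close>

definition admissible :: "('a \<Rightarrow> real) \<Rightarrow> bool" where
  "admissible X \<longleftrightarrow> X \<in> borel_measurable M \<and> (\<forall>\<omega>\<in>space M. 0 \<le> X \<omega>) \<and> integrable M X \<and>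
     (\<forall>k a b. integrable M (\<lambda>\<omega>. inc k a b \<omega> * X \<omega>)) \<and>
     (\<exists>C. \<forall>k t y. 0 \<le> y \<longrightarrow> (\<integral>\<omega>. inc k (t - y) t \<omega> * X \<omega> \<partial>M) \<le> C * (1 + y))"

lemma admissible_bounded:
  assumes [measurable]: "X \<in> borel_measurable M" and "\<And>\<omega>. 0 \<le> X \<omega>" "\<And>\<omega>. X \<omega> \<le> K"
  shows "admissible X"
  unfolding admissible_def
proof (intro conjI ballI allI)
  have K: "0 \<le> K" using assms(2,3) order_trans by blast
  show "integrable M X" by (rule integrable_const_bound[of _ K]) (use assms in auto)
  show int: "integrable M (\<lambda>\<omega>. inc k a b \<omega> * X \<omega>)" for k a b
    by (rule Bochner_Integration.integrable_bound[of _ "\<lambda>\<omega>. K * inc k a b \<omega>"])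
      (use inc_integrable[of k a b] assms K in \<open>auto simp: abs_mult mult.commute intro!: mult_right_mono\<close>)
  \<comment> \<open>Summing over all components makes the constant independent of
    \<open>k\<close>.\<close>
  have "(\<integral>\<omega>. inc k (t - y) t \<omega> * X \<omega> \<partial>M) \<le> (\<Sum>k\<in>UNIV. K * \<Lambda> $ k) * (1 + y)" if "0 \<le> y" for k t y
  proof -
    have "(\<integral>\<omega>. inc k (t - y) t \<omega> * X \<omega> \<partial>M) \<le> (\<integral>\<omega>. K * inc k (t - y) t \<omega> \<partial>M)"
      using that assms int inc_integrable
      by (intro integral_mono) (auto simp: mult.commute[of K] intro!: mult_left_mono inc_nonneg)
    also have "\<dots> = K * \<Lambda> $ k * y" using that by (simp add: inc_mean)
    also have "\<dots> \<le> (\<Sum>k\<in>UNIV. K * \<Lambda> $ k) * (1 + y)"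
      using that K intensity_vector_nonneg
      by (intro mult_mono member_le_sum) (auto intro!: sum_nonneg)
    finally show ?thesis .
  qed
  then show "\<exists>C. \<forall>k t y. 0 \<le> y \<longrightarrow> (\<integral>\<omega>. inc k (t - y) t \<omega> * X \<omega> \<partial>M) \<le> C * (1 + y)" by blast
qed (use assms in auto)

text \<open>Cauchy-Schwarz, with the square root of \<open>sq\<close> growing at most linearly in
  the length of the window.\<close>

lemma admissible_inc:
  assumes "c \<le> d"
  shows "admissible (inc j c d)"
  unfolding admissible_def
proof (intro conjI ballI allI)
  let ?C = "(\<Sum>k\<in>UNIV. sqrt (sq k 1)) * sqrt (sq j (d - c))"
  have "(\<integral>\<omega>. inc k (t - y) t \<omega> * inc j c d \<omega> \<partial>M) \<le> ?C * (1 + y)" if "0 \<le> y" for k t y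
  proof -
    have "(\<integral>\<omega>. inc k (t - y) t \<omega> * inc j c d \<omega> \<partial>M) \<le> sqrt (sq k (t - (t - y))) * sqrt (sq j (d - c))"
      using that assms by (intro inc_second_moment_le) auto
    also have "\<dots> \<le> (sqrt (sq k 1) * (1 + y)) * sqrt (sq j (d - c))"
      using sqrt_sq_le[OF that, of k] sq_nonneg[of j] by (intro mult_right_mono) auto
    also have "\<dots> \<le> ((\<Sum>k\<in>UNIV. sqrt (sq k 1)) * (1 + y)) * sqrt (sq j (d - c))"
      using that sq_nonneg by (intro mult_right_mono member_le_sum) auto
    finally show ?thesis by (simp add: mult_ac)
  qed
  then show "\<exists>C. \<forall>k t y. 0 \<le> y \<longrightarrow> (\<integral>\<omega>. inc k (t - y) t \<omega> * inc j c d \<omega> \<partial>M) \<le> C * (1 + y)" by blast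
qed (use assms inc_nonneg inc_integrable inc_prod_integrable in auto)

text \<open>The linear bound contained in \<open>admissible\<close>, multiplied by the exponential,
  is the dominating function for exchanging expectation and discounting.\<close>

lemma Z_Fubini:
  assumes X: "admissible X"
  shows "AE \<omega> in M. set_integrable lborel {0..} (\<lambda>y. inc k (t - y) t \<omega> * X \<omega> * exp (- \<beta> d * y))"
    and "integrable M (\<lambda>\<omega>. Z d k t \<omega> * X \<omega>)"
    and "(\<integral>\<omega>. Z d k t \<omega> * X \<omega> \<partial>M) = \<beta> d * laplace_real (\<lambda>y. \<integral>\<omega>. inc k (t - y) t \<omega> * X \<omega> \<partial>M) (\<beta> d)"
proof -
  have [measurable]: "X \<in> borel_measurable M" using X by (simp add: admissible_def)
  obtain C where C: "\<And>y. 0 \<le> y \<Longrightarrow> (\<integral>\<omega>. inc k (t - y) t \<omega> * X \<omega> \<partial>M) \<le> C * (1 + y)"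
    using X unfolding admissible_def by blast
  define f where "f y \<omega> = indicat_real {0..} y *\<^sub>R (inc k (t - y) t \<omega> * X \<omega> * exp (- \<beta> d * y))" for y \<omega>
  have f_eq: "f y \<omega> = inc k (t - y) t \<omega> * X \<omega> * (exp (- \<beta> d * y) * indicat_real {0..} y)" for y \<omega>
    by (simp add: f_def)
  have meas: "case_prod f \<in> borel_measurable (lborel \<Otimes>\<^sub>M M)"
    unfolding f_eq increment_def of_int_diff case_prod_unfold by measurable
  have nonneg: "0 \<le> f y \<omega>" if "\<omega> \<in> space M" for y \<omega>
    unfolding f_eq using X that inc_nonneg[OF that, of "t - y" t k]
    by (auto simp: admissible_def indicator_def)
  have int: "integrable M (f y)" for y
    unfolding f_eq using X by (intro integrable_mult_left) (auto simp: admissible_def)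
  have Ef: "(\<integral>\<omega>. f y \<omega> \<partial>M) = indicat_real {0..} y *\<^sub>R ((\<integral>\<omega>. inc k (t - y) t \<omega> * X \<omega> \<partial>M) * exp (- \<beta> d * y))" for y
    unfolding f_eq by simp
  have le: "(\<integral>\<omega>. f y \<omega> \<partial>M) \<le> indicat_real {0..} y *\<^sub>R (C * (1 + y) * exp (- \<beta> d * y))" for y
    unfolding Ef by (auto simp: indicator_def intro!: C)
  have h: "integrable lborel (\<lambda>y. indicat_real {0..} y *\<^sub>R (C * (1 + y) * exp (- \<beta> d * y)))"
    using laplace_integrable[OF subexponential_affine modes[of d], of C] by (simp add: set_integrable_def)
  note fub = Fubini_nonneg_dominated[OF sigma_finite_measure_axioms sigma_finite_lborel meas nonneg int le h]
  show "AE \<omega> in M. set_integrable lborel {0..} (\<lambda>y. inc k (t - y) t \<omega> * X \<omega> * exp (- \<beta> d * y))"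
    using fub(1) by (simp add: set_integrable_def f_def)
  have ZX: "Z d k t \<omega> * X \<omega> = \<beta> d * (\<integral>y. f y \<omega> \<partial>lborel)" for \<omega>
    unfolding Z_def laplace_real_def set_lebesgue_integral_def f_def
    by (simp add: mult.assoc) (simp add: mult.left_commute[of _ "X \<omega>"] mult.commute[of _ "X \<omega>"])
  show "integrable M (\<lambda>\<omega>. Z d k t \<omega> * X \<omega>)"
    unfolding ZX using fub(2) by simp
  show "(\<integral>\<omega>. Z d k t \<omega> * X \<omega> \<partial>M) = \<beta> d * laplace_real (\<lambda>y. \<integral>\<omega>. inc k (t - y) t \<omega> * X \<omega> \<partial>M) (\<beta> d)"
    unfolding ZX using fub(3) by (simp add: laplace_real_def set_lebesgue_integral_def Ef)
qed

text \<open>If no such \<open>s\<close> exists, every window \<open>(t - 1 / (n + 1), t]\<close>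
  contains an event. By Markov's inequality the probability of this is at most the mean count, which
  tends to 0.\<close>

lemma no_fixed_atom: "AE \<omega> in M. \<exists>s<t. N k s \<omega> = N k t \<omega>"
proof -
  define B where "B = (\<Inter>n. {\<omega>\<in>space M. N k t \<omega> - N k (t - 1 / real (Suc n)) \<omega> \<noteq> 0})"
  have B [measurable]: "B \<in> sets M" unfolding B_def by (intro sets.countable_INT inc_event) auto
  have "prob B \<le> \<Lambda> $ k * (1 / real (Suc n))" for n
  proof -
    have "prob B = (\<integral>\<omega>. indicat_real B \<omega> \<partial>M)" by simp
    also have "\<dots> \<le> (\<integral>\<omega>. inc k (t - 1 / real (Suc n)) t \<omega> \<partial>M)"
    proof (intro integral_mono inc_integrable)
      fix \<omega> assume \<omega>: "\<omega> \<in> space M"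
      then show "indicat_real B \<omega> \<le> inc k (t - 1 / real (Suc n)) t \<omega>"
      proof (cases "\<omega> \<in> B")
        case True
        then have "N k t \<omega> - N k (t - 1 / real (Suc n)) \<omega> \<noteq> 0" by (auto simp: B_def)
        moreover have "0 \<le> N k t \<omega> - N k (t - 1 / real (Suc n)) \<omega>"
          using N_mono[OF \<omega>, of "t - 1 / real (Suc n)" t k] by simp
        ultimately have "1 \<le> N k t \<omega> - N k (t - 1 / real (Suc n)) \<omega>" by linarith
        then have "1 \<le> inc k (t - 1 / real (Suc n)) t \<omega>"
          unfolding increment_def by (metis of_int_1_le_iff)
        then show ?thesis by (simp add: True)
      qed (simp add: inc_nonneg \<omega>)
    qed (simp add: emeasure_eq_measure)
    also have "\<dots> = \<Lambda> $ k * (1 / real (Suc n))" by (subst inc_mean) auto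
    finally show ?thesis .
  qed
  moreover have "(\<lambda>n. \<Lambda> $ k * (1 / real (Suc n))) \<longlonglongrightarrow> \<Lambda> $ k * 0"
    using LIMSEQ_inverse_real_of_nat by (intro tendsto_intros) (simp add: inverse_eq_divide)
  ultimately have "prob B \<le> \<Lambda> $ k * 0" by (intro LIMSEQ_le_const) auto
  then have "prob B = 0" by (simp add: measure_le_0_iff)
  then have "AE \<omega> in M. \<omega> \<notin> B" by (intro AE_not_in) (simp add: null_sets_def emeasure_eq_measure)
  with AE_space show ?thesis
  proof eventually_elim
    case (elim \<omega>)
    then obtain n where "N k t \<omega> - N k (t - 1 / real (Suc n)) \<omega> = 0" by (auto simp: B_def)
    then show ?case by (intro exI[of _ "t - 1 / real (Suc n)"]) auto
  qed
qed

lemma kernel_component: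
  "0 \<le> s \<Longrightarrow> \<Gamma> s $ i $ k = (\<Sum>d\<in>UNIV. A d $ i $ k * exp (- \<beta> d * s))"
  by (simp add: kernel exp_kernel_def mult.commute)

text \<open>Two kinds of exceptional paths are excluded, for finitely many components and modes:
  those with a divergent discounted past and those with an event at time \<open>t\<close>.\<close>

lemma intens_eq:
  "AE \<omega> in M. intens i t \<omega> = v $ i + (\<Sum>k\<in>UNIV. \<Sum>d\<in>UNIV. A d $ i $ k * Z d k t \<omega>)"
proof -
  have "AE \<omega> in M. \<forall>k\<in>UNIV. \<forall>d\<in>UNIV. set_integrable lborel {0..} (\<lambda>y. inc k (t - y) t \<omega> * 1 * exp (- \<beta> d * y))"
    by (intro AE_finite_allI Z_Fubini(1) admissible_bounded[of _ 1]) auto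
  moreover have "AE \<omega> in M. \<forall>k\<in>UNIV. \<exists>s<t. N k s \<omega> = N k t \<omega>"
    by (intro AE_finite_allI no_fixed_atom) auto
  ultimately show ?thesis using AE_space
  proof eventually_elim
    case (elim \<omega>)
    have "(LINT s:{..<t}|interval_measure (\<lambda>s. real_of_int (N k s \<omega>)). \<Gamma> (t - s) $ i $ k) =
        (\<Sum>d\<in>UNIV. A d $ i $ k * Z d k t \<omega>)" for k
    proof -
      let ?F = "\<lambda>s. real_of_int (N k s \<omega>)"
      obtain s0 where s0: "?F s0 = ?F t" "s0 < t" using elim(2) by auto
      have mono: "?F x \<le> ?F y" if "x \<le> y" for x y using N_mono[OF elim(3) that] by simp
      have int: "set_integrable lborel {0..} (\<lambda>y. (?F t - ?F (t - y)) * exp (- \<beta> d * y))" for d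
        using elim(1) by (simp add: increment_def)
      note e = interval_measure_exp[where F = ?F, OF mono N_right_continuous[OF elim(3)] modes int s0]
      have "(LINT s:{..<t}|interval_measure ?F. \<Gamma> (t - s) $ i $ k) =
          (LINT s:{..<t}|interval_measure ?F. (\<Sum>d\<in>UNIV. A d $ i $ k * exp (- \<beta> d * (t - s))))"
        by (intro set_lebesgue_integral_cong) (auto simp: kernel_component)
      also have "\<dots> = (\<Sum>d\<in>UNIV. LINT s:{..<t}|interval_measure ?F. A d $ i $ k * exp (- \<beta> d * (t - s)))"
        unfolding set_lebesgue_integral_def scaleR_sum_right
        using set_integrable_mult_right[OF e(1)] by (intro Bochner_Integration.integral_sum) (simp add: set_integrable_def)
      also have "\<dots> = (\<Sum>d\<in>UNIV. A d $ i $ k * Z d k t \<omega>)"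
        by (simp only: set_integral_mult_right e(2) Z_def increment_def of_int_diff)
      finally show ?thesis .
    qed
    then show ?case by (simp add: intens_def hawkes_intensity_def)
  qed
qed

lemma intens_mult:
  assumes X: "admissible X"
  shows "integrable M (\<lambda>\<omega>. intens i t \<omega> * X \<omega>)"
    and "(\<integral>\<omega>. intens i t \<omega> * X \<omega> \<partial>M) = v $ i * (\<integral>\<omega>. X \<omega> \<partial>M) +
      (\<Sum>k\<in>UNIV. \<Sum>d\<in>UNIV. A d $ i $ k *
        (\<beta> d * laplace_real (\<lambda>y. \<integral>\<omega>. inc k (t - y) t \<omega> * X \<omega> \<partial>M) (\<beta> d)))"
proof -
  let ?g = "\<lambda>\<omega>. v $ i * X \<omega> + (\<Sum>k\<in>UNIV. \<Sum>d\<in>UNIV. A d $ i $ k * (Z d k t \<omega> * X \<omega>))"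
  have [measurable]: "X \<in> borel_measurable M" and Xi: "integrable M X"
    using X by (auto simp: admissible_def)
  have [measurable]: "intens i t \<in> borel_measurable M" using intens_integrable by auto
  have eq: "AE \<omega> in M. intens i t \<omega> * X \<omega> = ?g \<omega>"
    using intens_eq[of i t] by eventually_elim (simp add: distrib_right sum_distrib_right mult.assoc)
  have int: "integrable M ?g"
    using Xi Z_Fubini(2)[OF X] by (intro Bochner_Integration.integrable_add Bochner_Integration.integrable_sum) auto
  then show "integrable M (\<lambda>\<omega>. intens i t \<omega> * X \<omega>)"
    using integrable_cong_AE[OF _ _ eq] borel_measurable_integrable[OF int] by auto
  have "(\<integral>\<omega>. intens i t \<omega> * X \<omega> \<partial>M) = (\<integral>\<omega>. ?g \<omega> \<partial>M)"
    using borel_measurable_integrable[OF int] by (intro integral_cong_AE eq) auto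
  also have "\<dots> = v $ i * (\<integral>\<omega>. X \<omega> \<partial>M) + (\<Sum>k\<in>UNIV. \<Sum>d\<in>UNIV. A d $ i $ k * (\<integral>\<omega>. Z d k t \<omega> * X \<omega> \<partial>M))"
    using Xi Z_Fubini(2)[OF X] by simp
  finally show "(\<integral>\<omega>. intens i t \<omega> * X \<omega> \<partial>M) = v $ i * (\<integral>\<omega>. X \<omega> \<partial>M) +
      (\<Sum>k\<in>UNIV. \<Sum>d\<in>UNIV. A d $ i $ k *
        (\<beta> d * laplace_real (\<lambda>y. \<integral>\<omega>. inc k (t - y) t \<omega> * X \<omega> \<partial>M) (\<beta> d)))"
    by (simp add: Z_Fubini(3)[OF X])
qed

section \<open>Compensators and second moments\<close>

lemma inc_history_measurable:
  assumes "c \<le> d" "d \<le> a"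
  shows "inc j c d \<in> borel_measurable (history M N a)"
proof -
  let ?G = "{(\<lambda>\<omega>. N i b \<omega> - N i a' \<omega>) -` B \<inter> space M | i a' b B. a' \<le> b \<and> b \<le> a}"
  have sp: "space (history M N a) = space M" by (simp add: history_def space_measure_of_conv)
  have se: "sets (history M N a) = sigma_sets (space M) ?G"
    unfolding history_def by (intro sets_measure_of) auto
  have "(\<lambda>\<omega>. N j d \<omega> - N j c \<omega>) \<in> measurable (history M N a) (count_space UNIV)"
  proof (rule measurableI)
    fix B :: "int set"
    have "(\<lambda>\<omega>. N j d \<omega> - N j c \<omega>) -` B \<inter> space M \<in> ?G" using assms by blast
    then show "(\<lambda>\<omega>. N j d \<omega> - N j c \<omega>) -` B \<inter> space (history M N a) \<in> sets (history M N a)"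
      unfolding sp se by (rule sigma_sets.Basic)
  qed simp
  from measurable_compose[OF this, of real_of_int] show ?thesis
    by (simp add: increment_def[abs_def])
qed

lemma history_subalgebra_mono:
  assumes "a \<le> s"
  shows "subalgebra (history M N s) (history M N a)"
proof -
  let ?G = "\<lambda>a. {(\<lambda>\<omega>. N i b \<omega> - N i a' \<omega>) -` B \<inter> space M | i a' b B. a' \<le> b \<and> b \<le> a}"
  have se: "sets (history M N a) = sigma_sets (space M) (?G a)" for a
    unfolding history_def by (intro sets_measure_of) auto
  have "?G a \<subseteq> ?G s" using assms by fastforce
  then show ?thesis
    unfolding subalgebra_def se by (intro conjI sigma_sets_mono') (simp_all add: history_def space_measure_of_conv)
qed

text \<open>The weighted mean count \<open>u i\<close> has right derivative
  \<open>E (intens i s X)\<close>: single events contribute this limit, and the excess of the count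
  over them is \<open>o(h)\<close> in mean. Continuity of this derivative in \<open>s\<close> comes
  from expressing the intensity by discounted pasts, after which the fundamental theorem for right
  derivatives applies.\<close>

lemma compensator_bounded:
  assumes X: "X \<in> borel_measurable (history M N a)" and nonneg: "\<And>\<omega>. 0 \<le> X \<omega>" and bd: "\<And>\<omega>. X \<omega> \<le> K"
    and "a \<le> b"
  shows "((\<lambda>s. \<integral>\<omega>. intens i s \<omega> * X \<omega> \<partial>M) has_integral (\<integral>\<omega>. inc i a b \<omega> * X \<omega> \<partial>M)) {a..b}"
proof -
  have X' [measurable]: "X \<in> borel_measurable M"
    using measurable_from_subalg[OF subalgebra_history[OF counting] X] .
  have K: "0 \<le> K" using order_trans[OF nonneg bd] by blast
  have adm: "admissible X" by (rule admissible_bounded[of _ K]) (use nonneg bd in auto)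
  have Xi: "integrable M (\<lambda>\<omega>. inc k c d \<omega> * X \<omega>)" for k c d using adm by (auto simp: admissible_def)
  define u where "u k s = (\<integral>\<omega>. inc k 0 s \<omega> * X \<omega> \<partial>M)" for k s
  have u_diff: "(\<integral>\<omega>. inc k c d \<omega> * X \<omega> \<partial>M) = u k d - u k c" for k c d
  proof -
    have "inc k c d \<omega> * X \<omega> = inc k 0 d \<omega> * X \<omega> - inc k 0 c \<omega> * X \<omega>" for \<omega>
      by (simp add: increment_def algebra_simps)
    then show ?thesis by (simp add: u_def Xi)
  qed
  have u_lip: "\<bar>u k s - u k s'\<bar> \<le> K * \<Lambda> $ k * \<bar>s - s'\<bar>" for k s s'
  proof -
    have "0 \<le> u k s' - u k s \<and> u k s' - u k s \<le> K * \<Lambda> $ k * (s' - s)" if "s \<le> s'" for s s'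
    proof
      show "0 \<le> u k s' - u k s" unfolding u_diff[symmetric]
        using that nonneg inc_nonneg by (intro Bochner_Integration.integral_nonneg_AE AE_I2) simp
      have "u k s' - u k s \<le> (\<integral>\<omega>. K * inc k s s' \<omega> \<partial>M)" unfolding u_diff[symmetric]
        using that bd Xi inc_integrable inc_nonneg
        by (intro integral_mono) (auto simp: mult.commute[of K] intro!: mult_left_mono)
      then show "u k s' - u k s \<le> K * \<Lambda> $ k * (s' - s)" using that by (simp add: inc_mean)
    qed
    from this[of s s'] this[of s' s] show ?thesis by (cases "s \<le> s'") (auto simp: abs_if)
  qed
  have u_cont: "continuous_on S (u k)" for S k
    using lipschitz_on_continuous_on[of "K * \<Lambda> $ k" UNIV "u k"] u_lip K intensity_vector_nonneg[of k]
    by (auto simp: lipschitz_on_def dist_real_def intro: continuous_on_subset)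
  \<comment> \<open>The mean of the increment over \<open>(s - y, s]\<close> weighted by
    \<open>X\<close>. Its transform in \<open>y\<close> is the weighted mean of the discounted past
    at \<open>s\<close>, up to the factor \<open>\<beta> d\<close>, and inherits the Lipschitz
    dependence on \<open>s\<close> from \<open>u\<close>.\<close>
  define l where "l k s y = u k s - u k (s - y)" for k s y
  have l_sub: "subexponential (l k s)" for k s
  proof (rule subexponential_bounded_by[where g = "\<lambda>y. K * \<Lambda> $ k * y"])
    show "continuous_on {0..} (l k s)" unfolding l_def
      by (intro continuous_intros continuous_on_compose2[OF u_cont[of UNIV]]) auto
    show "\<bar>l k s y\<bar> \<le> K * \<Lambda> $ k * y" if "0 \<le> y" for y
      using u_lip[of k s "s - y"] that by (simp add: l_def)
  qed (intro subexponential_cmult subexponential_ident)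
  have l_cont: "continuous_on {a..b} (\<lambda>s. laplace_real (l k s) (\<beta> d))" for k d
  proof (rule lipschitz_on_continuous_on)
    show "(2 * (K * \<Lambda> $ k) / \<beta> d)-lipschitz_on {a..b} (\<lambda>s. laplace_real (l k s) (\<beta> d))"
    proof (rule lipschitz_onI)
      show "0 \<le> 2 * (K * \<Lambda> $ k) / \<beta> d" using K intensity_vector_nonneg[of k] modes[of d] by simp
      fix s s'
      have "\<bar>l k s y - l k s' y\<bar> \<le> 2 * (K * \<Lambda> $ k) * \<bar>s - s'\<bar>" for y
        using u_lip[of k s s'] u_lip[of k "s - y" "s' - y"] by (simp add: l_def)
      then have "\<bar>laplace_real (\<lambda>y. l k s y - l k s' y) (\<beta> d)\<bar> \<le> laplace_real (\<lambda>_. 2 * (K * \<Lambda> $ k) * \<bar>s - s'\<bar>) (\<beta> d)"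
        by (intro laplace_real_abs_le subexponential_const modes)
      then show "dist (laplace_real (l k s) (\<beta> d)) (laplace_real (l k s') (\<beta> d)) \<le> 2 * (K * \<Lambda> $ k) / \<beta> d * dist s s'"
        by (simp add: laplace_real_diff l_sub modes laplace_real_const dist_real_def)
    qed
  qed
  have G_eq: "(\<integral>\<omega>. intens i s \<omega> * X \<omega> \<partial>M) = v $ i * (\<integral>\<omega>. X \<omega> \<partial>M) +
      (\<Sum>k\<in>UNIV. \<Sum>d\<in>UNIV. A d $ i $ k * (\<beta> d * laplace_real (l k s) (\<beta> d)))" for s
    unfolding intens_mult(2)[OF adm] u_diff l_def by simp
  have "((\<lambda>s. \<integral>\<omega>. intens i s \<omega> * X \<omega> \<partial>M) has_integral u i b - u i a) {a..b}"
  proof (rule has_integral_right_derivative[OF \<open>a \<le> b\<close> u_cont])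
    show "continuous_on {a..b} (\<lambda>s. \<integral>\<omega>. intens i s \<omega> * X \<omega> \<partial>M)"
      unfolding G_eq by (intro continuous_intros l_cont)
    fix s assume s: "a \<le> s" "s < b"
    \<comment> \<open>A variable from the past of \<open>a\<close> also belongs to the past of every
      later \<open>s\<close>, so the intensity at \<open>s\<close> may be tested against it.\<close>
    have Xs: "X \<in> borel_measurable (history M N s)"
      using measurable_from_subalg[OF history_subalgebra_mono[OF s(1)] X] .
    let ?I = "\<lambda>h \<omega>. indicat_real {\<omega>\<in>space M. N i (s + h) \<omega> - N i s \<omega> = 1} \<omega>"
    have Ii: "integrable M (\<lambda>\<omega>. X \<omega> * ?I h \<omega>)" for h
      by (rule integrable_const_bound[of _ K]) (use nonneg bd K in \<open>auto simp: indicator_def\<close>)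
    have I1: "integrable M (?I h)" for h by (simp add: emeasure_eq_measure)
    have "((\<lambda>h. (\<integral>\<omega>. (inc i s (s + h) \<omega> - ?I h \<omega>) * X \<omega> \<partial>M) / h) \<longlongrightarrow> 0) (at_right 0)"
    proof (rule Lim_null_comparison)
      show "((\<lambda>h. K * ((\<integral>\<omega>. inc i s (s + h) \<omega> - ?I h \<omega> \<partial>M) / h)) \<longlongrightarrow> 0) (at_right 0)"
        by (rule tendsto_mult_right_zero[OF multiple_event_mean_tendsto])
      show "\<forall>\<^sub>F h in at_right 0. norm ((\<integral>\<omega>. (inc i s (s + h) \<omega> - ?I h \<omega>) * X \<omega> \<partial>M) / h) \<le>
          K * ((\<integral>\<omega>. inc i s (s + h) \<omega> - ?I h \<omega> \<partial>M) / h)"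
        using eventually_at_right_less[of 0]
      proof eventually_elim
        case (elim h)
        have n: "0 \<le> inc i s (s + h) \<omega> - ?I h \<omega>" if "\<omega> \<in> space M" for \<omega>
          using inc_nonneg[OF that, of s "s + h" i] elim by (auto simp: indicator_def increment_def)
        have "0 \<le> (\<integral>\<omega>. (inc i s (s + h) \<omega> - ?I h \<omega>) * X \<omega> \<partial>M)"
          using n nonneg by (intro Bochner_Integration.integral_nonneg_AE AE_I2) auto
        moreover have "(\<integral>\<omega>. (inc i s (s + h) \<omega> - ?I h \<omega>) * X \<omega> \<partial>M) \<le> (\<integral>\<omega>. K * (inc i s (s + h) \<omega> - ?I h \<omega>) \<partial>M)"
        proof (intro integral_mono)
          show "integrable M (\<lambda>\<omega>. (inc i s (s + h) \<omega> - ?I h \<omega>) * X \<omega>)"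
            using Bochner_Integration.integrable_diff[OF Xi Ii, of i s "s + h" h]
            by (simp only: left_diff_distrib right_diff_distrib mult.commute[of _ "X _"])
          show "integrable M (\<lambda>\<omega>. K * (inc i s (s + h) \<omega> - ?I h \<omega>))"
            by (intro integrable_mult_right Bochner_Integration.integrable_diff inc_integrable I1)
          show "(inc i s (s + h) \<omega> - ?I h \<omega>) * X \<omega> \<le> K * (inc i s (s + h) \<omega> - ?I h \<omega>)" if "\<omega> \<in> space M" for \<omega>
            using mult_left_mono[OF bd n[OF that]] by (simp add: mult.commute)
        qed
        ultimately show ?case using elim by (simp add: divide_right_mono)
      qed
    qed
    from tendsto_add[OF this single_event_tendsto[OF Xs, of K i]]
    have "((\<lambda>h. (\<integral>\<omega>. (inc i s (s + h) \<omega> - ?I h \<omega>) * X \<omega> \<partial>M) / h + (\<integral>\<omega>. X \<omega> * ?I h \<omega> \<partial>M) / h)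
        \<longlongrightarrow> (\<integral>\<omega>. intens i s \<omega> * X \<omega> \<partial>M)) (at_right 0)"
      using nonneg bd by (simp add: mult.commute)
    moreover have "(\<integral>\<omega>. (inc i s (s + h) \<omega> - ?I h \<omega>) * X \<omega> \<partial>M) / h + (\<integral>\<omega>. X \<omega> * ?I h \<omega> \<partial>M) / h
        = (u i (s + h) - u i s) / h" for h
    proof -
      have "(\<integral>\<omega>. (inc i s (s + h) \<omega> - ?I h \<omega>) * X \<omega> \<partial>M) + (\<integral>\<omega>. X \<omega> * ?I h \<omega> \<partial>M) = u i (s + h) - u i s"
        unfolding u_diff[symmetric] left_diff_distrib mult.commute[of "?I h _"]
        by (subst Bochner_Integration.integral_diff[OF Xi Ii]) simp
      then show ?thesis by (simp flip: add_divide_distrib)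
    qed
    ultimately show "((\<lambda>h. (u i (s + h) - u i s) / h) \<longlongrightarrow> (\<integral>\<omega>. intens i s \<omega> * X \<omega> \<partial>M)) (at_right 0)"
      by simp
  qed
  then show ?thesis by (simp add: u_diff)
qed

text \<open>The factor with which the discounted pasts enter the Cauchy-Schwarz bound: each count in
  a window of length \<open>y\<close> has root second moment at most
  \<open>sqrt (sq k 1) * (1 + y)\<close>.\<close>

definition past_const :: "'m \<Rightarrow> real" where
  "past_const i = (\<Sum>k\<in>UNIV. \<Sum>d\<in>UNIV. \<bar>A d $ i $ k\<bar> * (\<beta> d * laplace_real (\<lambda>y. sqrt (sq k 1) * (1 + y)) (\<beta> d)))"

text \<open>The bound does not depend on \<open>s\<close>, which gives domination in the compensator
  identity, and it tends to 0 with \<open>d - c\<close>, which gives continuity of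
  \<open>F\<close>.\<close>

lemma intens_inc_le:
  assumes "c \<le> d"
  shows "\<bar>\<integral>\<omega>. intens i s \<omega> * inc j c d \<omega> \<partial>M\<bar> \<le> \<bar>v $ i\<bar> * (\<Lambda> $ j * (d - c)) + past_const i * sqrt (sq j (d - c))"
proof -
  let ?L = "\<lambda>k e. laplace_real (\<lambda>y. \<integral>\<omega>. inc k (s - y) s \<omega> * inc j c d \<omega> \<partial>M) (\<beta> e)"
  let ?B = "\<lambda>k e. laplace_real (\<lambda>y. sqrt (sq k 1) * (1 + y)) (\<beta> e)"
  have L: "\<bar>?L k e\<bar> \<le> ?B k e * sqrt (sq j (d - c))" for k e
  proof -
    have "\<bar>?L k e\<bar> \<le> laplace_real (\<lambda>y. sqrt (sq j (d - c)) * (sqrt (sq k 1) * (1 + y))) (\<beta> e)"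
    proof (intro laplace_real_abs_le subexponential_cmult[OF subexponential_affine] modes)
      fix y :: real assume y: "0 \<le> y"
      have "(\<integral>\<omega>. inc k (s - y) s \<omega> * inc j c d \<omega> \<partial>M) \<le> sqrt (sq k (s - (s - y))) * sqrt (sq j (d - c))"
        using y assms by (intro inc_second_moment_le) auto
      also have "\<dots> \<le> (sqrt (sq k 1) * (1 + y)) * sqrt (sq j (d - c))"
        using sqrt_sq_le[OF y, of k] sq_nonneg[of j] by (intro mult_right_mono) auto
      finally show "\<bar>\<integral>\<omega>. inc k (s - y) s \<omega> * inc j c d \<omega> \<partial>M\<bar> \<le> sqrt (sq j (d - c)) * (sqrt (sq k 1) * (1 + y))"
        using inc_second_moment_nonneg[of "s - y" s c d k j] y assms by (simp add: mult.commute)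
    qed
    then show ?thesis by (simp add: laplace_real_cmult mult.commute)
  qed
  have "\<bar>\<Sum>k\<in>UNIV. \<Sum>e\<in>UNIV. A e $ i $ k * (\<beta> e * ?L k e)\<bar> \<le>
      (\<Sum>k\<in>UNIV. \<Sum>e\<in>UNIV. \<bar>A e $ i $ k\<bar> * (\<beta> e * (?B k e * sqrt (sq j (d - c)))))"
  proof (intro order_trans[OF sum_abs] sum_mono)
    fix k e
    show "\<bar>A e $ i $ k * (\<beta> e * ?L k e)\<bar> \<le> \<bar>A e $ i $ k\<bar> * (\<beta> e * (?B k e * sqrt (sq j (d - c))))"
      using L[of k e] modes[of e] by (simp add: abs_mult mult_left_mono)
  qed
  also have "\<dots> = past_const i * sqrt (sq j (d - c))"
    by (simp add: past_const_def sum_distrib_right mult.assoc)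
  finally have "\<bar>\<Sum>k\<in>UNIV. \<Sum>e\<in>UNIV. A e $ i $ k * (\<beta> e * ?L k e)\<bar> \<le> past_const i * sqrt (sq j (d - c))" .
  moreover have "\<bar>v $ i * (\<integral>\<omega>. inc j c d \<omega> \<partial>M)\<bar> = \<bar>v $ i\<bar> * (\<Lambda> $ j * (d - c))"
    using assms intensity_vector_nonneg[of j] by (simp add: inc_mean abs_mult)
  ultimately show ?thesis unfolding intens_mult(2)[OF admissible_inc[OF assms]] by linarith
qed

text \<open>Truncated increments are bounded variables of the past. The identity passes to the limit
  by dominated convergence three times: under the expectation on each side and in the time
  integral.\<close>

lemma compensator_inc:
  assumes "c \<le> d" "d \<le> a" "a \<le> b"
  shows "((\<lambda>s. \<integral>\<omega>. intens i s \<omega> * inc j c d \<omega> \<partial>M) has_integral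
    (\<integral>\<omega>. inc i a b \<omega> * inc j c d \<omega> \<partial>M)) {a..b}"
proof -
  \<comment> \<open>The maximum with 0 matters off \<open>space M\<close>, where increments may be
    negative while the bounded case asks for nonnegativity at every point.\<close>
  define X where "X n \<omega> = max 0 (min (inc j c d \<omega>) (real n))" for n \<omega>
  have adm: "admissible (inc j c d)" using assms by (intro admissible_inc)
  have X_meas: "X n \<in> borel_measurable (history M N a)" for n
    unfolding X_def using inc_history_measurable[OF assms(1,2), of j] by measurable
  have X_meas' [measurable]: "X n \<in> borel_measurable M" for n
    unfolding X_def by measurable
  have X_bd: "0 \<le> X n \<omega>" "X n \<omega> \<le> real n" for n \<omega> by (auto simp: X_def)
  have X_le: "\<bar>X n \<omega>\<bar> \<le> inc j c d \<omega>" if "\<omega> \<in> space M" for n \<omega>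
    using inc_nonneg[OF that assms(1), of j] by (auto simp: X_def)
  have X_lim: "(\<lambda>n. X n \<omega>) \<longlonglongrightarrow> inc j c d \<omega>" if "\<omega> \<in> space M" for \<omega>
  proof (rule tendsto_eventually)
    obtain m where m: "inc j c d \<omega> \<le> real m" using real_arch_simple by blast
    show "\<forall>\<^sub>F n in sequentially. X n \<omega> = inc j c d \<omega>"
      using eventually_ge_at_top[of m]
    proof eventually_elim
      case (elim n)
      then have "inc j c d \<omega> \<le> real n" using m by linarith
      with inc_nonneg[OF that assms(1), of j] show ?case by (simp add: X_def)
    qed
  qed
  have intens_meas [measurable]: "intens i s \<in> borel_measurable M" for s using intens_integrable by auto
  let ?B = "\<bar>v $ i\<bar> * (\<Lambda> $ j * (d - c)) + past_const i * sqrt (sq j (d - c))"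
  show ?thesis
  proof (rule has_integral_dominated_convergence)
    show "((\<lambda>s. \<integral>\<omega>. intens i s \<omega> * X n \<omega> \<partial>M) has_integral (\<integral>\<omega>. inc i a b \<omega> * X n \<omega> \<partial>M)) {a..b}" for n
      by (intro compensator_bounded[of _ _ "real n"] X_meas X_bd assms)
    show "(\<lambda>_. ?B) integrable_on {a..b}" by (intro integrable_const_ivl)
    show "\<forall>s\<in>{a..b}. norm (\<integral>\<omega>. intens i s \<omega> * X n \<omega> \<partial>M) \<le> ?B" for n
    proof
      fix s
      have Xn: "integrable M (\<lambda>\<omega>. intens i s \<omega> * X n \<omega>)"
        by (intro intens_mult(1) admissible_bounded[of _ "real n"] X_bd) measurable
      \<comment> \<open>Positivity of the intensity makes the truncated moment at most the full one,
        and the full one has a bound uniform in \<open>s\<close>.\<close>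
      have "norm (\<integral>\<omega>. intens i s \<omega> * X n \<omega> \<partial>M) \<le> (\<integral>\<omega>. intens i s \<omega> * inc j c d \<omega> \<partial>M)"
      proof (rule order_trans[OF integral_norm_bound integral_mono_AE])
        show "integrable M (\<lambda>\<omega>. norm (intens i s \<omega> * X n \<omega>))" using Xn by (rule integrable_norm)
        show "integrable M (\<lambda>\<omega>. intens i s \<omega> * inc j c d \<omega>)" by (rule intens_mult(1)[OF adm])
        show "AE \<omega> in M. norm (intens i s \<omega> * X n \<omega>) \<le> intens i s \<omega> * inc j c d \<omega>"
          using intens_pos[of i s] AE_space
          by eventually_elim (auto simp: abs_mult intro!: mult_mono X_le)
      qed
      also have "\<dots> \<le> ?B" using intens_inc_le[OF assms(1), of i s j] by linarith
      finally show "norm (\<integral>\<omega>. intens i s \<omega> * X n \<omega> \<partial>M) \<le> ?B" .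
    qed
    show "\<forall>s\<in>{a..b}. (\<lambda>n. \<integral>\<omega>. intens i s \<omega> * X n \<omega> \<partial>M) \<longlonglongrightarrow> (\<integral>\<omega>. intens i s \<omega> * inc j c d \<omega> \<partial>M)"
    proof
      fix s
      show "(\<lambda>n. \<integral>\<omega>. intens i s \<omega> * X n \<omega> \<partial>M) \<longlonglongrightarrow> (\<integral>\<omega>. intens i s \<omega> * inc j c d \<omega> \<partial>M)"
      proof (rule integral_dominated_convergence)
        show "integrable M (\<lambda>\<omega>. norm (intens i s \<omega> * inc j c d \<omega>))"
          by (intro integrable_norm intens_mult(1) adm)
        show "AE \<omega> in M. (\<lambda>n. intens i s \<omega> * X n \<omega>) \<longlonglongrightarrow> intens i s \<omega> * inc j c d \<omega>"
          by (intro AE_I2 tendsto_intros X_lim)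
        show "AE \<omega> in M. norm (intens i s \<omega> * X n \<omega>) \<le> norm (intens i s \<omega> * inc j c d \<omega>)" for n
          unfolding real_norm_def abs_mult
          by (intro AE_I2 mult_left_mono order_trans[OF X_le abs_ge_self]) auto
      qed measurable
    qed
    show "(\<lambda>n. \<integral>\<omega>. inc i a b \<omega> * X n \<omega> \<partial>M) \<longlonglongrightarrow> (\<integral>\<omega>. inc i a b \<omega> * inc j c d \<omega> \<partial>M)"
    proof (rule integral_dominated_convergence)
      show "integrable M (\<lambda>\<omega>. norm (inc i a b \<omega> * inc j c d \<omega>))"
        by (intro integrable_norm inc_prod_integrable)
      show "AE \<omega> in M. (\<lambda>n. inc i a b \<omega> * X n \<omega>) \<longlonglongrightarrow> inc i a b \<omega> * inc j c d \<omega>"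
        by (intro AE_I2 tendsto_intros X_lim)
      show "AE \<omega> in M. norm (inc i a b \<omega> * X n \<omega>) \<le> norm (inc i a b \<omega> * inc j c d \<omega>)" for n
        unfolding real_norm_def abs_mult
        by (intro AE_I2 mult_left_mono order_trans[OF X_le abs_ge_self]) auto
    qed measurable
  qed
qed

section \<open>The mixed moment of intensity and past, and second moments of increments\<close>

definition F :: "'m \<Rightarrow> 'm \<Rightarrow> real \<Rightarrow> real" where
  "F i j x = (\<integral>\<omega>. intens i 0 \<omega> * inc j (- x) 0 \<omega> \<partial>M)"

text \<open>Stationarity is assumed for increments only, so the shift in time is carried out after
  expanding the intensity into moments of increments.\<close>

lemma intens_inc:
  assumes "c \<le> d" "d \<le> s"
  shows "(\<integral>\<omega>. intens i s \<omega> * inc j c d \<omega> \<partial>M) = F i j (s - c) - F i j (s - d)"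
proof -
  have adm: "admissible (inc j a b)" if "a \<le> b" for a b using that by (rule admissible_inc)
  have "(\<integral>\<omega>. intens i s \<omega> * inc j c d \<omega> \<partial>M) = (\<integral>\<omega>. intens i 0 \<omega> * inc j (c - s) (d - s) \<omega> \<partial>M)"
  proof -
    have "(\<integral>\<omega>. inc k (s - y) s \<omega> * inc j c d \<omega> \<partial>M) = (\<integral>\<omega>. inc k (0 - y) 0 \<omega> * inc j (c - s) (d - s) \<omega> \<partial>M)" for k y
      using inc_second_moment_shift[of k "0 - y" s 0 j "c - s" "d - s"] by simp
    then show ?thesis
      using assms by (simp add: intens_mult(2) adm inc_mean)
  qed
  also have "\<dots> = (\<integral>\<omega>. intens i 0 \<omega> * inc j (c - s) 0 \<omega> - intens i 0 \<omega> * inc j (d - s) 0 \<omega> \<partial>M)"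
    by (intro Bochner_Integration.integral_cong) (simp_all add: increment_def algebra_simps)
  also have "\<dots> = F i j (s - c) - F i j (s - d)"
    unfolding F_def using assms by (subst Bochner_Integration.integral_diff) (auto intro!: intens_mult(1) adm)
  finally show ?thesis .
qed

lemma F_0 [simp]: "F i j 0 = 0"
  by (simp add: F_def increment_def)

text \<open>A difference of two values of \<open>F\<close> is a moment over the window between them,
  so the bound of \<open>intens_inc_le\<close> is a modulus of continuity.\<close>

lemma F_cont: "continuous_on {0..} (F i j)"
proof -
  define m where "m h = \<bar>v $ i\<bar> * (\<Lambda> $ j * h) + past_const i * sqrt (sq j h)" for h
  have le: "\<bar>F i j y - F i j x\<bar> \<le> m (y - x)" if "0 \<le> x" "x \<le> y" for x y
    using intens_inc_le[of "- y" "- x" i 0 j] intens_inc[of "- y" "- x" 0 i j] that by (simp add: m_def)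
  have "(m \<longlongrightarrow> \<bar>v $ i\<bar> * (\<Lambda> $ j * 0) + past_const i * sqrt 0) (at_right 0)"
    unfolding m_def by (intro tendsto_intros sq_tendsto_0)
  then have m0: "(m \<longlongrightarrow> 0) (at_right 0)" by simp
  show ?thesis
    unfolding continuous_on_iff
  proof (intro ballI allI impI)
    fix x e :: real assume "x \<in> {0..}" "0 < e"
    have "\<forall>\<^sub>F h in at_right 0. m h < e" using order_tendstoD(2)[OF m0 \<open>0 < e\<close>] .
    then obtain b where b: "0 < b" "\<And>h. 0 < h \<Longrightarrow> h < b \<Longrightarrow> m h < e"
      unfolding eventually_at_right_field by auto
    have "dist (F i j y) (F i j x) < e" if "y \<in> {0..}" "dist y x < b" for y
    proof (cases "x = y")
      case False
      then have "m \<bar>y - x\<bar> < e" using that by (intro b) (auto simp: dist_real_def)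
      moreover have "\<bar>F i j y - F i j x\<bar> \<le> m \<bar>y - x\<bar>"
        using le[of x y] le[of y x] that \<open>x \<in> {0..}\<close> by (cases "x \<le> y") (auto simp: abs_minus_commute)
      ultimately show ?thesis by (simp add: dist_real_def)
    qed (simp add: \<open>0 < e\<close>)
    then show "\<exists>d>0. \<forall>y\<in>{0..}. dist y x < d \<longrightarrow> dist (F i j y) (F i j x) < e" using b(1) by blast
  qed
qed

lemma subexponential_F: "subexponential (F i j)"
proof (rule subexponential_bounded_by[OF F_cont])
  let ?g = "\<lambda>x. (\<bar>v $ i\<bar> * \<Lambda> $ j) * (1 + x) + (\<bar>past_const i\<bar> * sqrt (sq j 1)) * (1 + x)"
  show "subexponential ?g" by (intro subexponential_add subexponential_affine)
  fix x :: real assume x: "0 \<le> x"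
  have "\<bar>F i j x\<bar> \<le> \<bar>v $ i\<bar> * (\<Lambda> $ j * x) + past_const i * sqrt (sq j x)"
    using intens_inc_le[of "- x" 0 i 0 j] x by (simp add: F_def)
  also have "\<dots> \<le> (\<bar>v $ i\<bar> * \<Lambda> $ j) * (1 + x) + \<bar>past_const i\<bar> * (sqrt (sq j 1) * (1 + x))"
  proof (rule add_mono)
    show "\<bar>v $ i\<bar> * (\<Lambda> $ j * x) \<le> (\<bar>v $ i\<bar> * \<Lambda> $ j) * (1 + x)"
      using intensity_vector_nonneg[of j] by (simp add: mult.assoc mult_left_mono)
    show "past_const i * sqrt (sq j x) \<le> \<bar>past_const i\<bar> * (sqrt (sq j 1) * (1 + x))"
      using sqrt_sq_le[OF x, of j] sq_nonneg[of j x] by (intro mult_mono) auto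
  qed
  finally show "\<bar>F i j x\<bar> \<le> ?g x" by (simp add: mult.assoc)
qed

definition \<Phi> :: "'m \<Rightarrow> 'm \<Rightarrow> real \<Rightarrow> real" where
  "\<Phi> i j x = integral {0..x} (F i j)"

lemma \<Phi>_0 [simp]: "\<Phi> i j 0 = 0"
  by (simp add: \<Phi>_def)

lemma \<Phi>_deriv: "0 \<le> x \<Longrightarrow> (\<Phi> i j has_real_derivative F i j x) (at x within {0..})"
  unfolding \<Phi>_def by (rule has_real_derivative_integral_atLeast[OF F_cont])

text \<open>The compensator identity makes the moment the integral of
  \<open>F i j (s - c) - F i j (s - d)\<close> over \<open>s\<close>; evaluating the primitive at
  both ends gives a mixed second difference of \<open>\<Phi>\<close>.\<close>

lemma inc_cross_moment:
  assumes "c \<le> d" "d \<le> a" "a \<le> b"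
  shows "(\<integral>\<omega>. inc i a b \<omega> * inc j c d \<omega> \<partial>M) =
    (\<Phi> i j (b - c) - \<Phi> i j (b - d)) - (\<Phi> i j (a - c) - \<Phi> i j (a - d))"
proof -
  have shift: "((\<lambda>s. \<Phi> i j (s - e)) has_real_derivative F i j (s - e)) (at s within {a..b})"
    if "e \<le> a" "a \<le> s" for s e
  proof -
    have "((\<Phi> i j \<circ> (\<lambda>s. s - e)) has_real_derivative F i j (s - e) * 1) (at s within {a..b})"
      using that by (intro DERIV_image_chain DERIV_subset[OF \<Phi>_deriv]) (auto intro!: derivative_eq_intros)
    then show ?thesis by (simp add: o_def)
  qed
  have "((\<lambda>s. F i j (s - c) - F i j (s - d)) has_integral
      (\<Phi> i j (b - c) - \<Phi> i j (b - d)) - (\<Phi> i j (a - c) - \<Phi> i j (a - d))) {a..b}"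
    using assms
    by (intro fundamental_theorem_of_calculus)
      (auto simp flip: has_real_derivative_iff_has_vector_derivative intro!: DERIV_diff shift)
  moreover have "((\<lambda>s. F i j (s - c) - F i j (s - d)) has_integral
      (\<integral>\<omega>. inc i a b \<omega> * inc j c d \<omega> \<partial>M)) {a..b}"
    by (rule has_integral_eq[OF _ compensator_inc[OF assms]]) (use assms in \<open>auto simp: intens_inc\<close>)
  ultimately show ?thesis by (rule has_integral_unique[symmetric])
qed

text \<open>The derivative of \<open>\<Phi>\<close> at 0 is \<open>F i j 0 = 0\<close>. Hence
  \<open>2 ^ n\<close> copies of \<open>\<Phi>\<close> at the mesh size vanish in the limit.\<close>

lemma \<Phi>_small: "((\<lambda>h. \<Phi> i j h / h) \<longlongrightarrow> 0) (at_right 0)"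
  using \<Phi>_deriv[of 0 i j] by (simp add: has_field_derivative_iff at_within_Ici_at_right)

text \<open>Splitting the square \<open>(0, y] \<times> (0, y]\<close> along the diagonal cells
  leaves a staircase on each side. On a staircase all windows are disjoint, and the compensator
  formula telescopes to \<open>\<Phi>\<close>; the diagonal cells supply the atom.\<close>

lemma inc_diagonal_moment:
  assumes "0 \<le> y"
  shows "(\<integral>\<omega>. inc i 0 y \<omega> * inc j 0 y \<omega> \<partial>M) = (if i = j then \<Lambda> $ i * y else 0) + \<Phi> i j y + \<Phi> j i y"
proof (cases "y = 0")
  case True
  then show ?thesis by (simp add: increment_def)
next
  case False
  with assms have y: "0 < y" by simp
  define D where "D n = (\<Sum>p<(2::nat) ^ n. \<integral>\<omega>. inc i (cell y n p) (cell y n (Suc p)) \<omega> *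
    inc j (cell y n p) (cell y n (Suc p)) \<omega> \<partial>M)" for n :: nat
  have D: "D \<longlonglongrightarrow> (if i = j then \<Lambda> $ i * y else 0)"
    unfolding D_def by (rule diagonal_sum_tendsto[OF y])
  \<comment> \<open>Each row of the staircase is an increment of \<open>\<Phi>\<close> minus the
    mesh term \<open>\<Phi> k l (y / 2 ^ n)\<close>. The increments telescope; the mesh terms are
    written as \<open>y\<close> times a quotient that tends to 0.\<close>
  have cross: "(\<Sum>p<(2::nat) ^ n. \<integral>\<omega>. inc k (cell y n p) (cell y n (Suc p)) \<omega> * inc l 0 (cell y n p) \<omega> \<partial>M) =
      \<Phi> k l y - y * (\<Phi> k l (y / 2 ^ n) / (y / 2 ^ n))" for k l and n :: nat
  proof -
    have "(\<Sum>p<(2::nat) ^ n. \<integral>\<omega>. inc k (cell y n p) (cell y n (Suc p)) \<omega> * inc l 0 (cell y n p) \<omega> \<partial>M) =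
      (\<Sum>p<(2::nat) ^ n. (\<Phi> k l (cell y n (Suc p)) - \<Phi> k l (cell y n p)) - \<Phi> k l (y / 2 ^ n))"
    proof (intro sum.cong refl)
      fix p
      show "(\<integral>\<omega>. inc k (cell y n p) (cell y n (Suc p)) \<omega> * inc l 0 (cell y n p) \<omega> \<partial>M) =
        (\<Phi> k l (cell y n (Suc p)) - \<Phi> k l (cell y n p)) - \<Phi> k l (y / 2 ^ n)"
        using cell_mono[of y p "Suc p" n] cell_mono[of y 0 p n] assms
        by (subst inc_cross_moment) (auto simp: cell_Suc[of y n p])
    qed
    also have "\<dots> = (\<Sum>p<(2::nat) ^ n. \<Phi> k l (cell y n (Suc p)) - \<Phi> k l (cell y n p)) - (\<Sum>p<(2::nat) ^ n. \<Phi> k l (y / 2 ^ n))"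
      by (rule sum_subtractf)
    also have "\<dots> = \<Phi> k l y - 2 ^ n * \<Phi> k l (y / 2 ^ n)"
      by (subst sum_lessThan_telescope) simp
    finally show ?thesis using y by simp
  qed
  have eq: "(\<integral>\<omega>. inc i 0 y \<omega> * inc j 0 y \<omega> \<partial>M) = D n + (\<Phi> i j y - y * (\<Phi> i j (y / 2 ^ n) / (y / 2 ^ n)))
      + (\<Phi> j i y - y * (\<Phi> j i (y / 2 ^ n) / (y / 2 ^ n)))" for n :: nat
  proof -
    let ?I = "\<lambda>k p. inc k (cell y n p) (cell y n (Suc p))"
    have "inc i 0 y \<omega> * inc j 0 y \<omega> = (\<Sum>p<(2::nat) ^ n. ?I i p \<omega> * ?I j p \<omega> +
        ?I i p \<omega> * inc j 0 (cell y n p) \<omega> + ?I j p \<omega> * inc i 0 (cell y n p) \<omega>)" for \<omega>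
    proof -
      \<comment> \<open>Summation by parts: the product of the counts telescopes along the grid, and
        each step splits into a diagonal term and one term for each staircase.\<close>
      have "inc i 0 y \<omega> * inc j 0 y \<omega> = (\<Sum>p<(2::nat) ^ n. inc i 0 (cell y n (Suc p)) \<omega> * inc j 0 (cell y n (Suc p)) \<omega>
          - inc i 0 (cell y n p) \<omega> * inc j 0 (cell y n p) \<omega>)"
        by (subst sum_lessThan_telescope) (simp add: increment_def)
      also have "\<dots> = (\<Sum>p<(2::nat) ^ n. ?I i p \<omega> * ?I j p \<omega> +
        ?I i p \<omega> * inc j 0 (cell y n p) \<omega> + ?I j p \<omega> * inc i 0 (cell y n p) \<omega>)"
        by (intro sum.cong refl) (simp add: increment_def algebra_simps)
      finally show ?thesis .
    qed
    then have "(\<integral>\<omega>. inc i 0 y \<omega> * inc j 0 y \<omega> \<partial>M) = D n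
      + (\<Sum>p<(2::nat) ^ n. \<integral>\<omega>. ?I i p \<omega> * inc j 0 (cell y n p) \<omega> \<partial>M)
      + (\<Sum>p<(2::nat) ^ n. \<integral>\<omega>. ?I j p \<omega> * inc i 0 (cell y n p) \<omega> \<partial>M)"
      by (simp add: D_def inc_prod_integrable sum.distrib)
    then show ?thesis unfolding cross .
  qed
  have "(\<lambda>n. D n + (\<Phi> i j y - y * (\<Phi> i j (y / 2 ^ n) / (y / 2 ^ n)))
      + (\<Phi> j i y - y * (\<Phi> j i (y / 2 ^ n) / (y / 2 ^ n)))) \<longlonglongrightarrow>
    (if i = j then \<Lambda> $ i * y else 0) + (\<Phi> i j y - y * 0) + (\<Phi> j i y - y * 0)"
    by (intro tendsto_add tendsto_diff tendsto_mult tendsto_const D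
        filterlim_compose[OF \<Phi>_small mesh_filterlim[OF y]])
  from LIMSEQ_unique[OF tendsto_const this[folded eq]] show ?thesis by simp
qed

text \<open>Cutting the longer window at \<open>- y\<close> leaves a disjoint pair and a common
  window, both already computed.\<close>

lemma inc_past_moment:
  assumes "0 \<le> y" "y \<le> x"
  shows "(\<integral>\<omega>. inc k (- y) 0 \<omega> * inc j (- x) 0 \<omega> \<partial>M) =
    \<Phi> k j x - \<Phi> k j (x - y) + \<Phi> j k y + (if k = j then \<Lambda> $ k * y else 0)"
proof -
  have "(\<integral>\<omega>. inc k (- y) 0 \<omega> * inc j (- x) 0 \<omega> \<partial>M) =
    (\<integral>\<omega>. inc k (- y) 0 \<omega> * inc j (- x) (- y) \<omega> + inc k (- y) 0 \<omega> * inc j (- y) 0 \<omega> \<partial>M)"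
    by (simp add: inc_combine flip: distrib_left)
  also have "\<dots> = (\<integral>\<omega>. inc k (- y) 0 \<omega> * inc j (- x) (- y) \<omega> \<partial>M) + (\<integral>\<omega>. inc k (- y) 0 \<omega> * inc j (- y) 0 \<omega> \<partial>M)"
    by (intro Bochner_Integration.integral_add inc_prod_integrable)
  also have "(\<integral>\<omega>. inc k (- y) 0 \<omega> * inc j (- y) 0 \<omega> \<partial>M) = (\<integral>\<omega>. inc k 0 y \<omega> * inc j 0 y \<omega> \<partial>M)"
    using inc_second_moment_shift[of k 0 "- y" y j 0 y] by simp
  also have "\<dots> = (if k = j then \<Lambda> $ k * y else 0) + \<Phi> k j y + \<Phi> j k y"
    by (rule inc_diagonal_moment[OF assms(1)])
  also have "(\<integral>\<omega>. inc k (- y) 0 \<omega> * inc j (- x) (- y) \<omega> \<partial>M) = (\<Phi> k j x - \<Phi> k j y) - (\<Phi> k j (x - y) - \<Phi> k j 0)"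
    using assms by (subst inc_cross_moment) auto
  finally show ?thesis by simp
qed

section \<open>The covariance density and its Laplace transform\<close>

lemma subexponential_\<Phi>: "subexponential (\<Phi> i j)"
proof -
  \<comment> \<open>At rate 0 the exponential convolution is the plain primitive.\<close>
  have "\<Phi> i j = exp_conv 0 (F i j)" by (simp add: fun_eq_iff exp_conv_def \<Phi>_def)
  then show ?thesis using subexponential_exp_conv[OF subexponential_F, of 0 i j] by simp
qed

text \<open>The moment changes formula when \<open>y\<close> passes \<open>x\<close>, since then the
  other window becomes the longer one. Each branch is differentiated: by parts on
  \<open>[0, x]\<close> and by the transform rule on the tail. The boundary terms at
  \<open>x\<close> cancel, and the two pieces of the transform of \<open>F j k\<close> recombine, so
  only the convolution with \<open>F k j\<close> still sees \<open>x\<close> as a cut.\<close>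

lemma laplace_past_moment:
  assumes x: "0 \<le> x" and s: "0 < s"
  shows "s * laplace_real (\<lambda>y. \<integral>\<omega>. inc k (- y) 0 \<omega> * inc j (- x) 0 \<omega> \<partial>M) s =
    (1 - exp (- s * x)) * (laplace_real (F j k) s + (if k = j then \<Lambda> $ k else 0) / s) + exp_conv s (F k j) x"
proof -
  define g where "g y = (\<integral>\<omega>. inc k (- y) 0 \<omega> * inc j (- x) 0 \<omega> \<partial>M)" for y
  define D where "D = (if k = j then \<Lambda> $ k else 0)"
  define g1 where "g1 y = \<Phi> k j x - \<Phi> k j (x - y) + \<Phi> j k y + D * y" for y
  define g2 where "g2 y = \<Phi> j k (x + y) - \<Phi> j k y + (\<Phi> k j x + D * x)" for y
  have g1: "g y = g1 y" if "0 \<le> y" "y \<le> x" for y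
    using inc_past_moment[OF that, of k j] by (simp add: g_def g1_def D_def)
  \<comment> \<open>Beyond \<open>x\<close> the window of component \<open>j\<close> is the shorter
    one, so the formula is used with the roles of \<open>j\<close> and \<open>k\<close>
    exchanged.\<close>
  have g2: "g (x + y) = g2 y" if "0 \<le> y" for y
    using inc_past_moment[OF x, of "x + y" j k] that
    by (auto simp: g_def g2_def D_def mult.commute)
  have g: "subexponential g"
  proof (rule subexponential_bounded_by)
    \<comment> \<open>One expression valid on both sides of \<open>x\<close>; the maxima and the
      minimum exhibit continuity across it.\<close>
    have eq: "g y = \<Phi> k j x - \<Phi> k j (max 0 (x - y)) + (\<Phi> j k y - \<Phi> j k (max 0 (y - x))) + D * min x y"
      if "y \<in> {0..}" for y
      using that g1[of y] g2[of "y - x"] by (cases "y \<le> x") (auto simp: g1_def g2_def)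
    have c: "continuous_on {0..} (\<Phi> i l)" for i l by (rule subexponential_cont[OF subexponential_\<Phi>])
    have "continuous_on {0..} (\<lambda>y. \<Phi> k j x - \<Phi> k j (max 0 (x - y)) + (\<Phi> j k y - \<Phi> j k (max 0 (y - x))) + D * min x y)"
      by (intro continuous_intros continuous_on_compose2[OF c]) auto
    then show "continuous_on {0..} g" using eq by (subst continuous_on_cong[OF refl]) auto
    show "subexponential (\<lambda>y. (sqrt (sq j x) * sqrt (sq k 1)) * (1 + y))" by (rule subexponential_affine)
    fix y :: real assume y: "0 \<le> y"
    have "g y \<le> sqrt (sq k y) * sqrt (sq j x)"
      using inc_second_moment_le[of "- y" 0 "- x" 0 k j] x y by (simp add: g_def)
    also have "\<dots> \<le> (sqrt (sq k 1) * (1 + y)) * sqrt (sq j x)"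
      using sqrt_sq_le[OF y] sq_nonneg by (intro mult_right_mono) auto
    finally show "\<bar>g y\<bar> \<le> (sqrt (sq j x) * sqrt (sq k 1)) * (1 + y)"
      using inc_second_moment_nonneg[of "- y" 0 "- x" 0 k j] x y by (simp add: g_def mult_ac)
  qed
  have F': "continuous_on {0..x} (F j k)" by (rule continuous_on_subset[OF F_cont]) auto
  have F'': "continuous_on {0..x} (\<lambda>y. F k j (x - y))"
    by (intro continuous_on_compose2[OF F_cont] continuous_intros) auto
  have "integral {0..x} (\<lambda>y. (F k j (x - y) + F j k y + D) * exp (- s * y)) =
      g1 x * exp (- s * x) - g1 0 + s * integral {0..x} (\<lambda>y. g1 y * exp (- s * y))"
  proof (rule integral_deriv_exp[OF _ _ x])
    show "continuous_on {0..x} (\<lambda>y. F k j (x - y) + F j k y + D)"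
      by (intro continuous_intros F' F'')
    fix y assume y: "0 \<le> y" "y \<le> x"
    have 1: "(\<Phi> j k has_real_derivative F j k y) (at y within {0..x})"
      using y by (intro DERIV_subset[OF \<Phi>_deriv]) auto
    have "((\<Phi> k j \<circ> (\<lambda>y. x - y)) has_real_derivative F k j (x - y) * - 1) (at y within {0..x})"
      using y by (intro DERIV_image_chain DERIV_subset[OF \<Phi>_deriv]) (auto intro!: derivative_eq_intros)
    then have 2: "((\<lambda>y. \<Phi> k j (x - y)) has_real_derivative - F k j (x - y)) (at y within {0..x})"
      by (simp add: o_def)
    show "(g1 has_real_derivative F k j (x - y) + F j k y + D) (at y within {0..x})"
      unfolding g1_def by (auto intro!: derivative_eq_intros 1 2)
  qed
  moreover have "g1 0 = 0" by (simp add: g1_def)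
  moreover have "integral {0..x} (\<lambda>y. g1 y * exp (- s * y)) = integral {0..x} (\<lambda>y. g y * exp (- s * y))"
    by (intro Henstock_Kurzweil_Integration.integral_cong) (simp add: g1)
  moreover have "integral {0..x} (\<lambda>y. (F k j (x - y) + F j k y + D) * exp (- s * y)) =
      exp_conv s (F k j) x + integral {0..x} (\<lambda>y. F j k y * exp (- s * y)) + D * ((1 - exp (- s * x)) / s)"
  proof -
    have "integral {0..x} (\<lambda>y. (F k j (x - y) + F j k y + D) * exp (- s * y)) =
      integral {0..x} (\<lambda>y. F k j (x - y) * exp (- s * y)) + integral {0..x} (\<lambda>y. F j k y * exp (- s * y))
      + integral {0..x} (\<lambda>y. D * exp (- s * y))"
    proof -
      have "(\<lambda>y. F k j (x - y) * exp (- s * y)) integrable_on {0..x}" "(\<lambda>y. F j k y * exp (- s * y)) integrable_on {0..x}"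
        "(\<lambda>y. D * exp (- s * y)) integrable_on {0..x}"
        using F' F'' by (auto intro!: integrable_continuous_real continuous_intros)
      then show ?thesis
        unfolding distrib_right by (simp only: Henstock_Kurzweil_Integration.integral_add integrable_add)
    qed
    then show ?thesis
      using integral_exp_neg[OF s x] exp_conv_reflect[OF x F_cont, of k j s] by simp
  qed
  moreover have "laplace_real (\<lambda>y. F j k (x + y) - F j k y) s = s * laplace_real g2 s - g2 0"
  proof (rule laplace_real_deriv[OF _ _ _ s])
    show "subexponential (\<lambda>y. F j k (x + y) - F j k y)" "subexponential g2"
      unfolding g2_def
      by (intro subexponential_diff subexponential_add subexponential_const subexponential_shift
          subexponential_F subexponential_\<Phi> x)+
    fix y :: real assume y: "0 \<le> y"
    have "((\<Phi> j k \<circ> (\<lambda>y. x + y)) has_real_derivative F j k (x + y) * 1) (at y within {0..})"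
      using y x by (intro DERIV_image_chain DERIV_subset[OF \<Phi>_deriv]) (auto intro!: derivative_eq_intros)
    then have 2: "((\<lambda>y. \<Phi> j k (x + y)) has_real_derivative F j k (x + y)) (at y within {0..})"
      by (simp add: o_def)
    show "(g2 has_real_derivative F j k (x + y) - F j k y) (at y within {0..})"
      unfolding g2_def by (auto intro!: derivative_eq_intros 2 \<Phi>_deriv y)
  qed
  moreover have "laplace_real (\<lambda>y. F j k (x + y) - F j k y) s = laplace_real (\<lambda>y. F j k (x + y)) s - laplace_real (F j k) s"
    by (intro laplace_real_diff subexponential_shift subexponential_F x s)
  moreover have "g2 0 = g1 x" by (simp add: g1_def g2_def)
  moreover have "laplace_real (\<lambda>y. g (x + y)) s = laplace_real g2 s"
    by (rule laplace_real_cong) (rule g2)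
  moreover note laplace_real_split[OF g s x] laplace_real_split[OF subexponential_F s x, of j k]
  ultimately have parts: "exp_conv s (F k j) x + integral {0..x} (\<lambda>y. F j k y * exp (- s * y)) + D * ((1 - exp (- s * x)) / s)
      = g1 x * exp (- s * x) + s * integral {0..x} (\<lambda>y. g y * exp (- s * y))"
    and tail: "s * laplace_real g2 s = laplace_real (\<lambda>y. F j k (x + y)) s - laplace_real (F j k) s + g1 x"
    and Lg: "laplace_real g s = integral {0..x} (\<lambda>y. g y * exp (- s * y)) + exp (- s * x) * laplace_real g2 s"
    and LF: "laplace_real (F j k) s = integral {0..x} (\<lambda>y. F j k y * exp (- s * y)) + exp (- s * x) * laplace_real (\<lambda>y. F j k (x + y)) s"
    by simp_all
  \<comment> \<open>The boundary value \<open>g1 x\<close> enters \<open>parts\<close> and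
    \<open>tail\<close> with opposite effect and drops out.\<close>
  have "s * laplace_real g s = s * integral {0..x} (\<lambda>y. g y * exp (- s * y)) + exp (- s * x) * (s * laplace_real g2 s)"
    unfolding Lg by (simp add: distrib_left)
  also have "\<dots> = exp_conv s (F k j) x
      + (integral {0..x} (\<lambda>y. F j k y * exp (- s * y)) + exp (- s * x) * laplace_real (\<lambda>y. F j k (x + y)) s)
      - exp (- s * x) * laplace_real (F j k) s + D * ((1 - exp (- s * x)) / s)"
    unfolding tail using parts by (simp add: distrib_left right_diff_distrib mult.commute)
  also have "\<dots> = (1 - exp (- s * x)) * (laplace_real (F j k) s + D / s) + exp_conv s (F k j) x"
    unfolding LF[symmetric] by (simp add: left_diff_distrib distrib_left mult.commute)
  finally have "s * laplace_real g s = (1 - exp (- s * x)) * (laplace_real (F j k) s + D / s) + exp_conv s (F k j) x" .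
  then show ?thesis by (simp add: g_def[abs_def] D_def)
qed

text \<open>On the right \<open>F\<close> occurs only inside \<open>exp_conv\<close> and in
  constants, so the right side is continuously differentiable although \<open>F\<close> is so far
  merely continuous.\<close>

lemma F_renewal:
  assumes "0 \<le> x"
  shows "F i j x = v $ i * \<Lambda> $ j * x + (\<Sum>k\<in>UNIV. \<Sum>d\<in>UNIV. A d $ i $ k *
    ((1 - exp (- \<beta> d * x)) * (laplace_real (F j k) (\<beta> d) + (if k = j then \<Lambda> $ k else 0) / \<beta> d)
      + exp_conv (\<beta> d) (F k j) x))"
proof -
  have "- x \<le> 0" using assms by simp
  then show ?thesis
    unfolding F_def[of i j x] intens_mult(2)[OF admissible_inc[OF \<open>- x \<le> 0\<close>]] inc_mean[OF \<open>- x \<le> 0\<close>] diff_0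
      laplace_past_moment[OF assms modes] by (simp only: minus_minus mult.assoc)
qed

text \<open>The right side of \<open>F_renewal\<close> differentiated term by term, with the
  derivative of \<open>exp_conv b f\<close> written as \<open>f - b * exp_conv b f\<close>.\<close>

definition moment_density :: "'m \<Rightarrow> 'm \<Rightarrow> real \<Rightarrow> real" where
  "moment_density i j x = v $ i * \<Lambda> $ j + (\<Sum>k\<in>UNIV. \<Sum>d\<in>UNIV. A d $ i $ k *
    ((\<beta> d * laplace_real (F j k) (\<beta> d) + (if k = j then \<Lambda> $ k else 0)) * exp (- \<beta> d * x)
      + (F k j x - \<beta> d * exp_conv (\<beta> d) (F k j) x)))"

lemma subexponential_moment_density: "subexponential (moment_density i j)"
  unfolding moment_density_def using modes[THEN less_imp_le]
  by (intro subexponential_add subexponential_const subexponential_sum subexponential_cmult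
      subexponential_exp_neg subexponential_diff subexponential_F subexponential_exp_conv)

lemma F_deriv:
  assumes "0 \<le> x"
  shows "(F i j has_real_derivative moment_density i j x) (at x within {0..})"
proof -
  let ?G = "\<lambda>x. v $ i * \<Lambda> $ j * x + (\<Sum>k\<in>UNIV. \<Sum>d\<in>UNIV. A d $ i $ k *
    ((1 - exp (- \<beta> d * x)) * (laplace_real (F j k) (\<beta> d) + (if k = j then \<Lambda> $ k else 0) / \<beta> d)
      + exp_conv (\<beta> d) (F k j) x))"
  have piece: "((\<lambda>x. (1 - exp (- \<beta> d * x)) * (l + e / \<beta> d) + exp_conv (\<beta> d) (F k j) x) has_real_derivative
      (\<beta> d * l + e) * exp (- \<beta> d * x) + (F k j x - \<beta> d * exp_conv (\<beta> d) (F k j) x)) (at x within {0..})" for d k l e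
  proof -
    have "\<beta> d \<noteq> 0" using modes[of d] by simp
    then show ?thesis
      by (auto intro!: derivative_eq_intros exp_conv_deriv[OF F_cont assms] simp: field_simps)
  qed
  have "(?G has_real_derivative moment_density i j x) (at x within {0..})"
    unfolding moment_density_def by (intro DERIV_add DERIV_sum DERIV_cmult piece) (auto intro!: derivative_eq_intros)
  then show ?thesis
    by (rule has_field_derivative_transform_within[OF _ zero_less_one]) (use assms F_renewal in auto)
qed

lemma laplace_moment_density: "0 < s \<Longrightarrow> laplace_real (moment_density i j) s = s * laplace_real (F i j) s"
  using laplace_real_deriv[OF F_deriv subexponential_F subexponential_moment_density, of s i j] by simp

text \<open>Both the exponential and the convolution contribute the denominator
  \<open>s + \<beta> d\<close>. The transforms of \<open>F\<close>, at \<open>s\<close> and at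
  \<open>\<beta> d\<close>, carry the factors that turn them into transforms of its
  derivative.\<close>

lemma laplace_moment_density_eq:
  assumes s: "0 < s"
  shows "laplace_real (moment_density i j) s = v $ i * \<Lambda> $ j / s + (\<Sum>k\<in>UNIV. \<Sum>d\<in>UNIV. A d $ i $ k *
    ((if k = j then \<Lambda> $ k else 0) + laplace_real (moment_density k j) s + laplace_real (moment_density j k) (\<beta> d)) / (s + \<beta> d))"
proof -
  note sub = subexponential_add subexponential_const subexponential_sum subexponential_cmult
      subexponential_exp_neg subexponential_diff subexponential_F subexponential_exp_conv modes[THEN less_imp_le]
  let ?c = "\<lambda>k d. \<beta> d * laplace_real (F j k) (\<beta> d) + (if k = j then \<Lambda> $ k else 0)"
  have piece: "laplace_real (\<lambda>x. ?c k d * exp (- \<beta> d * x) + (F k j x - \<beta> d * exp_conv (\<beta> d) (F k j) x)) s =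
      ((if k = j then \<Lambda> $ k else 0) + laplace_real (moment_density k j) s + laplace_real (moment_density j k) (\<beta> d)) / (s + \<beta> d)" for k d
  proof -
    have "laplace_real (\<lambda>x. ?c k d * exp (- \<beta> d * x) + (F k j x - \<beta> d * exp_conv (\<beta> d) (F k j) x)) s =
      laplace_real (\<lambda>x. ?c k d * exp (- \<beta> d * x)) s + laplace_real (\<lambda>x. F k j x - \<beta> d * exp_conv (\<beta> d) (F k j) x) s"
      by (intro laplace_real_add sub s)
    also have "laplace_real (\<lambda>x. F k j x - \<beta> d * exp_conv (\<beta> d) (F k j) x) s =
      laplace_real (F k j) s - laplace_real (\<lambda>x. \<beta> d * exp_conv (\<beta> d) (F k j) x) s"
      by (intro laplace_real_diff sub s)
    also have "\<dots> = laplace_real (F k j) s - \<beta> d * (laplace_real (F k j) s / (s + \<beta> d))"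
      using s modes[of d] by (simp add: laplace_real_cmult laplace_real_exp_conv subexponential_F)
    \<comment> \<open>The factor \<open>s\<close> left after the subtraction is what converts the
      transform of \<open>F k j\<close> into that of its density.\<close>
    also have "\<dots> = s * laplace_real (F k j) s / (s + \<beta> d)"
      using s modes[of d] by (simp add: field_simps)
    also have "laplace_real (\<lambda>x. ?c k d * exp (- \<beta> d * x)) s = ?c k d / (s + \<beta> d)"
      using s modes[of d] by (simp only: laplace_real_cmult laplace_real_exp) simp
    finally show ?thesis
      using s modes[of d] by (simp add: laplace_moment_density add_divide_distrib)
  qed
  have "laplace_real (moment_density i j) s = laplace_real (\<lambda>x. v $ i * \<Lambda> $ j) s +
      laplace_real (\<lambda>x. \<Sum>k\<in>UNIV. \<Sum>d\<in>UNIV. A d $ i $ k * (?c k d * exp (- \<beta> d * x) + (F k j x - \<beta> d * exp_conv (\<beta> d) (F k j) x))) s"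
    unfolding moment_density_def[abs_def] by (intro laplace_real_add sub s)
  also have "laplace_real (\<lambda>x. \<Sum>k\<in>UNIV. \<Sum>d\<in>UNIV. A d $ i $ k * (?c k d * exp (- \<beta> d * x) + (F k j x - \<beta> d * exp_conv (\<beta> d) (F k j) x))) s
    = (\<Sum>k\<in>UNIV. laplace_real (\<lambda>x. \<Sum>d\<in>UNIV. A d $ i $ k * (?c k d * exp (- \<beta> d * x) + (F k j x - \<beta> d * exp_conv (\<beta> d) (F k j) x))) s)"
    by (intro laplace_real_sum sub s finite)
  also have "\<dots> = (\<Sum>k\<in>UNIV. \<Sum>d\<in>UNIV. laplace_real (\<lambda>x. A d $ i $ k * (?c k d * exp (- \<beta> d * x) + (F k j x - \<beta> d * exp_conv (\<beta> d) (F k j) x))) s)"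
    by (intro sum.cong refl laplace_real_sum sub s finite)
  also have "laplace_real (\<lambda>x. v $ i * \<Lambda> $ j) s = v $ i * \<Lambda> $ j / s"
    by (rule laplace_real_const[OF s])
  finally show ?thesis by (simp only: laplace_real_cmult piece times_divide_eq_right)
qed

text \<open>The intensity tested against the constant 1. A mean increment is linear in
  \<open>y\<close>, and the transform of \<open>y\<close> at \<open>\<beta> d\<close> is the inverse
  square of \<open>\<beta> d\<close>, one factor of which the normalisation of \<open>Z\<close>
  removes.\<close>

lemma mean_intensity_eq: "\<Lambda> $ i = v $ i + (\<Sum>k\<in>UNIV. \<Sum>d\<in>UNIV. A d $ i $ k * \<Lambda> $ k / \<beta> d)"
proof -
  have adm: "admissible (\<lambda>_. 1)" by (rule admissible_bounded[of _ 1]) auto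
  have L: "\<beta> d * laplace_real (\<lambda>y. \<integral>\<omega>. inc k (0 - y) 0 \<omega> * 1 \<partial>M) (\<beta> d) = \<Lambda> $ k / \<beta> d" for k d
  proof -
    have "laplace_real (\<lambda>y. \<integral>\<omega>. inc k (0 - y) 0 \<omega> * 1 \<partial>M) (\<beta> d) = laplace_real (\<lambda>y. \<Lambda> $ k * y) (\<beta> d)"
      by (rule laplace_real_cong) (simp add: inc_mean)
    then show ?thesis
      using modes[of d] by (simp add: laplace_real_cmult laplace_real_ident power2_eq_square)
  qed
  show ?thesis
    using intens_mult(2)[OF adm, of i 0] unfolding L by (simp add: intens_mean prob_space)
qed

text \<open>The covariance over windows of length \<open>h\<close> at lag \<open>\<tau>\<close> is a
  symmetric second difference of \<open>\<Phi>\<close> divided by \<open>h\<^sup>2\<close>, minus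
  the product of the means. Since \<open>\<Phi>\<close> has second derivative
  \<open>moment_density\<close>, uniqueness of limits identifies the density.\<close>

lemma covariance_density_eq:
  assumes cov: "is_covariance_density M N \<Lambda> \<Omega>" and \<tau>: "0 < \<tau>"
  shows "\<Omega> \<tau> $ i $ j = moment_density i j \<tau> - \<Lambda> $ i * \<Lambda> $ j"
proof (rule tendsto_unique)
  show "((\<lambda>h. \<integral>\<omega>. (diff_quot N h (0 + \<tau>) \<omega> - \<Lambda>) $ i * (diff_quot N h 0 \<omega> - \<Lambda>) $ j \<partial>M)
      \<longlongrightarrow> \<Omega> \<tau> $ i $ j) (at_right 0)"
    using cov \<tau> unfolding is_covariance_density_def by blast
  have at: "(f has_real_derivative D) (at x)" if "(f has_real_derivative D) (at x within {0..})" "0 < x" for f D and x :: real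
    using that at_within_interior[of x "{0..}"] by simp
  have "((\<lambda>h. (\<Phi> i j (\<tau> + h) - 2 * \<Phi> i j \<tau> + \<Phi> i j (\<tau> - h)) / h\<^sup>2 - \<Lambda> $ i * \<Lambda> $ j)
      \<longlongrightarrow> moment_density i j \<tau> - \<Lambda> $ i * \<Lambda> $ j) (at_right 0)"
    by (intro tendsto_intros second_difference_tendsto[where F = "F i j"] at \<Phi>_deriv F_deriv \<tau>
        continuous_on_subset[OF subexponential_cont[OF subexponential_moment_density]]) auto
  moreover have "\<forall>\<^sub>F h in at_right 0. (\<Phi> i j (\<tau> + h) - 2 * \<Phi> i j \<tau> + \<Phi> i j (\<tau> - h)) / h\<^sup>2 - \<Lambda> $ i * \<Lambda> $ j =
      (\<integral>\<omega>. (diff_quot N h (0 + \<tau>) \<omega> - \<Lambda>) $ i * (diff_quot N h 0 \<omega> - \<Lambda>) $ j \<partial>M)"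
    using eventually_at_right_real[OF \<tau>]
  proof eventually_elim
    case (elim h)
    \<comment> \<open>With \<open>h\<close> below the lag the windows \<open>(0, h]\<close> and
      \<open>(\<tau>, \<tau> + h]\<close> are disjoint and ordered, as the cross moment formula
      requires.\<close>
    then have h: "0 < h" "h < \<tau>" by auto
    have "(\<integral>\<omega>. (diff_quot N h (0 + \<tau>) \<omega> - \<Lambda>) $ i * (diff_quot N h 0 \<omega> - \<Lambda>) $ j \<partial>M) =
      (\<integral>\<omega>. inc i \<tau> (\<tau> + h) \<omega> * inc j 0 h \<omega> * (1 / h\<^sup>2) - inc i \<tau> (\<tau> + h) \<omega> * (\<Lambda> $ j / h)
        - inc j 0 h \<omega> * (\<Lambda> $ i / h) + \<Lambda> $ i * \<Lambda> $ j \<partial>M)"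
      using h by (intro Bochner_Integration.integral_cong)
        (auto simp: diff_quot_def increment_def field_simps power2_eq_square)
    also have "\<dots> = (\<integral>\<omega>. inc i \<tau> (\<tau> + h) \<omega> * inc j 0 h \<omega> \<partial>M) * (1 / h\<^sup>2) - (\<integral>\<omega>. inc i \<tau> (\<tau> + h) \<omega> \<partial>M) * (\<Lambda> $ j / h)
        - (\<integral>\<omega>. inc j 0 h \<omega> \<partial>M) * (\<Lambda> $ i / h) + \<Lambda> $ i * \<Lambda> $ j"
      by (simp add: inc_prod_integrable inc_integrable prob_space)
    also have "(\<integral>\<omega>. inc i \<tau> (\<tau> + h) \<omega> * inc j 0 h \<omega> \<partial>M) = \<Phi> i j (\<tau> + h) - 2 * \<Phi> i j \<tau> + \<Phi> i j (\<tau> - h)"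
      using h by (subst inc_cross_moment) auto
    finally show ?case using h by (simp add: inc_mean)
  qed
  ultimately show "((\<lambda>h. \<integral>\<omega>. (diff_quot N h (0 + \<tau>) \<omega> - \<Lambda>) $ i * (diff_quot N h 0 \<omega> - \<Lambda>) $ j \<partial>M)
      \<longlongrightarrow> moment_density i j \<tau> - \<Lambda> $ i * \<Lambda> $ j) (at_right 0)"
    by (simp add: tendsto_cong)
qed simp

lemma laplace_covariance_density:
  assumes cov: "is_covariance_density M N \<Lambda> \<Omega>" and s: "0 < s"
  shows "laplace \<Omega> s $ i $ j = laplace_real (moment_density i j) s - \<Lambda> $ i * \<Lambda> $ j / s"
proof -
  let ?d = "\<lambda>t. moment_density i j t - \<Lambda> $ i * \<Lambda> $ j"
  let ?g = "\<lambda>t. indicat_real {0..} t *\<^sub>R (?d t * exp (- s * t))"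
  let ?f = "\<lambda>t. indicat_real {0..} t *\<^sub>R (\<Omega> t $ i $ j * exp (- s * t))"
  have sub: "subexponential ?d" by (intro subexponential_diff subexponential_moment_density subexponential_const)
  have g [measurable]: "?g \<in> borel_measurable borel"
    using laplace_integrable[OF sub s] by (simp add: set_integrable_def borel_measurable_integrable)
  \<comment> \<open>The density is identified only for positive times; its value at 0 is arbitrary,
    but a single point does not affect the integral.\<close>
  have f_eq: "?f t = (if t = 0 then \<Omega> 0 $ i $ j else ?g t)" for t
    using covariance_density_eq[OF cov, of t i j] by (cases "t \<le> 0") (auto simp: indicator_def)
  have f: "?f \<in> borel_measurable borel" unfolding f_eq by measurable
  have "laplace \<Omega> s $ i $ j = (\<integral>t. ?f t \<partial>lborel)" by (simp add: laplace_def set_lebesgue_integral_def)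
  also have "\<dots> = (\<integral>t. ?g t \<partial>lborel)"
  proof (intro integral_cong_AE)
    show "AE t in lborel. ?f t = ?g t"
      using AE_lborel_singleton[of 0] by eventually_elim (simp only: f_eq if_False)
  qed (use f g in simp_all)
  also have "\<dots> = laplace_real ?d s" by (simp add: laplace_real_def set_lebesgue_integral_def)
  also have "\<dots> = laplace_real (moment_density i j) s - \<Lambda> $ i * \<Lambda> $ j / s"
    using s by (simp add: laplace_real_diff subexponential_moment_density subexponential_const laplace_real_const)
  finally show ?thesis .
qed

text \<open>Centring subtracts \<open>\<Lambda> $ k * \<Lambda> $ j\<close> times
  \<open>1 / s + 1 / \<beta> d\<close> in each summand. This sum of inverses has numerator
  \<open>s + \<beta> d\<close>, which cancels the denominator. The mean equation then collapses the
  corrections to \<open>(\<Lambda> $ i - v $ i) * \<Lambda> $ j / s\<close>, which removes the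
  baseline term.\<close>

lemma laplace_covariance_system:
  assumes cov: "is_covariance_density M N \<Lambda> \<Omega>" and s: "0 < s"
  shows "laplace \<Omega> s $ i $ j = (\<Sum>k\<in>UNIV. \<Sum>d\<in>UNIV. A d $ i $ k *
    ((diag \<Lambda> + laplace \<Omega> s + transpose (laplace \<Omega> (\<beta> d))) $ k $ j / (s + \<beta> d)))"
proof -
  note L = laplace_covariance_density[OF cov]
  have summand: "A d $ i $ k * ((diag \<Lambda> + laplace \<Omega> s + transpose (laplace \<Omega> (\<beta> d))) $ k $ j / (s + \<beta> d)) =
    A d $ i $ k * ((if k = j then \<Lambda> $ k else 0) + laplace_real (moment_density k j) s + laplace_real (moment_density j k) (\<beta> d)) / (s + \<beta> d)
      - A d $ i $ k * \<Lambda> $ k / \<beta> d * (\<Lambda> $ j / s)" for k d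
  proof -
    have "(diag \<Lambda> + laplace \<Omega> s + transpose (laplace \<Omega> (\<beta> d))) $ k $ j =
      (if k = j then \<Lambda> $ k else 0) + laplace_real (moment_density k j) s + laplace_real (moment_density j k) (\<beta> d)
        - \<Lambda> $ k * \<Lambda> $ j * ((s + \<beta> d) / (s * \<beta> d))"
      using s modes[of d] by (simp add: diag_def transpose_def L field_simps)
    moreover have "\<Lambda> $ k * \<Lambda> $ j * ((s + \<beta> d) / (s * \<beta> d)) / (s + \<beta> d) = \<Lambda> $ k / \<beta> d * (\<Lambda> $ j / s)"
      using s modes[of d] by simp
    ultimately show ?thesis by (simp add: diff_divide_distrib right_diff_distrib)
  qed
  have "(\<Sum>k\<in>UNIV. \<Sum>d\<in>UNIV. A d $ i $ k * \<Lambda> $ k / \<beta> d * (\<Lambda> $ j / s)) = (\<Lambda> $ i - v $ i) * (\<Lambda> $ j / s)"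
  proof -
    have "\<Lambda> $ i - v $ i = (\<Sum>k\<in>UNIV. \<Sum>d\<in>UNIV. A d $ i $ k * \<Lambda> $ k / \<beta> d)"
      using mean_intensity_eq[of i] by simp
    then show ?thesis by (simp only: sum_distrib_right)
  qed
  then show ?thesis
    unfolding summand sum_subtractf L[OF s]
    by (subst laplace_moment_density_eq[OF s]) (simp add: left_diff_distrib diff_divide_distrib)
qed

end

theorem proposition2:
  fixes M :: "'a measure"
    and N :: "'m::finite \<Rightarrow> real \<Rightarrow> 'a \<Rightarrow> int"
    and v \<Lambda> :: "real^'m"
    and \<Gamma> \<Omega> :: "real \<Rightarrow> real^'m^'m"
    and A :: "'d::finite \<Rightarrow> real^'m^'m"
    and \<beta> :: "'d \<Rightarrow> real"
  assumes hawkes: "hawkes_process M N v \<Gamma>"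
    and stationary: "stationary_increments M N"
    and mean: "\<And>t. mean_intensity M N v \<Gamma> t = \<Lambda>"
    and cov: "is_covariance_density M N \<Lambda> \<Omega>"
    and exp_class: "\<Gamma> \<in> Exp_class"
    and kernel: "\<Gamma> = exp_kernel UNIV A \<beta>"
    and modes: "\<And>d. \<beta> d > 0"
  shows "block_row (\<lambda>j. laplace \<Omega> (\<beta> j)) =
    block_row A **
    block_matrix (\<lambda>i j. (1 / (\<beta> j + \<beta> i)) *\<^sub>R
      (diag \<Lambda> + laplace \<Omega> (\<beta> j) + transpose (laplace \<Omega> (\<beta> i))))"
proof -
  interpret prob_space M using hawkes by (simp add: hawkes_process_def)
  interpret stationary_hawkes M N v \<Lambda> \<Gamma> A \<beta>
    by unfold_locales
      (use hawkes stationary mean cov kernel modes in \<open>auto simp: is_covariance_density_def increment_def\<close>)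
  show ?thesis
    unfolding vec_eq_iff
  proof (intro allI)
    fix i :: 'm and q :: "'d \<times> 'm"
    let ?b = "\<beta> (fst q)"
    \<comment> \<open>The scalar system is evaluated at the mode of the column block; its double sum
      over components and modes becomes one sum over the paired row index of the block
      matrix.\<close>
    have "laplace \<Omega> ?b $ i $ snd q = (\<Sum>p\<in>UNIV. A (fst p) $ i $ snd p *
        ((diag \<Lambda> + laplace \<Omega> ?b + transpose (laplace \<Omega> (\<beta> (fst p)))) $ snd p $ snd q / (?b + \<beta> (fst p))))"
      unfolding laplace_covariance_system[OF cov modes]
      by (subst sum.swap, subst sum.cartesian_product) (simp add: case_prod_unfold)
    then show "block_row (\<lambda>j. laplace \<Omega> (\<beta> j)) $ i $ q = (block_row A **
        block_matrix (\<lambda>i j. (1 / (\<beta> j + \<beta> i)) *\<^sub>R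
          (diag \<Lambda> + laplace \<Omega> (\<beta> j) + transpose (laplace \<Omega> (\<beta> i))))) $ i $ q"
      by (simp only: block_row_def block_matrix_def matrix_matrix_mult_def vec_lambda_beta
          vector_scaleR_component real_scaleR_def times_divide_eq_left mult_1_left)
  qed
qed

end
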